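(* Let $r\ge 3$ be an integer and $T>0$. Let $u=u(x,t)$, 1-periodic in $x$, be the solution, assumed to be sufficiently smooth in $[0,1]\times[0,T]$, of the periodic initial-value problem $$u_t-u_{txx}+3uu_x=2u_xu_{xx}+uu_{xxx},\quad 0\le x\le 1,\ 0\le t\le T,\qquad u(x,0)=u_0(x),\ 0\le x\le 1.$$ For $h=1/N$, let $S_h$ be the space of smooth 1-periodic splines of order $r$ on the uniform mesh of size $h$, and $Q_h$ the quasiinterpolation operator onto $S_h$. Then, for $h$ sufficiently small, the semidiscrete problem of finding $u_h:[0,T]\to S_h$ with $$(u_{ht},\phi)+(u_{htx},\phi')+3(u_hu_{hx},\phi)+\tfrac12(u_{hx}^2,\phi')+(u_hu_{hxx},\phi')=0\qquad\forall\phi\in S_h,\ 0\le t\le T,$$ $$u_h(0)=Q_hu_0,$$ has a unique solution $u_h:[0,T]\to S_h$. Moreover, there exists a constant $C$ independent of $h$ such that $$\max_{0\le t\le T}\|u(t)-u_h(t)\|\le Ch^r .$$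
   Context: Notation: $(\cdot,\cdot)$ and $\|\cdot\|$ are the inner product and norm of $L^2(0,1)$. "Sufficiently smooth" means having as many continuous derivatives (in $x$ and $t$) as needed for the estimate. Periodic splines: for a positive integer $N$ let $h=1/N$, $x_i=ih$, $i=0,\dots,N$, and for an integer $r\ge2$ let $$S_h=\{\phi\in C^{r-2}_{per}[0,1]:\ \phi|_{[x_{i-1},x_i]}\in\mathbb P_{r-1},\ 1\le i\le N\},$$ where $C^{k}_{per}$ denotes 1-periodic $k$-times continuously differentiable functions and $\mathbb P_{r-1}$ the polynomials of degree at most $r-1$. Quasiinterpolant (Thomée–Wendroff): $\{\phi_j\}_{j=1}^N$ denotes a fixed basis of $S_h$, with $\mathrm{supp}(\phi_j)=O(h)$, and for a sufficiently smooth 1-periodic function $v$ one sets $Q_hv=\sum_{j=1}^N v(x_j)\phi_j$. The basis is chosen (as is known to be possible) so that, with constants independent of $h$, for sufficiently smooth 1-periodic $v,w,f,g$ and integers $0\le\nu,\kappa\le r-1$: (0) $\|Q_hv-v\|\le Ch^r\|v^{(r)}\|$; (i) $\|\psi\|\le Ch^{-1}\max_{1\le i\le N}|(\psi,\phi_i)|$ for all $\psi\in S_h$; (ii) $((Q_hw)^{(\nu)},\phi_i^{(\kappa)})=(-1)^\kappa h\,w^{(\nu+\kappa)}(x_i)+O(h^{2r+j-\nu-\kappa})$, $1\le i\le N$, where $j=1$ if $\nu+\kappa$ is even and $j=2$ if $\nu+\kappa$ is odd; (iii) $\max_{1\le i\le N}\big|(f(Q_hg)^{(\nu)},\phi_i^{(\kappa)})-(-1)^\kappa(Q_h[(fg^{(\nu)})^{(\kappa)}],\phi_i)\big|=O(h^{2r+j-\nu-\kappa})$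 with $j$ as in (ii). *)

theory Defs
  imports "HOL-Analysis.Analysis" "HOL-Computational_Algebra.Polynomial"
begin

section \<open>The inner product and norm of \<open>L\<^sup>2(0,1)\<close>\<close>

text \<open>Below these are applied only to functions that are piecewise continuous on the unit interval
  (up to finitely many mesh points, where the highest derivative of a spline need not exist and
  \<open>deriv\<close> is arbitrary). For such functions the integral is the Lebesgue integral.\<close>

definition l2_inner :: "(real \<Rightarrow> real) \<Rightarrow> (real \<Rightarrow> real) \<Rightarrow> real" where
  "l2_inner f g = integral {0..1} (\<lambda>x. f x * g x)"

definition l2_norm :: "(real \<Rightarrow> real) \<Rightarrow> real" where
  "l2_norm f = sqrt (l2_inner f f)"

section \<open>Periodic smooth functions and periodic splines\<close>

text \<open>Functions on the unit interval with periodic smoothness are represented by their 1-periodic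
  extensions to the whole line, so that all derivatives are two-sided.\<close>

definition periodic1 :: "(real \<Rightarrow> real) \<Rightarrow> bool" where
  "periodic1 f \<longleftrightarrow> (\<forall>x. f (x + 1) = f x)"

definition C_per :: "nat \<Rightarrow> (real \<Rightarrow> real) set" where
  "C_per k = {f. periodic1 f \<and>
     (\<forall>j<k. \<forall>x. (deriv ^^ j) f field_differentiable (at x)) \<and>
     continuous_on UNIV ((deriv ^^ k) f)}"

definition splines :: "nat \<Rightarrow> nat \<Rightarrow> (real \<Rightarrow> real) set" where
  "splines r N = {\<phi>. \<phi> \<in> C_per (r - 2) \<and>
     (\<forall>i\<in>{1..N}. \<exists>p :: real poly. degree p \<le> r - 1 \<and>
        (\<forall>x\<in>{(real i - 1) / real N .. real i / real N}. \<phi> x = poly p x))}"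

section \<open>The quasiinterpolant\<close>

text \<open>\<open>\<phi> N 1, \<dots>, \<phi> N N\<close> are the basis functions for the mesh size \<open>h = 1/N\<close>.\<close>

definition is_spline_basis :: "nat \<Rightarrow> nat \<Rightarrow> (nat \<Rightarrow> real \<Rightarrow> real) \<Rightarrow> bool" where
  "is_spline_basis r N b \<longleftrightarrow>
     (\<forall>j\<in>{1..N}. b j \<in> splines r N) \<and>
     (\<forall>\<psi>\<in>splines r N. \<exists>c. \<forall>x. \<psi> x = (\<Sum>j=1..N. c j * b j x)) \<and>
     (\<forall>c. (\<forall>x. (\<Sum>j=1..N. c j * b j x) = 0) \<longrightarrow> (\<forall>j\<in>{1..N}. c j = 0))"

text \<open>The support of each basis function is contained, modulo 1, in an interval of length \<open>K h\<close>.\<close>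

definition small_supports :: "(nat \<Rightarrow> nat \<Rightarrow> real \<Rightarrow> real) \<Rightarrow> bool" where
  "small_supports \<phi> \<longleftrightarrow> (\<exists>K. \<forall>N\<ge>1. \<forall>j\<in>{1..N}. \<exists>a.
     closure {x. \<phi> N j x \<noteq> 0} \<subseteq> (\<Union>n::int. {a + of_int n .. a + of_int n + K * (1 / real N)}))"

definition quasi_interp ::
  "(nat \<Rightarrow> nat \<Rightarrow> real \<Rightarrow> real) \<Rightarrow> nat \<Rightarrow> (real \<Rightarrow> real) \<Rightarrow> real \<Rightarrow> real" where
  "quasi_interp \<phi> N v = (\<lambda>x. \<Sum>j=1..N. v (real j / real N) * \<phi> N j x)"

text \<open>In each of the following properties \<open>m\<close> is the amount of smoothness hidden in the words
  ``sufficiently smooth''.\<close>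

definition approximation_property :: "nat \<Rightarrow> (nat \<Rightarrow> nat \<Rightarrow> real \<Rightarrow> real) \<Rightarrow> bool" where
  "approximation_property r \<phi> \<longleftrightarrow> (\<exists>m C. \<forall>v\<in>C_per m. \<forall>N\<ge>1.
     l2_norm (\<lambda>x. quasi_interp \<phi> N v x - v x)
       \<le> C * (1 / real N) ^ r * l2_norm ((deriv ^^ r) v))"

definition stability_property :: "nat \<Rightarrow> (nat \<Rightarrow> nat \<Rightarrow> real \<Rightarrow> real) \<Rightarrow> bool" where
  "stability_property r \<phi> \<longleftrightarrow> (\<exists>C. \<forall>N\<ge>1. \<forall>\<psi>\<in>splines r N.
     l2_norm \<psi> \<le> C * inverse (1 / real N) * (MAX i\<in>{1..N}. \<bar>l2_inner \<psi> (\<phi> N i)\<bar>))"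

definition parity_gain :: "nat \<Rightarrow> nat" where
  "parity_gain n = (if even n then 1 else 2)"

text \<open>The constants \<open>C\<close> in the next two properties may depend on \<open>w\<close>, respectively on \<open>f\<close> and \<open>g\<close>,
  but not on the mesh size or on \<open>i\<close>. The exponent is positive, as \<open>\<nu> + \<kappa> \<le> 2 * r - 2\<close>.\<close>

definition superconvergence_property :: "nat \<Rightarrow> (nat \<Rightarrow> nat \<Rightarrow> real \<Rightarrow> real) \<Rightarrow> bool" where
  "superconvergence_property r \<phi> \<longleftrightarrow> (\<exists>m. \<forall>\<nu>\<le>r - 1. \<forall>\<kappa>\<le>r - 1. \<forall>w\<in>C_per m.
     \<exists>C. \<forall>N\<ge>1. \<forall>i\<in>{1..N}.
       \<bar>l2_inner ((deriv ^^ \<nu>) (quasi_interp \<phi> N w)) ((deriv ^^ \<kappa>) (\<phi> N i))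
          - (-1) ^ \<kappa> * (1 / real N) * (deriv ^^ (\<nu> + \<kappa>)) w (real i / real N)\<bar>
       \<le> C * (1 / real N) ^ (2 * r + parity_gain (\<nu> + \<kappa>) - (\<nu> + \<kappa>)))"

definition product_superconvergence_property ::
  "nat \<Rightarrow> (nat \<Rightarrow> nat \<Rightarrow> real \<Rightarrow> real) \<Rightarrow> bool" where
  "product_superconvergence_property r \<phi> \<longleftrightarrow>
     (\<exists>m. \<forall>\<nu>\<le>r - 1. \<forall>\<kappa>\<le>r - 1. \<forall>f\<in>C_per m. \<forall>g\<in>C_per m.
     \<exists>C. \<forall>N\<ge>1. \<forall>i\<in>{1..N}.
       \<bar>l2_inner (\<lambda>x. f x * (deriv ^^ \<nu>) (quasi_interp \<phi> N g) x) ((deriv ^^ \<kappa>) (\<phi> N i))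
          - (-1) ^ \<kappa> * l2_inner
              (quasi_interp \<phi> N ((deriv ^^ \<kappa>) (\<lambda>x. f x * (deriv ^^ \<nu>) g x))) (\<phi> N i)\<bar>
       \<le> C * (1 / real N) ^ (2 * r + parity_gain (\<nu> + \<kappa>) - (\<nu> + \<kappa>)))"

definition quasi_interp_basis :: "nat \<Rightarrow> (nat \<Rightarrow> nat \<Rightarrow> real \<Rightarrow> real) \<Rightarrow> bool" where
  "quasi_interp_basis r \<phi> \<longleftrightarrow>
     (\<forall>N\<ge>1. is_spline_basis r N (\<phi> N)) \<and>
     small_supports \<phi> \<and>
     approximation_property r \<phi> \<and>
     stability_property r \<phi> \<and>
     superconvergence_property r \<phi> \<and>
     product_superconvergence_property r \<phi>"

section \<open>The periodic initial-value problem\<close>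

text \<open>Functions of space and time are written \<open>u t x\<close>. Time derivatives at \<open>0\<close> and \<open>T\<close> are
  one-sided.\<close>

definition time_deriv :: "real \<Rightarrow> (real \<Rightarrow> real \<Rightarrow> real) \<Rightarrow> real \<Rightarrow> real \<Rightarrow> real" where
  "time_deriv T u t x = vector_derivative (\<lambda>s. u s x) (at t within {0..T})"

text \<open>\<open>u\<close> is 1-periodic in \<open>x\<close> and has continuous partial derivatives
  \<open>D i j\<close> (\<open>i\<close> times in \<open>t\<close>, \<open>j\<close> times in \<open>x\<close>) of total order up to \<open>k\<close>.\<close>

definition C_per_space_time :: "nat \<Rightarrow> real \<Rightarrow> (real \<Rightarrow> real \<Rightarrow> real) \<Rightarrow> bool" where
  "C_per_space_time k T u \<longleftrightarrow>
     (\<forall>t\<in>{0..T}. periodic1 (u t)) \<and>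
     (\<exists>D :: nat \<Rightarrow> nat \<Rightarrow> real \<Rightarrow> real \<Rightarrow> real.
        (\<forall>t\<in>{0..T}. \<forall>x. D 0 0 t x = u t x) \<and>
        (\<forall>i j. i + j \<le> k \<longrightarrow> continuous_on ({0..T} \<times> UNIV) (\<lambda>(t, x). D i j t x)) \<and>
        (\<forall>i j. i + j < k \<longrightarrow> (\<forall>t\<in>{0..T}. \<forall>x.
           (D i j t has_real_derivative D i (Suc j) t x) (at x) \<and>
           ((\<lambda>s. D i j s x) has_real_derivative D (Suc i) j t x) (at t within {0..T}))))"

definition camassa_holm_solution ::
  "real \<Rightarrow> (real \<Rightarrow> real) \<Rightarrow> (real \<Rightarrow> real \<Rightarrow> real) \<Rightarrow> bool" where
  "camassa_holm_solution T u0 u \<longleftrightarrow>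
     (\<forall>t\<in>{0..T}. \<forall>x\<in>{0..1}.
        time_deriv T u t x - (deriv ^^ 2) (time_deriv T u t) x + 3 * u t x * deriv (u t) x
          = 2 * deriv (u t) x * (deriv ^^ 2) (u t) x + u t x * (deriv ^^ 3) (u t) x) \<and>
     (\<forall>x\<in>{0..1}. u 0 x = u0 x)"

section \<open>The semidiscrete problem\<close>

text \<open>As the spline space is finite-dimensional, differentiability in time of a spline-valued
  function is the same as pointwise differentiability.\<close>

definition semidiscrete_solution ::
  "nat \<Rightarrow> nat \<Rightarrow> real \<Rightarrow> (real \<Rightarrow> real) \<Rightarrow> (real \<Rightarrow> real \<Rightarrow> real) \<Rightarrow> bool" where
  "semidiscrete_solution r N T v uh \<longleftrightarrow>
     (\<forall>t\<in>{0..T}. uh t \<in> splines r N) \<and>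
     (\<forall>t\<in>{0..T}. \<forall>x. (\<lambda>s. uh s x) differentiable (at t within {0..T})) \<and>
     (\<forall>\<phi>\<in>splines r N. \<forall>t\<in>{0..T}.
        l2_inner (time_deriv T uh t) \<phi>
        + l2_inner (deriv (time_deriv T uh t)) (deriv \<phi>)
        + 3 * l2_inner (\<lambda>x. uh t x * deriv (uh t) x) \<phi>
        + 1 / 2 * l2_inner (\<lambda>x. (deriv (uh t) x)\<^sup>2) (deriv \<phi>)
        + l2_inner (\<lambda>x. uh t x * (deriv ^^ 2) (uh t) x) (deriv \<phi>) = 0) \<and>
     uh 0 = v"

end

theory Submission
  imports Defs
begin

text \<open>Testing the weak form of \<open>u\<^sub>t - u\<^sub>t\<^sub>x\<^sub>x\<close> with the unknown itself produces the derivative of the \<open>H\<^sup>1\<close> inner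
  product, while the cubic form \<open>3 (w w', w) + 1/2 (w'\<^sup>2, w') + (w w'', w')\<close> vanishes for periodic \<open>w\<close>.
  So the semidiscrete flow, a quadratic system of ordinary differential equations, conserves the
  \<open>H\<^sup>1\<close> norm and is global. For the same reason the terms cubic in \<open>e = H - u\<^sub>h\<close>, where \<open>H = Q\<^sub>h u\<close>,
  drop out of the energy identity for \<open>e\<close>: no a priori bound on \<open>u\<^sub>h\<close> is needed, and
  Gronwall's inequality reduces the estimate (and uniqueness) to the consistency error
  \<open>(H\<^sub>t, \<chi>) + (H\<^sub>t\<^sub>x, \<chi>') + 3 (H H', \<chi>) + 1/2 (H'\<^sup>2, \<chi>') + (H H'', \<chi>')\<close> being \<open>O(h\<^sup>r) \<parallel>\<chi>\<parallel>\<^sub>1\<close>.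

  With \<open>\<theta> = H - u\<close> that error splits into a part linear in \<open>H\<close>, which by property (iii) is
  \<open>O(h\<^sup>2\<^sup>r\<^sup>-\<^sup>1)\<close> on each basis function and hence \<open>O(h\<^sup>r)\<close> by property (i), and terms quadratic in \<open>\<theta>\<close>,
  which are small by inverse estimates, as \<open>r \<ge> 3\<close>. The constants in (iii) are not assumed uniform
  in the functions; uniformity over \<open>0 \<le> t \<le> T\<close> comes from the uniform boundedness
  principle, applied to each of the two arguments in turn.\<close>

section \<open>Ordinary differential equations\<close>

text \<open>On a cell, passing from an L2 bound to a pointwise bound of the \<open>k\<close>-th
  derivative costs h^(-k-1/2). So \<theta>'' is O(h^(r-5/2)) and \<theta>'^2 is O(h^(2r-3)); from r
  = 3 on the former is bounded and the latter O(h^r). In the linear part the terms free of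
  \<open>H\<close> add up, by the equation and one integration by parts, to (u_t - u_txx, \<chi>),
  and replacing this by (Q_h(u_t - u_txx), \<chi>) costs O(h^r). Each term is now linear in a
  quasiinterpolant; tested with a basis function \<phi>_i it is, up to the error in (iii), a sum
  over the nodes x_j with weights (\<phi>_j, \<phi>_i). The coefficient of each weight is twice the
  residual of the equation at x_j, hence zero. As (i) is about splines and not functionals, the
  linear part is represented by a spline before (i) is used. For uniformity, the errors in (iii)
  divided by h^(r+1) form a family of bilinear functionals of two smooth functions, indexed by mesh
  and basis function and bounded for each pair of functions. The slices of \<open>u\<close> and of
  its time derivative lie in one ball of C^m, so a constant uniform on that ball suffices.\<close>

lemma radial_retraction_lipschitz:
  fixes x y :: "'a::real_normed_vector"
  assumes "R > 0"
  shows "norm ((R / max R (norm x)) *\<^sub>R x - (R / max R (norm y)) *\<^sub>R y) \<le> 2 * norm (x - y)"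
proof -
  define a where "a = R / max R (norm x)"
  define b where "b = R / max R (norm y)"
  have a: "0 < a" "a \<le> 1" and b: "0 < b" "b \<le> 1"
    using assms by (auto simp: a_def b_def divide_simps)
  have by1: "b * norm y \<le> R" using assms by (auto simp: b_def divide_simps max_def)
  have "max R (norm x) > 0" "max R (norm y) > 0" using assms by auto
  \<comment> \<open>The factors differ by \<open>a * b / R\<close> times the difference of the
    maxima, and \<open>b * norm y \<le> R\<close> cancels the division by \<open>R\<close>. Together
    with the term \<open>a * norm (x - y)\<close> this gives the constant 2 in any normed
    space.\<close>
  then have "a - b = a * b * (max R (norm y) - max R (norm x)) / R"
    using assms unfolding a_def b_def by (simp add: field_simps del: max_less_iff_conj less_max_iff_disj)
  then have "\<bar>a - b\<bar> * norm y = a * (b * norm y) * \<bar>max R (norm y) - max R (norm x)\<bar> / R"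
    using a b assms by (simp add: abs_mult)
  also have "\<dots> \<le> 1 * R * norm (x - y) / R"
    using a b assms by1 norm_triangle_ineq3[of y x]
    by (intro divide_right_mono mult_mono) (auto simp: norm_minus_commute)
  finally have 1: "\<bar>a - b\<bar> * norm y \<le> norm (x - y)" using assms by simp
  have "a *\<^sub>R x - b *\<^sub>R y = a *\<^sub>R (x - y) + (a - b) *\<^sub>R y"
    by (simp add: algebra_simps)
  then have "norm (a *\<^sub>R x - b *\<^sub>R y) \<le> a * norm (x - y) + \<bar>a - b\<bar> * norm y"
    using norm_triangle_ineq[of "a *\<^sub>R (x - y)" "(a - b) *\<^sub>R y"] a by simp
  also have "\<dots> \<le> norm (x - y) + norm (x - y)"
    using 1 a by (intro add_mono) (auto simp: mult_left_le_one_le)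
  finally show ?thesis by (simp add: a_def b_def)
qed

text \<open>The exponential weight makes the Picard operator a contraction on the whole interval at once.\<close>

lemma global_lipschitz_ode_exists:
  fixes F :: "'a::banach \<Rightarrow> 'a"
  assumes L: "L \<ge> 0" "\<And>x y. norm (F x - F y) \<le> L * norm (x - y)" and T: "T \<ge> 0"
  obtains c where "c 0 = c0" "\<And>t. t \<in> {0..T} \<Longrightarrow> (c has_vector_derivative F (c t)) (at t within {0..T})"
proof -
  \<comment> \<open>The weight \<open>exp (K * s)\<close> integrates to at most
    \<open>exp (K * t) / K\<close>, so the contraction factor is \<open>L / K\<close>. This choice
    makes it at most 1/2 and keeps \<open>K\<close> positive when \<open>L = 0\<close>.\<close>
  define K where "K = 2 * L + 1"
  have K: "K > 0" using L by (simp add: K_def)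
  have contF: "continuous_on UNIV F"
    using L by (intro lipschitz_on_continuous_on[of L] lipschitz_onI) (auto simp: dist_norm)
  \<comment> \<open>Clamping time to [0,T] extends curves on the interval to bounded continuous
    functions on the line, so that the type of such functions serves as the Banach space.\<close>
  define cl where "cl t = max 0 (min T t)" for t :: real
  have cl: "cl t \<in> {0..T}" for t using T by (auto simp: cl_def)
  have cl_id: "cl t = t" if "t \<in> {0..T}" for t using that by (auto simp: cl_def)
  have cont_cl: "continuous_on UNIV cl" unfolding cl_def by (intro continuous_intros)
  \<comment> \<open>The unknown \<open>v\<close> is the curve multiplied by
    \<open>exp (- K * s)\<close>: its supremum norm is the weighted norm of the curve.\<close>
  define I where "I v t = integral {0..t} (\<lambda>s. F (exp (K * s) *\<^sub>R apply_bcontfun v s))" for v :: "real \<Rightarrow>\<^sub>C 'a" and t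
  define g where "g v t = exp (- K * t) *\<^sub>R (c0 + I v t)" for v :: "real \<Rightarrow>\<^sub>C 'a" and t
  have contFv: "continuous_on S (\<lambda>s. F (exp (K * s) *\<^sub>R apply_bcontfun v s))" for v :: "real \<Rightarrow>\<^sub>C 'a" and S
    by (intro continuous_on_compose2[OF contF] continuous_intros) auto
  have Ider: "(I v has_vector_derivative F (exp (K * t) *\<^sub>R apply_bcontfun v t)) (at t within {0..T})"
    if "t \<in> {0..T}" for v t
    unfolding I_def by (rule integral_has_vector_derivative[OF contFv that])
  have contg: "continuous_on {0..T} (g v)" for v
    unfolding g_def using Ider
    by (intro continuous_intros) (meson continuous_on_eq_continuous_within has_vector_derivative_continuous)
  have contgc: "continuous_on UNIV (\<lambda>t. g v (cl t))" for v
    by (rule continuous_on_compose2[OF contg cont_cl]) (use cl in auto)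
  have bnd: "(\<lambda>t. g v (cl t)) \<in> bcontfun" for v
  proof -
    obtain B where "\<And>t. t \<in> {0..T} \<Longrightarrow> norm (g v t) \<le> B"
      using compact_imp_bounded[OF compact_continuous_image[OF contg compact_Icc]]
      unfolding bounded_iff by fastforce
    then show ?thesis using cl by (intro bcontfun_normI[OF contgc]) auto
  qed
  define G where "G v = Bcontfun (\<lambda>t. g v (cl t))" for v
  have G: "apply_bcontfun (G v) t = g v (cl t)" for v t
    unfolding G_def by (simp add: Bcontfun_inverse bnd)
  have contr: "dist (G v) (G w) \<le> 1/2 * dist v w" for v w
  proof -
    have "norm (apply_bcontfun (G v - G w) x) \<le> 1/2 * norm (v - w)" for x
    proof -
      define t where "t = cl x"
      have t: "t \<in> {0..T}" by (simp add: t_def cl del: atLeastAtMost_iff)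
      have "norm (I v t - I w t) \<le> integral {0..t} (\<lambda>s. L * norm (v - w) * exp (K * s))"
      proof -
        have "I v t - I w t = integral {0..t} (\<lambda>s. F (exp (K * s) *\<^sub>R apply_bcontfun v s) - F (exp (K * s) *\<^sub>R apply_bcontfun w s))"
          unfolding I_def by (intro integral_diff[symmetric] integrable_continuous_interval contFv)
        moreover have "norm (F (exp (K * s) *\<^sub>R apply_bcontfun v s) - F (exp (K * s) *\<^sub>R apply_bcontfun w s)) \<le> L * norm (v - w) * exp (K * s)" for s
        proof -
          have "norm (F (exp (K * s) *\<^sub>R apply_bcontfun v s) - F (exp (K * s) *\<^sub>R apply_bcontfun w s))
            \<le> L * norm (exp (K * s) *\<^sub>R (apply_bcontfun v s - apply_bcontfun w s))"
            using L(2)[of "exp (K * s) *\<^sub>R apply_bcontfun v s" "exp (K * s) *\<^sub>R apply_bcontfun w s"]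
            by (simp add: scaleR_diff_right)
          also have "\<dots> \<le> L * (exp (K * s) * norm (v - w))"
            using L(1) norm_bounded[of "v - w" s] by (intro mult_left_mono) auto
          finally show ?thesis by (simp add: mult_ac)
        qed
        ultimately show ?thesis
          by (simp only:) (intro integral_norm_bound_integral integrable_continuous_interval continuous_on_diff contFv continuous_intros; simp)
      qed
      also have "\<dots> = L * norm (v - w) * (exp (K * t) / K - 1 / K)"
      proof -
        have "((\<lambda>s. L * norm (v - w) * exp (K * s)) has_integral
           L * norm (v - w) * (exp (K * t) / K) - L * norm (v - w) * (exp (K * 0) / K)) {0..t}"
          using t K by (intro fundamental_theorem_of_calculus)
            (auto intro!: derivative_eq_intros simp: has_real_derivative_iff_has_vector_derivative[symmetric])
        then show ?thesis by (simp only: integral_unique) (simp add: right_diff_distrib)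
      qed
      also have "\<dots> \<le> L * norm (v - w) * (exp (K * t) / K)"
        using L K by (intro mult_left_mono) auto
      finally have "exp (- K * t) * norm (I v t - I w t) \<le> exp (- K * t) * (L * norm (v - w) * (exp (K * t) / K))"
        by (intro mult_left_mono) auto
      also have "\<dots> = L / K * norm (v - w)"
        by (simp add: exp_minus field_simps)
      also have "\<dots> \<le> 1/2 * norm (v - w)"
        using K L by (intro mult_right_mono) (auto simp: K_def field_simps)
      finally have "norm (g v t - g w t) \<le> 1/2 * norm (v - w)"
        by (simp add: g_def scaleR_diff_right[symmetric])
      then show ?thesis by (simp add: G t_def)
    qed
    then show ?thesis unfolding dist_norm by (rule norm_bound)
  qed
  obtain v where v: "G v = v"
    using banach_fix_type[of "1/2" G] contr by (auto simp: Ex1_def)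
  define c where "c t = c0 + I v t" for t
  have gv: "apply_bcontfun v t = exp (- K * t) *\<^sub>R c t" if "t \<in> {0..T}" for t
    using G[of v t] v cl_id[OF that] by (simp add: g_def c_def)
  show ?thesis
  proof
    show "c 0 = c0" by (simp add: c_def I_def)
    show "(c has_vector_derivative F (c t)) (at t within {0..T})" if "t \<in> {0..T}" for t
      using Ider[OF that, of v] gv[OF that] unfolding c_def
      by (auto intro!: derivative_eq_intros simp: exp_minus)
  qed
qed

text \<open>The discrete metric makes the bounded functions on the naturals a Banach space, which serves as the
  phase space of systems of variable finite dimension.\<close>

instantiation nat :: metric_space
begin

definition dist_nat :: "nat \<Rightarrow> nat \<Rightarrow> real" where
  "dist_nat m n = \<bar>real m - real n\<bar>"

definition uniformity_nat :: "(nat \<times> nat) filter" where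
  "uniformity_nat = (INF e\<in>{0<..}. principal {(x, y). dist x y < e})"

instance
proof
  show "uniformity = (INF e\<in>{0<..}. principal {(x, y). dist x y < (e :: real)} :: (nat \<times> nat) filter)"
    by (rule uniformity_nat_def)
  have u: "eventually (\<lambda>(x, y :: nat). x = y) uniformity"
    unfolding uniformity_nat_def
    by (rule eventually_INF1[of 1]) (auto simp: eventually_principal dist_nat_def)
  show "open U \<longleftrightarrow> (\<forall>x\<in>U. \<forall>\<^sub>F (x', y) in uniformity. x' = x \<longrightarrow> y \<in> U)" for U :: "nat set"
    using u by (auto simp: open_discrete elim!: eventually_mono)
qed (auto simp: dist_nat_def)

end

instance bcontfun :: (metric_space, banach) banach ..

text \<open>Truncation outside a ball of radius \<open>R\<close> makes the quadratic field globally
  Lipschitz. As the field is homogeneous of degree 2, truncating only multiplies it by a scalar, so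
  the identity \<open>energy\<close> survives and the truncated flow still conserves the sum of
  squares. Its trajectory therefore stays where the truncation does nothing.\<close>

lemma energy_preserving_quadratic_ode:
  fixes \<beta> :: "nat \<Rightarrow> nat \<Rightarrow> nat \<Rightarrow> real" and n :: nat
  assumes energy: "\<And>y. (\<Sum>i<n. \<Sum>k<n. \<Sum>l<n. y i * (y k * y l * \<beta> i k l)) = 0" and T: "T \<ge> 0"
  obtains a :: "real \<Rightarrow> nat \<Rightarrow> real" where "\<And>i. i < n \<Longrightarrow> a 0 i = a0 i"
    "\<And>t i. t \<in> {0..T} \<Longrightarrow> i < n \<Longrightarrow>
      ((\<lambda>s. a s i) has_real_derivative - (\<Sum>k<n. \<Sum>l<n. a t k * a t l * \<beta> i k l)) (at t within {0..T})"
proof -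
  define q where "q i y = - (\<Sum>k<n. \<Sum>l<n. y k * y l * \<beta> i k l)" for i and y :: "nat \<Rightarrow> real"
  have q_scale: "q i (\<lambda>k. s * y k) = s\<^sup>2 * q i y" for i s y
    by (simp add: q_def sum_distrib_left power2_eq_square mult_ac)
  have q_energy: "(\<Sum>i<n. y i * q i y) = 0" for y
    using energy[of y] by (simp add: q_def sum_distrib_left sum_negf)
  define fin where "fin x = Bcontfun (\<lambda>j. if j < n then x j else 0)" for x :: "nat \<Rightarrow> real"
  have mem: "(\<lambda>j. if j < n then x j else 0) \<in> bcontfun" for x :: "nat \<Rightarrow> real"
  proof (rule bcontfun_normI)
    show "norm (if j < n then x j else 0) \<le> (\<Sum>i<n. \<bar>x i\<bar>)" for j
      by (auto intro: member_le_sum[of j "{..<n}" "\<lambda>i. \<bar>x i\<bar>"] sum_nonneg)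
  qed simp
  have fin: "apply_bcontfun (fin x) j = (if j < n then x j else 0)" for x j
    unfolding fin_def by (subst Bcontfun_inverse[OF mem]) simp
  have coord: "\<bar>apply_bcontfun c i\<bar> \<le> norm c" for c :: "nat \<Rightarrow>\<^sub>C real" and i
    using norm_bounded[of c i] by simp
  \<comment> \<open>Adding 1 keeps \<open>R\<close> positive for zero initial data.\<close>
  define R where "R = sqrt (\<Sum>i<n. (a0 i)\<^sup>2) + 1"
  have R: "R > 0" unfolding R_def by (intro add_nonneg_pos real_sqrt_ge_zero sum_nonneg) auto
  have R2: "(\<Sum>i<n. (a0 i)\<^sup>2) \<le> R\<^sup>2"
  proof -
    have "(\<Sum>i<n. (a0 i)\<^sup>2) = (sqrt (\<Sum>i<n. (a0 i)\<^sup>2))\<^sup>2" by (simp add: sum_nonneg)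
    also have "\<dots> \<le> R\<^sup>2" unfolding R_def by (intro power_mono real_sqrt_ge_zero sum_nonneg) auto
    finally show ?thesis .
  qed
  define s where "s c = R / max R (norm c)" for c :: "nat \<Rightarrow>\<^sub>C real"
  define F where "F c = fin (\<lambda>i. q i (\<lambda>k. s c * apply_bcontfun c k))" for c
  \<comment> \<open>A product of two truncated coordinates changes by at most
    \<open>R * 2 + R * 2\<close> times \<open>norm (c - d)\<close>; summing over \<open>i\<close>
    bounds all coordinates at once.\<close>
  define L where "L = (\<Sum>i<n. \<Sum>k<n. \<Sum>l<n. 4 * R * \<bar>\<beta> i k l\<bar>)"
  have L0: "0 \<le> L" unfolding L_def using R by (intro sum_nonneg) auto
  have lip: "norm (F c - F d) \<le> L * norm (c - d)" for c d
  proof (rule norm_bound)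
    fix j
    have s1: "\<bar>s b * apply_bcontfun b k\<bar> \<le> R" for b k
    proof -
      have "\<bar>s b * apply_bcontfun b k\<bar> = s b * \<bar>apply_bcontfun b k\<bar>" using R by (simp add: s_def abs_mult)
      also have "\<dots> \<le> s b * max R (norm b)"
        using R coord[of b k] by (intro mult_left_mono) (auto simp: s_def)
      also have "\<dots> = R"
      proof -
        have "0 < max R (norm b)" using R by (simp add: less_max_iff_disj)
        then have "max R (norm b) \<noteq> 0" by linarith
        then show ?thesis unfolding s_def times_divide_eq_left by (rule nonzero_mult_div_cancel_right)
      qed
      finally show ?thesis .
    qed
    have s2: "\<bar>s c * apply_bcontfun c k - s d * apply_bcontfun d k\<bar> \<le> 2 * norm (c - d)" for k
      using coord[of "s c *\<^sub>R c - s d *\<^sub>R d" k] radial_retraction_lipschitz[OF R, of c d]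
      by (simp add: s_def)
    have s3: "\<bar>(s c * apply_bcontfun c k) * (s c * apply_bcontfun c l) - (s d * apply_bcontfun d k) * (s d * apply_bcontfun d l)\<bar>
        \<le> 4 * R * norm (c - d)" for k l
    proof -
      define x y x' y' where "x = s c * apply_bcontfun c k" and "y = s c * apply_bcontfun c l"
        and "x' = s d * apply_bcontfun d k" and "y' = s d * apply_bcontfun d l"
      have "x * y - x' * y' = x * (y - y') + y' * (x - x')" by (simp add: algebra_simps)
      then have "\<bar>x * y - x' * y'\<bar> \<le> \<bar>x\<bar> * \<bar>y - y'\<bar> + \<bar>y'\<bar> * \<bar>x - x'\<bar>"
        by (simp flip: abs_mult)
      also have "\<dots> \<le> R * (2 * norm (c - d)) + R * (2 * norm (c - d))"
        using R s1[of c k] s1[of d l] s2[of k] s2[of l]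
        by (intro add_mono mult_mono) (auto simp: x_def y_def x'_def y'_def)
      finally show ?thesis by (simp add: x_def y_def x'_def y'_def)
    qed
    have "\<bar>apply_bcontfun (F c - F d) j\<bar> \<le> (\<Sum>k<n. \<Sum>l<n. 4 * R * norm (c - d) * \<bar>\<beta> j k l\<bar>)"
    proof (cases "j < n")
      case True
      have "apply_bcontfun (F c - F d) j = - (\<Sum>k<n. \<Sum>l<n. ((s c * apply_bcontfun c k) * (s c * apply_bcontfun c l)
          - (s d * apply_bcontfun d k) * (s d * apply_bcontfun d l)) * \<beta> j k l)"
        using True by (simp only: F_def minus_bcontfun.rep_eq fin q_def if_True left_diff_distrib sum_subtractf)
      also have "\<bar>\<dots>\<bar> \<le> (\<Sum>k<n. \<Sum>l<n. 4 * R * norm (c - d) * \<bar>\<beta> j k l\<bar>)"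
        unfolding abs_minus_cancel
        by (intro order_trans[OF sum_abs] sum_mono) (simp only: abs_mult, intro mult_right_mono s3 abs_ge_zero)
      finally show ?thesis .
    qed (use R in \<open>auto simp: F_def fin intro!: sum_nonneg\<close>)
    also have "\<dots> = (\<Sum>k<n. \<Sum>l<n. 4 * R * \<bar>\<beta> j k l\<bar>) * norm (c - d)"
      by (simp add: sum_distrib_left sum_distrib_right mult_ac)
    finally have *: "\<bar>apply_bcontfun (F c - F d) j\<bar> \<le> (\<Sum>k<n. \<Sum>l<n. 4 * R * \<bar>\<beta> j k l\<bar>) * norm (c - d)" .
    show "norm (apply_bcontfun (F c - F d) j) \<le> L * norm (c - d)"
    proof (cases "j < n")
      case True
      then have "(\<Sum>k<n. \<Sum>l<n. 4 * R * \<bar>\<beta> j k l\<bar>) \<le> L"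
        unfolding L_def using R by (intro member_le_sum[of j "{..<n}" "\<lambda>i. \<Sum>k<n. \<Sum>l<n. 4 * R * \<bar>\<beta> i k l\<bar>"]) (auto intro!: sum_nonneg)
      then have "(\<Sum>k<n. \<Sum>l<n. 4 * R * \<bar>\<beta> j k l\<bar>) * norm (c - d) \<le> L * norm (c - d)" by (rule mult_right_mono) simp
      then show ?thesis using * by simp
    qed (use L0 in \<open>simp add: F_def fin\<close>)
  qed
  obtain c where c0: "c 0 = fin a0"
    and c: "\<And>t. t \<in> {0..T} \<Longrightarrow> (c has_vector_derivative F (c t)) (at t within {0..T})"
    by (rule global_lipschitz_ode_exists[where F = F and L = L and ?c0.0 = "fin a0" and T = T, OF L0 lip T]) blast
  define a where "a t i = apply_bcontfun (c t) i" for t i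
  have bl: "bounded_linear (\<lambda>c :: nat \<Rightarrow>\<^sub>C real. apply_bcontfun c i)" for i
    by (rule bounded_linear_intro[where K = 1]) (use coord in \<open>auto\<close>)
  have der: "((\<lambda>s. a s i) has_real_derivative apply_bcontfun (F (c t)) i) (at t within {0..T})" if "t \<in> {0..T}" for t i
    unfolding a_def has_real_derivative_iff_has_vector_derivative
    by (rule bounded_linear.has_vector_derivative[OF bl c[OF that]])
  have der': "((\<lambda>s. a s i) has_real_derivative (s (c t))\<^sup>2 * q i (a t)) (at t within {0..T})" if "t \<in> {0..T}" "i < n" for t i
    using der[OF that(1), of i] that(2) unfolding a_def by (simp add: F_def fin q_scale)
  \<comment> \<open>The norm of the phase space sees all naturals, so the coordinates from
    \<open>n\<close> on must be shown to stay zero.\<close>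
  have zero: "a t i = 0" if "t \<in> {0..T}" "i \<ge> n" for t i
  proof -
    have "\<exists>k. \<forall>t\<in>{0..T}. a t i = k"
      by (rule has_field_derivative_zero_constant) (use der[of _ i] that(2) in \<open>auto simp: F_def fin\<close>)
    moreover have "a 0 i = 0" using that(2) by (simp add: a_def c0 fin)
    ultimately show ?thesis using that(1) T by (metis atLeastAtMost_iff order_refl)
  qed
  have conserved: "(\<Sum>i<n. (a t i)\<^sup>2) = (\<Sum>i<n. (a0 i)\<^sup>2)" if "t \<in> {0..T}" for t
  proof -
    have "\<exists>k. \<forall>t\<in>{0..T}. (\<Sum>i<n. (a t i)\<^sup>2) = k"
    proof (rule has_field_derivative_zero_constant)
      fix t assume t: "t \<in> {0..T}"
      have "((\<lambda>t. \<Sum>i<n. (a t i)\<^sup>2) has_real_derivative (\<Sum>i<n. 2 * a t i * ((s (c t))\<^sup>2 * q i (a t)))) (at t within {0..T})"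
      proof (rule DERIV_sum)
        fix i assume "i \<in> {..<n}"
        then show "((\<lambda>t. (a t i)\<^sup>2) has_real_derivative 2 * a t i * ((s (c t))\<^sup>2 * q i (a t))) (at t within {0..T})"
          using der'[OF t, of i] by (auto intro!: derivative_eq_intros)
      qed
      moreover have "(\<Sum>i<n. 2 * a t i * ((s (c t))\<^sup>2 * q i (a t))) = 2 * (s (c t))\<^sup>2 * (\<Sum>i<n. a t i * q i (a t))"
        by (simp add: sum_distrib_left mult_ac)
      ultimately show "((\<lambda>t. \<Sum>i<n. (a t i)\<^sup>2) has_real_derivative 0) (at t within {0..T})"
        by (simp add: q_energy)
    qed simp
    moreover have "(\<Sum>i<n. (a 0 i)\<^sup>2) = (\<Sum>i<n. (a0 i)\<^sup>2)" by (simp add: a_def c0 fin)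
    ultimately show ?thesis using that T by (metis atLeastAtMost_iff order_refl)
  qed
  \<comment> \<open>The supremum norm is at most the Euclidean one, which is conserved and below
    \<open>R\<close>: the truncation is inactive along the trajectory.\<close>
  have "norm (c t) \<le> R" if t: "t \<in> {0..T}" for t
  proof (rule norm_bound)
    fix i
    show "norm (apply_bcontfun (c t) i) \<le> R"
    proof (cases "i < n")
      case True
      then have "(a t i)\<^sup>2 \<le> (\<Sum>i<n. (a t i)\<^sup>2)" by (intro member_le_sum) auto
      then have "(a t i)\<^sup>2 \<le> R\<^sup>2" using conserved[OF t] R2 by simp
      then have "\<bar>a t i\<bar> \<le> R" using R by (simp add: abs_le_square_iff[symmetric])
      then show ?thesis by (simp add: a_def)
    next
      case False
      then show ?thesis using zero[OF t, of i] R by (simp add: a_def)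
    qed
  qed
  then have s1: "s (c t) = 1" if "t \<in> {0..T}" for t
    using R max_absorb1[of "norm (c t)" R] that unfolding s_def by auto
  show ?thesis
  proof (rule that[of a])
    show "a 0 i = a0 i" if "i < n" for i using that by (simp add: a_def c0 fin)
    show "((\<lambda>s. a s i) has_real_derivative - (\<Sum>k<n. \<Sum>l<n. a t k * a t l * \<beta> i k l)) (at t within {0..T})"
      if "t \<in> {0..T}" "i < n" for t i
      using der'[OF that] s1[OF that(1)] by (simp add: q_def)
  qed
qed

text \<open>With the integrating factor, \<open>exp (- L * t) * y t - a * t\<close> has a
  nonpositive derivative, because \<open>exp (- L * s) \<le> 1\<close> for
  \<open>s \<ge> 0\<close>.\<close>

lemma gronwall_affine:
  fixes y :: "real \<Rightarrow> real"
  assumes y: "\<And>t. t \<in> {0..T} \<Longrightarrow> (y has_real_derivative y' t) (at t within {0..T})"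
    and le: "\<And>t. t \<in> {0..T} \<Longrightarrow> y' t \<le> a + L * y t" and y0: "y 0 = 0" and a: "0 \<le> a" and L: "0 \<le> L"
    and t: "t \<in> {0..T}"
  shows "y t \<le> a * T * exp (L * T)"
proof -
  define z where "z t = exp (- L * t) * y t - a * t" for t
  define z' where "z' t = exp (- L * t) * (y' t - L * y t) - a" for t
  have dz: "(z has_real_derivative z' s) (at s within {0..t})" if s: "s \<in> {0..t}" for s
  proof -
    have "(z has_real_derivative z' s) (at s within {0..T})"
      unfolding z_def[abs_def] z'_def using y[of s] s t
      by (auto intro!: derivative_eq_intros simp: algebra_simps)
    then show ?thesis by (rule DERIV_subset) (use t in auto)
  qed
  have nonpos: "z' s \<le> 0" if "s \<in> {0..t}" for s
  proof -
    have "exp (- L * s) * (y' s - L * y s) \<le> exp (- L * s) * a"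
      using le[of s] that t by (intro mult_left_mono) auto
    also have "\<dots> \<le> 1 * a" using L a that by (intro mult_right_mono) auto
    finally show ?thesis by (simp add: z'_def)
  qed
  have "\<exists>s\<in>{0..t}. z t - z 0 = z' s * (t - 0)"
  proof (rule mvt_very_simple)
    show "0 \<le> t" using t by simp
    fix s assume "0 \<le> s" "s \<le> t"
    then show "(z has_derivative (*) (z' s)) (at s within {0..t})"
      using dz[of s] by (simp add: has_field_derivative_def)
  qed
  then obtain s where s: "s \<in> {0..t}" "z t - z 0 = z' s * t" by auto
  have "z' s * t \<le> 0" using nonpos[OF s(1)] t by (simp add: mult_nonpos_nonneg)
  then have "exp (- L * t) * y t \<le> a * t" using s(2) y0 by (simp add: z_def)
  then have "exp (L * t) * (exp (- L * t) * y t) \<le> exp (L * t) * (a * t)" by (rule mult_left_mono) simp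
  moreover have "exp (L * t) * (exp (- L * t) * y t) = y t" by (simp add: exp_minus)
  ultimately have "y t \<le> exp (L * t) * (a * t)" by linarith
  also have "\<dots> \<le> exp (L * T) * (a * T)" using t L a by (intro mult_mono) (auto intro: mult_left_mono)
  finally show ?thesis by (simp add: mult_ac)
qed

section \<open>Smooth periodic functions and uniform boundedness\<close>

lemma C_perD:
  assumes "f \<in> C_per m"
  shows "periodic1 f"
    "j < m \<Longrightarrow> ((deriv ^^ j) f has_real_derivative (deriv ^^ Suc j) f x) (at x)"
    "continuous_on UNIV ((deriv ^^ m) f)"
  using assms by (auto simp: C_per_def DERIV_deriv_iff_field_differentiable)

text \<open>Iterates of \<open>deriv\<close> are computed by guessing: an explicit chain
  \<open>D\<close> of derivatives certifies the smoothness and, by uniqueness of the derivative,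
  gives the values.\<close>

lemma C_perI:
  assumes "periodic1 f" "D 0 = f"
    and D: "\<And>j x. j < m \<Longrightarrow> (D j has_real_derivative D (Suc j) x) (at x)"
    and "continuous_on UNIV (D m)"
  shows "f \<in> C_per m" "j \<le> m \<Longrightarrow> (deriv ^^ j) f = D j"
proof -
  have eq: "(deriv ^^ j) f = D j" if "j \<le> m" for j
    using that
  proof (induction j)
    case (Suc j)
    then have "(deriv ^^ Suc j) f = deriv (D j)" by simp
    also have "\<dots> = D (Suc j)" using D[of j] Suc.prems by (auto intro: DERIV_imp_deriv)
    finally show ?case .
  qed (use assms in simp)
  have "(deriv ^^ j) f field_differentiable at x" if "j < m" for j x
    using D[OF that, of x] eq[of j] that unfolding field_differentiable_def by auto
  then show "f \<in> C_per m"
    using assms(1,4) eq[of m] by (simp add: C_per_def)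
  show "j \<le> m \<Longrightarrow> (deriv ^^ j) f = D j" by (rule eq)
qed

lemma C_per_continuous:
  assumes "f \<in> C_per m" "j \<le> m"
  shows "continuous_on UNIV ((deriv ^^ j) f)"
proof (cases "j = m")
  case False
  then show ?thesis using C_perD(2)[OF assms(1), of j] assms(2)
    by (intro continuous_at_imp_continuous_on ballI) (rule DERIV_isCont, simp)
qed (use C_perD assms in auto)

lemma C_per_mono:
  assumes "f \<in> C_per m" "k \<le> m"
  shows "f \<in> C_per k"
  using C_per_continuous[OF assms] assms by (simp add: C_per_def)

lemma periodic1_deriv:
  assumes "periodic1 f" "\<And>x. (f has_real_derivative f' x) (at x)"
  shows "periodic1 f'"
proof -
  have "f' (x + 1) = f' x" for x
  proof -
    have "(f has_real_derivative f' (x + 1)) (at (x + 1))" by (rule assms)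
    then have "((\<lambda>x. f (x + 1)) has_real_derivative f' (x + 1)) (at x)"
      by (simp add: DERIV_shift)
    then have "(f has_real_derivative f' (x + 1)) (at x)"
      using assms(1) by (simp add: periodic1_def)
    then show ?thesis using assms(2) DERIV_unique by blast
  qed
  then show ?thesis by (simp add: periodic1_def)
qed

lemma C_per_periodic_deriv:
  assumes "f \<in> C_per m" "j \<le> m"
  shows "periodic1 ((deriv ^^ j) f)"
  using assms(2)
proof (induction j)
  case (Suc j)
  then show ?case
    using periodic1_deriv[of "(deriv ^^ j) f" "(deriv ^^ Suc j) f"] C_perD(2)[OF assms(1), of j] by auto
qed (use C_perD[OF assms(1)] in auto)

lemma periodic1_shift_int:
  assumes "periodic1 f"
  shows "f (x + of_int n) = f x"
proof -
  have 1: "f (x + real k) = f x" for k x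
  proof (induction k)
    case (Suc k)
    have "f ((x + real k) + 1) = f (x + real k)" using assms unfolding periodic1_def by blast
    then show ?case using Suc by (simp add: add_ac)
  qed simp
  show ?thesis
  proof (cases "n \<ge> 0")
    case True
    then show ?thesis using 1[of x "nat n"] by simp
  next
    case False
    then show ?thesis using 1[of "x + of_int n" "nat (- n)"] by simp
  qed
qed

lemma periodic1_reduce:
  assumes "periodic1 f"
  obtains y where "y \<in> {0..<1}" "f x = f y"
proof (rule that[of "frac x"])
  show "frac x \<in> {0..<1}" by (auto simp: frac_lt_1)
  show "f x = f (frac x)"
    using periodic1_shift_int[OF assms, of "frac x" "\<lfloor>x\<rfloor>"] by (simp add: frac_def)
qed

lemma periodic1_continuous_bounded:
  assumes "periodic1 f" "continuous_on UNIV f"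
  obtains B where "\<And>x. \<bar>f x\<bar> \<le> B"
proof -
  have "bounded (f ` {0..1})"
    by (intro compact_imp_bounded compact_continuous_image continuous_on_subset[OF assms(2)]) auto
  then obtain B where B: "\<And>x. x \<in> {0..1} \<Longrightarrow> \<bar>f x\<bar> \<le> B"
    unfolding bounded_iff real_norm_def by blast
  show ?thesis
  proof (rule that)
    show "\<bar>f x\<bar> \<le> B" for x
      by (rule periodic1_reduce[OF assms(1), of x]) (use B in auto)
  qed
qed

text \<open>The ball of radius \<open>M\<close> in the C^m norm. Constants are made uniform over
  such balls, since all time slices of the solution lie in one of them.\<close>

definition CB :: "nat \<Rightarrow> real \<Rightarrow> (real \<Rightarrow> real) set" where
  "CB m M = {f \<in> C_per m. \<forall>j\<le>m. \<forall>x. \<bar>(deriv ^^ j) f x\<bar> \<le> M}"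

lemma CB_mono:
  assumes "f \<in> CB m M" "k \<le> m" "M \<le> M'"
  shows "f \<in> CB k M'"
proof -
  have "\<bar>(deriv ^^ j) f x\<bar> \<le> M'" if "j \<le> k" for j x
    using assms that order_trans[of "\<bar>(deriv ^^ j) f x\<bar>" M M'] by (simp add: CB_def)
  then show ?thesis using assms C_per_mono[of f m k] by (simp add: CB_def)
qed

lemma CB_nonneg: "f \<in> CB m M \<Longrightarrow> 0 \<le> M"
  using order_trans[OF abs_ge_zero, of "f 0" M] by (auto simp: CB_def dest: spec[of _ 0])

lemma C_per_in_CB:
  assumes "f \<in> C_per m"
  obtains M where "M > 0" "f \<in> CB m M"
proof -
  have "\<exists>B. \<forall>x. \<bar>(deriv ^^ j) f x\<bar> \<le> B" if "j \<le> m" for j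
    using periodic1_continuous_bounded[OF C_per_periodic_deriv[OF assms that] C_per_continuous[OF assms that]]
    by metis
  then obtain B where B: "\<And>j x. j \<le> m \<Longrightarrow> \<bar>(deriv ^^ j) f x\<bar> \<le> B j" by metis
  define M where "M = 1 + (\<Sum>j\<le>m. \<bar>B j\<bar>)"
  have "\<bar>(deriv ^^ j) f x\<bar> \<le> M" if "j \<le> m" for j x
    using B[OF that, of x] member_le_sum[of j "{..m}" "\<lambda>j. \<bar>B j\<bar>"] that by (auto simp: M_def)
  moreover have "M > 0" unfolding M_def by (intro add_pos_nonneg sum_nonneg) auto
  ultimately show ?thesis using assms that by (auto simp: CB_def)
qed

lemma C_per_lincomb:
  assumes "f \<in> C_per m" "g \<in> C_per m"
  shows "(\<lambda>x. a * f x + b * g x) \<in> C_per m"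
    "j \<le> m \<Longrightarrow> (deriv ^^ j) (\<lambda>x. a * f x + b * g x) = (\<lambda>x. a * (deriv ^^ j) f x + b * (deriv ^^ j) g x)"
proof -
  note * = C_perI[where D = "\<lambda>j x. a * (deriv ^^ j) f x + b * (deriv ^^ j) g x"
      and f = "\<lambda>x. a * f x + b * g x" and m = m]
  have P: "periodic1 (\<lambda>x. a * f x + b * g x)"
    using C_perD(1)[OF assms(1)] C_perD(1)[OF assms(2)] by (auto simp: periodic1_def)
  have D: "((\<lambda>x. a * (deriv ^^ j) f x + b * (deriv ^^ j) g x) has_real_derivative
      a * (deriv ^^ Suc j) f x + b * (deriv ^^ Suc j) g x) (at x)" if "j < m" for j x
    using C_perD(2)[OF assms(1) that, of x] C_perD(2)[OF assms(2) that, of x]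
    by (intro DERIV_add DERIV_cmult)
  have C: "continuous_on UNIV (\<lambda>x. a * (deriv ^^ m) f x + b * (deriv ^^ m) g x)"
    using assms by (intro continuous_intros C_perD(3))
  show "(\<lambda>x. a * f x + b * g x) \<in> C_per m"
    by (rule *(1)) (use P D C in auto)
  show "j \<le> m \<Longrightarrow> (deriv ^^ j) (\<lambda>x. a * f x + b * g x) = (\<lambda>x. a * (deriv ^^ j) f x + b * (deriv ^^ j) g x)"
    by (rule *(2)) (use P D C in auto)
qed

lemma C_per_cmult:
  assumes "f \<in> C_per m"
  shows "(\<lambda>x. a * f x) \<in> C_per m"
    "j \<le> m \<Longrightarrow> (deriv ^^ j) (\<lambda>x. a * f x) = (\<lambda>x. a * (deriv ^^ j) f x)"
  using C_per_lincomb[OF assms assms, where a = a and b = 0] by auto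

lemma C_per_add_cmult:
  assumes "f \<in> C_per m" "g \<in> C_per m"
  shows "(\<lambda>x. f x + c * g x) \<in> C_per m"
    "j \<le> m \<Longrightarrow> (deriv ^^ j) (\<lambda>x. f x + c * g x) = (\<lambda>x. (deriv ^^ j) f x + c * (deriv ^^ j) g x)"
  using C_per_lincomb[OF assms, where a = 1 and b = c] by auto

lemma CB_scale:
  assumes "f \<in> CB m M" "M > 0"
  shows "(\<lambda>x. (1 / M) * f x) \<in> CB m 1"
proof -
  have f: "f \<in> C_per m" using assms by (simp add: CB_def)
  have "\<bar>(deriv ^^ j) (\<lambda>x. (1 / M) * f x) x\<bar> \<le> 1" if "j \<le> m" for j x
    unfolding C_per_cmult(2)[OF f that] using assms that by (simp add: CB_def abs_mult)
  then show ?thesis using C_per_cmult(1)[OF f] unfolding CB_def by blast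
qed

text \<open>Termwise differentiation and the Weierstrass test. This is completeness of C^m in the
  form that the gliding hump uses: absolutely convergent combinations of elements of the unit
  ball.\<close>

lemma CB_series:
  assumes s: "\<And>k::nat. s k \<in> CB m 1" and a: "summable (\<lambda>k. \<bar>a k\<bar>)"
  shows "(\<lambda>x. \<Sum>k. a k * s k x) \<in> CB m (\<Sum>k. \<bar>a k\<bar>)"
proof -
  define D where "D j x = (\<Sum>k. a k * (deriv ^^ j) (s k) x)" for j x
  have sC: "s k \<in> C_per m" for k using s by (auto simp: CB_def)
  have le: "norm (a k * (deriv ^^ j) (s k) x) \<le> \<bar>a k\<bar>" if "j \<le> m" for j k x
    using s[of k] that by (auto simp: CB_def abs_mult intro: mult_left_le)
  have summ: "summable (\<lambda>k. a k * (deriv ^^ j) (s k) x)" if "j \<le> m" for j x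
    by (rule summable_comparison_test'[OF a]) (rule le[OF that])
  have P: "periodic1 (\<lambda>x. \<Sum>k. a k * s k x)"
    using C_perD(1)[OF sC] by (auto simp: periodic1_def)
  have Dj: "(D j has_real_derivative D (Suc j) x) (at x)" if "j < m" for j x
    unfolding D_def
  proof (rule has_field_derivative_series'(2)[where S = UNIV])
    show "uniformly_convergent_on UNIV (\<lambda>n x. \<Sum>i<n. a i * (deriv ^^ Suc j) (s i) x)"
      by (rule Weierstrass_m_test'[OF _ a]) (rule le, use that in simp)
    show "((\<lambda>x. a n * (deriv ^^ j) (s n) x) has_real_derivative a n * (deriv ^^ Suc j) (s n) x) (at x within UNIV)" for n x
      using C_perD(2)[OF sC that] by (intro DERIV_cmult) auto
    show "summable (\<lambda>n. a n * (deriv ^^ j) (s n) 0)" using summ that by auto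
  qed auto
  have cont: "continuous_on UNIV (D m)"
  proof (rule uniform_limit_theorem)
    show "uniform_limit UNIV (\<lambda>n x. \<Sum>i<n. a i * (deriv ^^ m) (s i) x) (D m) sequentially"
      unfolding D_def by (rule Weierstrass_m_test[OF _ a]) (rule le, simp)
    show "\<forall>\<^sub>F n in sequentially. continuous_on UNIV (\<lambda>x. \<Sum>i<n. a i * (deriv ^^ m) (s i) x)"
      using sC by (intro always_eventually allI continuous_intros C_perD(3))
  qed auto
  note * = C_perI[where D = D and m = m, OF P _ Dj cont]
  have D0: "D 0 = (\<lambda>x. \<Sum>k. a k * s k x)" by (simp add: D_def fun_eq_iff)
  have "\<bar>D j x\<bar> \<le> (\<Sum>k. \<bar>a k\<bar>)" if "j \<le> m" for j x
  proof -
    have sn: "summable (\<lambda>k. norm (a k * (deriv ^^ j) (s k) x))"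
      by (rule summable_comparison_test'[OF a, of 0]) (use le[OF that, of _ x] in simp)
    show ?thesis
      using order_trans[OF summable_norm[OF sn] suminf_le[OF le[OF that, of _ x] sn a]]
      by (simp add: D_def)
  qed
  then show ?thesis using *[OF D0] by (auto simp: CB_def)
qed

text \<open>Sokal's gliding hump argument: the signs are chosen so that the \<open>k\<close>-th partial sum keeps the
  full size of its last term under the \<open>k\<close>-th functional.\<close>

lemma uniform_boundedness_C_per:
  fixes l :: "'i \<Rightarrow> (real \<Rightarrow> real) \<Rightarrow> real"
  assumes lin: "\<And>i f g c. i \<in> I \<Longrightarrow> f \<in> C_per m \<Longrightarrow> g \<in> C_per m \<Longrightarrow> l i (\<lambda>x. f x + c * g x) = l i f + c * l i g"
    and bdd: "\<And>i. i \<in> I \<Longrightarrow> \<exists>K. \<forall>f\<in>CB m 1. \<bar>l i f\<bar> \<le> K"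
    and pt: "\<And>f. f \<in> C_per m \<Longrightarrow> \<exists>K. \<forall>i\<in>I. \<bar>l i f\<bar> \<le> K"
  shows "\<exists>C. \<forall>i\<in>I. \<forall>f\<in>CB m 1. \<bar>l i f\<bar> \<le> C"
proof (rule ccontr)
  assume neg: "\<not> ?thesis"
  have CBC: "f \<in> C_per m" if "f \<in> CB m M" for f M using that by (simp add: CB_def)
  have ne: "CB m 1 \<noteq> {}" using neg by auto
  define S where "S i = (SUP f\<in>CB m 1. \<bar>l i f\<bar>)" for i
  have bdda: "bdd_above ((\<lambda>f. \<bar>l i f\<bar>) ` CB m 1)" if "i \<in> I" for i
    using bdd[OF that] by (auto simp: bdd_above_def)
  have S: "\<bar>l i f\<bar> \<le> S i" if "i \<in> I" "f \<in> CB m 1" for i f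
    unfolding S_def by (rule cSUP_upper[OF that(2) bdda[OF that(1)]])
  \<comment> \<open>The functional norms \<open>S i\<close> are unbounded, so they exceed any
    \<open>4 ^ k\<close>, and each is approached on the unit ball up to the factor 3/4.\<close>
  have "\<exists>i f. i \<in> I \<and> f \<in> CB m 1 \<and> 4 ^ k \<le> S i \<and> 3/4 * S i < \<bar>l i f\<bar>" for k :: nat
  proof -
    obtain i f where i: "i \<in> I" "f \<in> CB m 1" "\<bar>l i f\<bar> > 4 ^ k" using neg by (meson not_le)
    then have "4 ^ k \<le> S i" using S[of i f] by simp
    moreover have "S i > 0" using \<open>4 ^ k \<le> S i\<close> using zero_less_power[of "4::real" k] by linarith
    then have "3/4 * S i < S i" by simp
    then obtain g where "g \<in> CB m 1" "3/4 * S i < \<bar>l i g\<bar>"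
      using less_cSUP_iff[OF ne bdda[OF i(1)], of "3/4 * S i"] by (auto simp: S_def)
    ultimately show ?thesis using i by blast
  qed
  then obtain n f where n: "\<And>k::nat. n k \<in> I" and f: "\<And>k::nat. f k \<in> CB m 1"
    and Sn: "\<And>k::nat. 4 ^ k \<le> S (n k)" and big: "\<And>k::nat. 3/4 * S (n k) < \<bar>l (n k) (f k)\<bar>"
    by metis
  \<comment> \<open>With ratio 1/3, the series after step \<open>k\<close> has total weight
    \<open>q k / 2\<close>, less than the fraction 3/4 of \<open>q k\<close> that step
    \<open>k\<close> achieves, while \<open>q k * 4 ^ k\<close> still grows.\<close>
  define q :: "nat \<Rightarrow> real" where "q k = (1/3) ^ k" for k
  define nxt where "nxt k y = (if \<bar>l (n k) (\<lambda>t. y t + q k * f k t)\<bar> \<ge> q k * \<bar>l (n k) (f k)\<bar>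
     then q k else - q k)" for k y
  define x where "x = rec_nat (\<lambda>_. 0) (\<lambda>k y. (\<lambda>t. y t + nxt k y * f k t))"
  define a where "a k = nxt k (x k)" for k
  have x0: "x 0 = (\<lambda>_. 0)" and xS: "x (Suc k) = (\<lambda>t. x k t + a k * f k t)" for k
    by (simp_all add: x_def a_def)
  have abs_a: "\<bar>a k\<bar> = q k" for k by (simp add: a_def nxt_def q_def)
  have xC: "x k \<in> C_per m" for k
  proof (induction k)
    case 0
    show ?case using C_per_cmult(1)[OF CBC[OF f[of 0]], where a = 0] by (simp add: x0)
  qed (simp add: xS C_per_add_cmult(1) CBC[OF f])
  have xsum: "x k t = (\<Sum>i<k. a i * f i t)" for k t
    by (induction k) (simp_all add: x0 xS)
  \<comment> \<open>One of a + b and a - b has modulus at least that of b, so one of the two signs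
    keeps the size of the new term, whatever the previous partial sum is.\<close>
  have hump: "q k * \<bar>l (n k) (f k)\<bar> \<le> \<bar>l (n k) (x (Suc k))\<bar>" for k
  proof -
    have e: "l (n k) (\<lambda>t. x k t + c * f k t) = l (n k) (x k) + c * l (n k) (f k)" for c
      by (rule lin[OF n xC CBC[OF f]])
    have q: "q k > 0" by (simp add: q_def)
    show ?thesis
    proof (cases "\<bar>l (n k) (x k) + q k * l (n k) (f k)\<bar> \<ge> q k * \<bar>l (n k) (f k)\<bar>")
      case False
      moreover have "q k * \<bar>l (n k) (f k)\<bar> = \<bar>q k * l (n k) (f k)\<bar>" using q by (simp add: abs_mult)
      ultimately have "\<bar>l (n k) (x k) + (- q k) * l (n k) (f k)\<bar> \<ge> q k * \<bar>l (n k) (f k)\<bar>" by simp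
      then show ?thesis using False unfolding xS e by (simp add: a_def nxt_def e)
    qed (use e in \<open>simp add: xS a_def nxt_def\<close>)
  qed
  define F where "F t = (\<Sum>k. a k * f k t)" for t
  have q_sum: "q sums (3/2)" unfolding q_def using geometric_sums[of "1/3 :: real"] by simp
  then have suma: "summable (\<lambda>k. \<bar>a k\<bar>)" by (simp add: abs_a sums_iff)
  have FC: "F \<in> C_per m" using CB_series[OF f suma] by (auto simp: CB_def F_def[abs_def])
  obtain K where K: "\<And>i. i \<in> I \<Longrightarrow> \<bar>l i F\<bar> \<le> K" using pt[OF FC] by auto
  have "(4/3) ^ k \<le> 4 * K" for k
  proof -
    \<comment> \<open>The tail, rescaled by \<open>2 * 3 ^ k\<close> so that its weights sum to 1
      and it lies in the unit ball.\<close>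
    define G where "G t = (\<Sum>i. (2 * 3 ^ k * a (i + Suc k)) * f (i + Suc k) t)" for t
    have eq: "\<bar>2 * 3 ^ k * a (i + Suc k)\<bar> = 2/3 * q i" for i
      by (simp add: abs_mult abs_a q_def power_add field_simps)
    have "(\<lambda>i. 2/3 * q i) sums (2/3 * (3/2))" by (rule sums_mult[OF q_sum])
    then have e1: "(\<lambda>i. 2/3 * q i) sums 1" by simp
    have GB: "G \<in> CB m 1"
      using CB_series[of "\<lambda>i. f (i + Suc k)" m "\<lambda>i. 2 * 3 ^ k * a (i + Suc k)"] f e1
      unfolding eq by (simp add: G_def[abs_def] sums_iff)
    have FG: "F = (\<lambda>t. x (Suc k) t + q k / 2 * G t)"
    proof
      fix t
      have ft: "\<bar>f i t\<bar> \<le> 1" for i using f[of i] by (auto simp: CB_def dest: spec[of _ 0])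
      have s1: "summable (\<lambda>i. a i * f i t)"
        by (rule summable_comparison_test'[OF suma]) (use ft in \<open>auto simp: abs_mult intro: mult_left_le\<close>)
      have "F t = (\<Sum>i. a (i + Suc k) * f (i + Suc k) t) + x (Suc k) t"
        unfolding F_def xsum by (rule suminf_split_initial_segment[OF s1])
      also have "(\<Sum>i. a (i + Suc k) * f (i + Suc k) t) = q k / 2 * G t"
      proof -
        have "q k / 2 * G t = (\<Sum>i. q k / 2 * ((2 * 3 ^ k * a (i + Suc k)) * f (i + Suc k) t))"
          unfolding G_def using summable_ignore_initial_segment[OF s1, of "Suc k"]
          by (intro suminf_mult[symmetric]) (simp add: mult.assoc summable_mult)
        also have "\<dots> = (\<Sum>i. a (i + Suc k) * f (i + Suc k) t)"
          by (simp add: q_def power_divide)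
        finally show ?thesis ..
      qed
      finally show "F t = x (Suc k) t + q k / 2 * G t" by simp
    qed
    have "l (n k) F = l (n k) (x (Suc k)) + q k / 2 * l (n k) G"
      unfolding FG by (rule lin[OF n xC CBC[OF GB]])
    moreover have "\<bar>q k / 2 * l (n k) G\<bar> \<le> q k / 2 * S (n k)"
      using S[OF n GB, of k] by (simp add: abs_mult q_def)
    moreover have "q k * (3/4 * S (n k)) \<le> q k * \<bar>l (n k) (f k)\<bar>"
      using big[of k] by (intro mult_left_mono) (auto simp: q_def)
    \<comment> \<open>3/4 from the hump minus 1/2 from the tail.\<close>
    ultimately have "q k * S (n k) / 4 \<le> \<bar>l (n k) F\<bar>"
      using hump[of k] by (simp add: field_simps)
    then have "q k * S (n k) / 4 \<le> K" using K[OF n, of k] by simp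
    moreover have "q k * 4 ^ k \<le> q k * S (n k)" using Sn by (intro mult_left_mono) (auto simp: q_def)
    ultimately show ?thesis by (simp add: q_def power_divide)
  qed
  moreover obtain k where "4 * K < (4/3) ^ k" using real_arch_pow[of "4/3" "4 * K"] by auto
  ultimately show False by (meson not_le)
qed

text \<open>For a fixed first argument, the principle in the second one gives a bound over all
  \<open>i\<close> and all \<open>g\<close> in the unit ball. This is the pointwise hypothesis for
  the functionals of \<open>f\<close> indexed by the pairs \<open>(i, g)\<close>, to which the
  principle applies once more.\<close>

lemma uniform_boundedness_C_per_bilinear:
  fixes E :: "'i \<Rightarrow> (real \<Rightarrow> real) \<Rightarrow> (real \<Rightarrow> real) \<Rightarrow> real"
  assumes lin1: "\<And>i f g h c. i \<in> I \<Longrightarrow> f \<in> C_per m \<Longrightarrow> g \<in> C_per m \<Longrightarrow> h \<in> C_per m \<Longrightarrow>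
      E i (\<lambda>x. f x + c * g x) h = E i f h + c * E i g h"
    and lin2: "\<And>i f g h c. i \<in> I \<Longrightarrow> f \<in> C_per m \<Longrightarrow> g \<in> C_per m \<Longrightarrow> h \<in> C_per m \<Longrightarrow>
      E i h (\<lambda>x. f x + c * g x) = E i h f + c * E i h g"
    and bdd: "\<And>i M. i \<in> I \<Longrightarrow> \<exists>K. \<forall>f\<in>CB m M. \<forall>g\<in>CB m M. \<bar>E i f g\<bar> \<le> K"
    and pt: "\<And>f g. f \<in> C_per m \<Longrightarrow> g \<in> C_per m \<Longrightarrow> \<exists>K. \<forall>i\<in>I. \<bar>E i f g\<bar> \<le> K"
  shows "\<exists>C. \<forall>i\<in>I. \<forall>f\<in>CB m M. \<forall>g\<in>CB m M. \<bar>E i f g\<bar> \<le> C"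
proof -
  have CBC: "f \<in> C_per m" if "f \<in> CB m M" for f M using that by (simp add: CB_def)
  have 1: "\<exists>C. \<forall>i\<in>I. \<forall>g\<in>CB m 1. \<bar>E i f g\<bar> \<le> C" if f: "f \<in> C_per m" for f
  proof (rule uniform_boundedness_C_per)
    fix i assume i: "i \<in> I"
    show "\<exists>K. \<forall>g\<in>CB m 1. \<bar>E i f g\<bar> \<le> K"
    proof -
      obtain M where M: "f \<in> CB m M" using C_per_in_CB[OF f] by metis
      obtain K where "\<forall>f\<in>CB m (max M 1). \<forall>g\<in>CB m (max M 1). \<bar>E i f g\<bar> \<le> K" using bdd[OF i] by blast
      then show ?thesis using M CB_mono[of _ m _ m "max M 1"] by (metis max.cobounded1 max.cobounded2 order_refl)
    qed
  qed (use lin2 pt f in auto)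
  have "\<exists>C. \<forall>p\<in>I \<times> CB m 1. \<forall>f\<in>CB m 1. \<bar>E (fst p) f (snd p)\<bar> \<le> C"
  proof (rule uniform_boundedness_C_per)
    fix p assume p: "p \<in> I \<times> CB m 1"
    show "\<exists>K. \<forall>f\<in>CB m 1. \<bar>E (fst p) f (snd p)\<bar> \<le> K" using bdd[of "fst p" 1] p by (metis mem_Times_iff)
  next
    fix f assume "f \<in> C_per m"
    then show "\<exists>K. \<forall>p\<in>I \<times> CB m 1. \<bar>E (fst p) f (snd p)\<bar> \<le> K" using 1 by (metis mem_Times_iff)
  qed (use lin1 CBC in \<open>auto simp: mem_Times_iff\<close>)
  then obtain C where C: "\<And>i f g. i \<in> I \<Longrightarrow> f \<in> CB m 1 \<Longrightarrow> g \<in> CB m 1 \<Longrightarrow> \<bar>E i f g\<bar> \<le> C" by (metis mem_Times_iff fst_conv snd_conv)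
  have z: "(\<lambda>_. 0) \<in> C_per m" if "f \<in> C_per m" for f :: "real \<Rightarrow> real"
    using C_per_cmult(1)[OF that, where a = 0] by simp
  have sc1: "E i (\<lambda>x. c * f x) g = c * E i f g" if "i \<in> I" "f \<in> C_per m" "g \<in> C_per m" for i f g c
    using lin1[OF that(1) z[OF that(2)] that(2) that(3), of c] lin1[OF that(1) z[OF that(2)] z[OF that(2)] that(3), of 1] by simp
  have sc2: "E i f (\<lambda>x. c * g x) = c * E i f g" if "i \<in> I" "f \<in> C_per m" "g \<in> C_per m" for i f g c
    using lin2[OF that(1) z[OF that(2)] that(3) that(2), of c] lin2[OF that(1) z[OF that(2)] z[OF that(2)] that(2), of 1] by simp
  \<comment> \<open>Positive whatever \<open>M\<close> is, so both arguments can be scaled into the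
    unit ball.\<close>
  define B where "B = max M 1"
  have B: "B > 0" by (simp add: B_def)
  have "\<bar>E i f g\<bar> \<le> B * B * C" if "i \<in> I" "f \<in> CB m M" "g \<in> CB m M" for i f g
  proof -
    have fg: "f \<in> CB m B" "g \<in> CB m B" using that CB_mono[of _ m M m B] by (auto simp: B_def)
    have "E i (\<lambda>x. (1/B) * f x) (\<lambda>x. (1/B) * g x) = (1/B) * ((1/B) * E i f g)"
      by (simp only: sc1 sc2 that(1) CBC[OF fg(1)] CBC[OF fg(2)] C_per_cmult(1))
    then have "\<bar>(1/B) * ((1/B) * E i f g)\<bar> \<le> C"
      using C[OF that(1) CB_scale[OF fg(1) B] CB_scale[OF fg(2) B]] by simp
    then show ?thesis using B by (simp add: abs_mult field_simps)
  qed
  then show ?thesis by blast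
qed

section \<open>Finite-dimensional function spaces\<close>

text \<open>The spaces depend on parameters such as \<open>r\<close> and \<open>N\<close>, so they
  are sets of functions instead of types; sum and multiple are merged into one axiom, and linearity
  is always checked in the same merged form.\<close>

locale function_space =
  fixes V :: "('a \<Rightarrow> real) set"
  assumes zero: "(\<lambda>_. 0) \<in> V"
    and add_cmult: "f \<in> V \<Longrightarrow> g \<in> V \<Longrightarrow> (\<lambda>x. f x + c * g x) \<in> V"
begin

lemma cmult: "f \<in> V \<Longrightarrow> (\<lambda>x. c * f x) \<in> V"
  using add_cmult[OF zero, of f c] by simp

lemma lincomb: "finite J \<Longrightarrow> (\<And>j. j \<in> J \<Longrightarrow> b j \<in> V) \<Longrightarrow> (\<lambda>x. \<Sum>j\<in>J. c j * b j x) \<in> V"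
proof (induction J rule: finite_induct)
  case (insert j J)
  then show ?case using add_cmult[of "\<lambda>x. \<Sum>j\<in>J. c j * b j x" "b j" "c j"]
    by (simp add: add.commute)
qed (simp add: zero)

lemma linear_lincomb:
  assumes F: "\<And>f g c. f \<in> V \<Longrightarrow> g \<in> V \<Longrightarrow> F (\<lambda>x. f x + c * g x) = F f + c * F g"
    and "finite J" "\<And>j. j \<in> J \<Longrightarrow> b j \<in> V"
  shows "F (\<lambda>x. \<Sum>j\<in>J. c j * b j x) = (\<Sum>j\<in>J. c j * (F (b j) :: real))"
  using assms(2,3)
proof (induction J rule: finite_induct)
  case empty
  show ?case using F[OF zero zero, of 1] by simp
next
  case (insert j J)
  then show ?case using F[OF lincomb[of J b c], of "b j" "c j"]
    by (simp add: add.commute)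
qed

text \<open>Finitely many point evaluations serve as coordinates on \<open>V\<close>. The time
  derivative of a spline-valued curve is given only pointwise, and coordinates of this kind inherit
  it directly.\<close>

lemma lagrange_basis:
  assumes "finite J" "\<And>j. j \<in> J \<Longrightarrow> b j \<in> V"
    and span: "\<And>f. f \<in> V \<Longrightarrow> \<exists>c. f = (\<lambda>x. \<Sum>j\<in>J. c j * b j x)"
  obtains m :: nat and p g where "\<And>k. k < m \<Longrightarrow> g k \<in> V"
    and "\<And>f x. f \<in> V \<Longrightarrow> f x = (\<Sum>k<m. f (p k) * g k x)"
proof -
  have "\<exists>(m::nat) p g. (\<forall>k<m. g k \<in> V) \<and> (\<forall>k<m. \<forall>l<m. g k (p l) = (if k = l then 1 else 0)) \<and>
     (\<forall>j\<in>J. \<forall>x. b j x = (\<Sum>k<m. b j (p k) * g k x))"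
    using assms(1,2)
  proof (induction J rule: finite_induct)
    case empty
    then show ?case by (intro exI[of _ 0]) auto
  next
    case (insert i J)
    from insert.IH[OF insert.prems[OF insertI2]]
    obtain m :: nat and p g where g: "\<And>k. k < m \<Longrightarrow> g k \<in> V"
      and dual: "\<And>k l. k < m \<Longrightarrow> l < m \<Longrightarrow> g k (p l) = (if k = l then 1 else 0)"
      and rep: "\<And>j x. j \<in> J \<Longrightarrow> b j x = (\<Sum>k<m. b j (p k) * g k x)"
      by blast
    \<comment> \<open>The residual of interpolation at the old nodes. Duality makes it vanish at
      these nodes; if it is not identically zero, a point \<open>q\<close> where it is nonzero
      becomes the next node.\<close>
    define r where "r x = b i x - (\<Sum>k<m. b i (p k) * g k x)" for x
    show ?case
    proof (cases "\<forall>x. r x = 0")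
      case True
      then have "b i x = (\<Sum>k<m. b i (p k) * g k x)" for x
        unfolding r_def by (metis eq_iff_diff_eq_0)
      then show ?thesis using g dual rep
        by (intro exI[of _ m] exI[of _ p] exI[of _ g]) blast
    next
      case False
      then obtain q where q: "r q \<noteq> 0" by auto
      have rp: "r (p l) = 0" if "l < m" for l
        using that by (simp add: r_def dual if_distrib sum.delta' cong: if_cong)
      have rV: "r \<in> V"
        using add_cmult[OF insert.prems[of i] lincomb[of "{..<m}" g "\<lambda>k. b i (p k)"], of "-1"] g
        by (simp add: r_def[abs_def])
      define h where "h x = (1 / r q) * r x" for x
      have h: "h \<in> V" "h q = 1" "\<And>l. l < m \<Longrightarrow> h (p l) = 0"
        using cmult[OF rV, of "1 / r q"] q rp by (auto simp: h_def[abs_def])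
      define P where "P k = (if k < m then p k else q)" for k
      \<comment> \<open>The old functions are corrected by multiples of \<open>h\<close> so that
        they vanish at the new node.\<close>
      define G where "G k = (if k < m then (\<lambda>x. g k x + (- g k q) * h x) else h)" for k
      have expand: "f x = (\<Sum>k<Suc m. f (P k) * G k x)"
        if "\<And>x. f x = (\<Sum>k<m. f (p k) * g k x) + c * r x" for f x c
      proof -
        have "(\<Sum>k<Suc m. f (P k) * G k x) = (\<Sum>k<m. f (p k) * g k x) + (f q - (\<Sum>k<m. f (p k) * g k q)) * h x"
          by (simp add: P_def G_def algebra_simps sum.distrib sum_subtractf sum_distrib_left)
        also have "\<dots> = f x"
          using that[of x] that[of q] q by (simp add: h_def)
        finally show ?thesis ..
      qed
      have "b i x = (\<Sum>k<Suc m. b i (P k) * G k x)" for x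
        by (rule expand[of _ 1]) (simp only: r_def, simp)
      moreover have "b j x = (\<Sum>k<Suc m. b j (P k) * G k x)" if "j \<in> J" for j x
        by (rule expand[of _ 0]) (unfold mult_zero_left add_0_right, rule rep[OF that])
      moreover have "G k \<in> V" if "k < Suc m" for k
        using add_cmult[OF g[of k] h(1), of "- g k q"] h(1) by (cases "k < m") (simp_all add: G_def)
      moreover have "\<forall>k<Suc m. \<forall>l<Suc m. G k (P l) = (if k = l then 1 else 0)"
        using dual h by (auto simp: G_def P_def less_Suc_eq)
      ultimately show ?thesis by (intro exI[of _ "Suc m"] exI[of _ P] exI[of _ G]) blast
    qed
  qed
  then obtain m :: nat and p g where g: "\<And>k. k < m \<Longrightarrow> g k \<in> V"
    and rep: "\<And>j x. j \<in> J \<Longrightarrow> b j x = (\<Sum>k<m. b j (p k) * g k x)" by blast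
  have "f x = (\<Sum>k<m. f (p k) * g k x)" if fV: "f \<in> V" for f x
  proof -
    obtain c where c: "f = (\<lambda>x. \<Sum>j\<in>J. c j * b j x)" using span[OF fV] by auto
    have "f x = (\<Sum>j\<in>J. c j * b j x)" by (simp add: c)
    also have "\<dots> = (\<Sum>j\<in>J. c j * (\<Sum>k<m. b j (p k) * g k x))"
      by (rule sum.cong[OF refl], subst rep) auto
    also have "\<dots> = (\<Sum>j\<in>J. \<Sum>k<m. c j * b j (p k) * g k x)" by (simp add: sum_distrib_left mult.assoc)
    also have "\<dots> = (\<Sum>k<m. \<Sum>j\<in>J. c j * b j (p k) * g k x)" by (rule sum.swap)
    also have "\<dots> = (\<Sum>k<m. f (p k) * g k x)" by (simp add: c sum_distrib_right)
    finally show ?thesis .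
  qed
  then show ?thesis using that g by blast
qed

end

locale function_inner_space = function_space V for V :: "('a \<Rightarrow> real) set" +
  fixes ip :: "('a \<Rightarrow> real) \<Rightarrow> ('a \<Rightarrow> real) \<Rightarrow> real"
  assumes sym: "f \<in> V \<Longrightarrow> g \<in> V \<Longrightarrow> ip f g = ip g f"
    and lin: "f \<in> V \<Longrightarrow> g \<in> V \<Longrightarrow> h \<in> V \<Longrightarrow> ip (\<lambda>x. f x + c * g x) h = ip f h + c * ip g h"
    and nonneg: "f \<in> V \<Longrightarrow> 0 \<le> ip f f"
    and definite: "f \<in> V \<Longrightarrow> ip f f = 0 \<Longrightarrow> f = (\<lambda>_. 0)"
begin

lemma ip_zero: "h \<in> V \<Longrightarrow> ip (\<lambda>_. 0) h = 0"
  using lin[OF zero zero, of h 1] by simp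

lemma ip_cmult: "f \<in> V \<Longrightarrow> h \<in> V \<Longrightarrow> ip (\<lambda>x. c * f x) h = c * ip f h"
  using lin[OF zero, of f h c] by (simp add: ip_zero)

lemma ip_lincomb:
  assumes "finite J" "\<And>j. j \<in> J \<Longrightarrow> b j \<in> V" "h \<in> V"
  shows "ip (\<lambda>x. \<Sum>j\<in>J. c j * b j x) h = (\<Sum>j\<in>J. c j * ip (b j) h)"
  using assms
proof (induction J rule: finite_induct)
  case (insert j J)
  then show ?case using lin[OF lincomb[of J b c], of "b j" h "c j"]
    by (simp add: add.commute)
qed (simp add: ip_zero)

lemma ip_lincomb_right:
  assumes "finite J" "\<And>j. j \<in> J \<Longrightarrow> b j \<in> V" "h \<in> V"
  shows "ip h (\<lambda>x. \<Sum>j\<in>J. c j * b j x) = (\<Sum>j\<in>J. c j * ip h (b j))"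
  using ip_lincomb[OF assms] sym[OF assms(3) lincomb[OF assms(1,2)]] sym[OF assms(3,2)] by simp

text \<open>Gram-Schmidt on a spanning family. A vector whose residual \<open>q\<close> has norm
  zero adds nothing, by definiteness; otherwise the normalised residual is appended.\<close>

lemma orthonormal_basis:
  assumes "finite J" "\<And>j. j \<in> J \<Longrightarrow> b j \<in> V"
    and span: "\<And>f. f \<in> V \<Longrightarrow> \<exists>c. f = (\<lambda>x. \<Sum>j\<in>J. c j * b j x)"
  obtains m :: nat and e where "\<And>i. i < m \<Longrightarrow> e i \<in> V"
    and "\<And>i j. i < m \<Longrightarrow> j < m \<Longrightarrow> ip (e i) (e j) = (if i = j then 1 else 0)"
    and "\<And>f. f \<in> V \<Longrightarrow> f = (\<lambda>x. \<Sum>i<m. ip f (e i) * e i x)"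
proof -
  have "\<exists>(m::nat) e. (\<forall>i<m. e i \<in> V) \<and> (\<forall>i<m. \<forall>j<m. ip (e i) (e j) = (if i = j then 1 else 0)) \<and>
     (\<forall>j\<in>J. \<exists>a. b j = (\<lambda>x. \<Sum>i<m. a i * e i x))"
    using assms(1,2)
  proof (induction J rule: finite_induct)
    case empty
    then show ?case by (intro exI[of _ 0]) auto
  next
    case (insert k J)
    from insert.IH[OF insert.prems[OF insertI2]]
    obtain m :: nat and e where e: "\<And>i. i < m \<Longrightarrow> e i \<in> V"
      and orth: "\<And>i j. i < m \<Longrightarrow> j < m \<Longrightarrow> ip (e i) (e j) = (if i = j then 1 else 0)"
      and rep: "\<And>j. j \<in> J \<Longrightarrow> \<exists>a. b j = (\<lambda>x. \<Sum>i<m. a i * e i x)"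
      by blast
    have bk: "b k \<in> V" using insert.prems by simp
    define s where "s x = (\<Sum>i<m. ip (b k) (e i) * e i x)" for x
    define q where "q x = b k x + (-1) * s x" for x
    have sV: "s \<in> V" unfolding s_def[abs_def] by (rule lincomb) (use e in auto)
    have qV: "q \<in> V" unfolding q_def[abs_def] by (rule add_cmult[OF bk sV])
    have qe: "ip q (e i) = 0" if "i < m" for i
    proof -
      have "ip s (e i) = (\<Sum>j<m. ip (b k) (e j) * ip (e j) (e i))"
        unfolding s_def[abs_def] by (rule ip_lincomb) (use e that in auto)
      also have "\<dots> = ip (b k) (e i)" using that by (simp add: orth if_distrib sum.delta cong: if_cong)
      finally show ?thesis unfolding q_def[abs_def] using lin[OF bk sV e[OF that], of "-1"] by simp
    qed
    have bq: "b k x = s x + q x" for x by (simp add: q_def)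
    show ?case
    proof (cases "ip q q = 0")
      case True
      then have "b k = (\<lambda>x. \<Sum>i<m. ip (b k) (e i) * e i x)"
        using definite[OF qV] bq by (auto simp: fun_eq_iff s_def)
      then show ?thesis using e orth rep by (intro exI[of _ m] exI[of _ e]) auto
    next
      case False
      define n where "n = sqrt (ip q q)"
      have n: "n > 0" "n * n = ip q q" using False nonneg[OF qV] by (auto simp: n_def)
      define p where "p x = (1/n) * q x" for x
      have pV: "p \<in> V" unfolding p_def[abs_def] by (rule cmult[OF qV])
      have ip_p: "ip p h = (1/n) * ip q h" if "h \<in> V" for h
        unfolding p_def[abs_def] by (rule ip_cmult[OF qV that])
      have 1: "ip p (e i) = 0" "ip (e i) p = 0" if "i < m" for i
        using ip_p[OF e[OF that]] qe[OF that] sym[OF e[OF that] pV] by simp_all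
      have "ip p p = (1/n) * ip p q" using ip_p[OF pV] sym[OF qV pV] by simp
      also have "\<dots> = (1/n) * ((1/n) * (n * n))" using ip_p[OF qV] by (simp only: n(2))
      finally have 2: "ip p p = 1" using n(1) by simp
      define E where "E i = (if i < m then e i else p)" for i
      have E: "E i \<in> V" if "i < Suc m" for i
        using that e pV by (auto simp: E_def)
      have "ip (E i) (E j) = (if i = j then 1 else 0)" if "i < Suc m" "j < Suc m" for i j
        using that orth 1 2 by (auto simp: E_def less_Suc_eq)
      moreover have "\<exists>a. b j = (\<lambda>x. \<Sum>i<Suc m. a i * E i x)" if j: "j \<in> insert k J" for j
      proof (cases "j = k")
        case True
        then show ?thesis using n bq
          by (intro exI[of _ "\<lambda>i. if i < m then ip (b k) (e i) else n"]) (auto simp: E_def s_def p_def fun_eq_iff)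
      next
        case False
        then obtain a where "b j = (\<lambda>x. \<Sum>i<m. a i * e i x)" using rep j by auto
        then show ?thesis
          by (intro exI[of _ "\<lambda>i. if i < m then a i else 0"]) (auto simp: E_def fun_eq_iff)
      qed
      ultimately show ?thesis using E by (intro exI[of _ "Suc m"] exI[of _ E]) blast
    qed
  qed
  then obtain m :: nat and e where e: "\<And>i. i < m \<Longrightarrow> e i \<in> V"
    and orth: "\<And>i j. i < m \<Longrightarrow> j < m \<Longrightarrow> ip (e i) (e j) = (if i = j then 1 else 0)"
    and "\<forall>j\<in>J. \<exists>a. b j = (\<lambda>x. \<Sum>i<m. a i * e i x)" by blast
  then obtain a where a: "\<And>j. j \<in> J \<Longrightarrow> b j = (\<lambda>x. \<Sum>i<m. a j i * e i x)" by metis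
  have "f = (\<lambda>x. \<Sum>i<m. ip f (e i) * e i x)" if fV: "f \<in> V" for f
  proof -
    obtain c where c: "f = (\<lambda>x. \<Sum>j\<in>J. c j * b j x)" using span[OF fV] by auto
    define d where "d i = (\<Sum>j\<in>J. c j * a j i)" for i
    have fd: "f = (\<lambda>x. \<Sum>i<m. d i * e i x)"
    proof
      fix x
      have "f x = (\<Sum>j\<in>J. c j * (\<Sum>i<m. a j i * e i x))" using a by (simp add: c)
      also have "\<dots> = (\<Sum>j\<in>J. \<Sum>i<m. c j * a j i * e i x)" by (simp add: sum_distrib_left mult.assoc)
      also have "\<dots> = (\<Sum>i<m. \<Sum>j\<in>J. c j * a j i * e i x)" by (rule sum.swap)
      finally show "f x = (\<Sum>i<m. d i * e i x)" by (simp add: d_def sum_distrib_right)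
    qed
    have "ip f (e i) = d i" if "i < m" for i
    proof -
      have "ip f (e i) = (\<Sum>j<m. d j * ip (e j) (e i))"
        unfolding fd by (rule ip_lincomb) (use e that in auto)
      also have "\<dots> = d i" using that by (simp add: orth if_distrib sum.delta cong: if_cong)
      finally show ?thesis .
    qed
    then show ?thesis using fd by simp
  qed
  then show ?thesis using that e orth by blast
qed

end

section \<open>Piecewise continuous functions and the inner product\<close>

text \<open>A class closed under sums and products that contains all derivatives of splines, whose
  values at the mesh nodes may be arbitrary. The bound covers the exceptional points too, which
  finitely many values cannot spoil.\<close>

definition pw :: "(real \<Rightarrow> real) \<Rightarrow> bool" where
  "pw f \<longleftrightarrow> (\<exists>B. \<forall>x\<in>{0..1}. \<bar>f x\<bar> \<le> B) \<and> (\<exists>F. finite F \<and> continuous_on ({0..1} - F) f)"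

lemma pw_continuous: "continuous_on UNIV f \<Longrightarrow> pw f"
proof -
  assume c: "continuous_on UNIV f"
  have "bounded (f ` {0..1})"
    by (intro compact_imp_bounded compact_continuous_image continuous_on_subset[OF c]) auto
  then have "\<exists>B. \<forall>x\<in>{0..1}. \<bar>f x\<bar> \<le> B" unfolding bounded_iff real_norm_def by blast
  moreover have "continuous_on ({0..1} - {}) f" by (rule continuous_on_subset[OF c]) auto
  ultimately show "pw f" unfolding pw_def by (metis finite.emptyI)
qed

lemma pw_const: "pw (\<lambda>_. c)"
  by (intro pw_continuous continuous_intros)

lemma pw_add: "pw f \<Longrightarrow> pw g \<Longrightarrow> pw (\<lambda>x. f x + g x)"
proof -
  assume "pw f" "pw g"
  then obtain A B F G where 1: "\<And>x. x \<in> {0..1} \<Longrightarrow> \<bar>f x\<bar> \<le> A" "\<And>x. x \<in> {0..1} \<Longrightarrow> \<bar>g x\<bar> \<le> B"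
    and 2: "finite F" "finite G" "continuous_on ({0..1} - F) f" "continuous_on ({0..1} - G) g"
    unfolding pw_def by blast
  have "\<bar>f x + g x\<bar> \<le> A + B" if "x \<in> {0..1}" for x using 1[OF that] by linarith
  moreover have "continuous_on ({0..1} - (F \<union> G)) (\<lambda>x. f x + g x)"
    by (intro continuous_on_add continuous_on_subset[OF 2(3)] continuous_on_subset[OF 2(4)]) auto
  ultimately show ?thesis unfolding pw_def using finite_UnI[OF 2(1,2)] by (intro conjI exI ballI) auto
qed

lemma pw_mult: "pw f \<Longrightarrow> pw g \<Longrightarrow> pw (\<lambda>x. f x * g x)"
proof -
  assume "pw f" "pw g"
  then obtain A B F G where 1: "\<And>x. x \<in> {0..1} \<Longrightarrow> \<bar>f x\<bar> \<le> A" "\<And>x. x \<in> {0..1} \<Longrightarrow> \<bar>g x\<bar> \<le> B"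
    and 2: "finite F" "finite G" "continuous_on ({0..1} - F) f" "continuous_on ({0..1} - G) g"
    unfolding pw_def by blast
  have "\<bar>f x * g x\<bar> \<le> A * B" if "x \<in> {0..1}" for x
    using mult_mono[OF 1(1)[OF that] 1(2)[OF that]] 1(1)[OF that] abs_ge_zero[of "f x"]
    by (simp add: abs_mult)
  moreover have "continuous_on ({0..1} - (F \<union> G)) (\<lambda>x. f x * g x)"
    by (intro continuous_on_mult continuous_on_subset[OF 2(3)] continuous_on_subset[OF 2(4)]) auto
  ultimately show ?thesis unfolding pw_def using finite_UnI[OF 2(1,2)] by (intro conjI exI ballI) auto
qed

lemma pw_cmult: "pw f \<Longrightarrow> pw (\<lambda>x. c * f x)"
  by (rule pw_mult[OF pw_const])

lemma pw_uminus: "pw f \<Longrightarrow> pw (\<lambda>x. - f x)"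
  using pw_cmult[of f "-1"] by simp

lemma pw_diff: "pw f \<Longrightarrow> pw g \<Longrightarrow> pw (\<lambda>x. f x - g x)"
  using pw_add[of f "\<lambda>x. - g x"] by (simp add: pw_uminus)

lemma pw_power2: "pw f \<Longrightarrow> pw (\<lambda>x. (f x)\<^sup>2)"
  by (simp add: power2_eq_square pw_mult)

lemma pw_sum: "(\<And>i. i \<in> I \<Longrightarrow> pw (f i)) \<Longrightarrow> pw (\<lambda>x. \<Sum>i\<in>I. f i x)"
  by (induction I rule: infinite_finite_induct) (auto simp: pw_const pw_add)

lemmas pw_intros = pw_const pw_add pw_diff pw_mult pw_uminus pw_power2 pw_sum

lemma pw_cong_finite:
  assumes "pw g" "finite F" "\<And>x. x \<in> {0..1} - F \<Longrightarrow> f x = g x"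
  shows "pw f"
proof -
  obtain B G where B: "\<And>x. x \<in> {0..1} \<Longrightarrow> \<bar>g x\<bar> \<le> B" and G: "finite G" "continuous_on ({0..1} - G) g"
    using assms(1) unfolding pw_def by blast
  have "\<bar>f x\<bar> \<le> \<bar>B\<bar> + (\<Sum>y\<in>F. \<bar>f y\<bar>)" if "x \<in> {0..1}" for x
  proof (cases "x \<in> F")
    case True
    then have "\<bar>f x\<bar> \<le> (\<Sum>y\<in>F. \<bar>f y\<bar>)" using assms(2) by (intro member_le_sum) auto
    then show ?thesis by linarith
  next
    case False
    then have "f x = g x" using assms(3) that by simp
    moreover have "0 \<le> (\<Sum>y\<in>F. \<bar>f y\<bar>)" by (intro sum_nonneg) auto
    ultimately show ?thesis using B[OF that] by linarith
  qed
  moreover have "continuous_on ({0..1} - (F \<union> G)) g"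
    by (rule continuous_on_subset[OF G(2)]) auto
  then have "continuous_on ({0..1} - (F \<union> G)) f"
    by (rule continuous_on_eq) (use assms(3) in auto)
  ultimately show ?thesis unfolding pw_def using finite_UnI[OF assms(2) G(1)] by (intro conjI exI ballI) auto
qed

lemma pw_integrable:
  assumes "pw f"
  shows "f integrable_on {0..1}"
proof -
  obtain B F where B: "\<And>x. x \<in> {0..1} \<Longrightarrow> \<bar>f x\<bar> \<le> B" and F: "finite F" "continuous_on ({0..1} - F) f"
    using assms unfolding pw_def by blast
  have neg: "negligible (sym_diff ({0..1::real} - F) {0..1})"
    by (rule negligible_subset[OF negligible_finite[OF F(1)]]) auto
  have S: "{0..1} - F \<in> sets lebesgue"
    using F(1) by (intro sets.Diff) (auto simp: negligible_finite negligible_imp_sets)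
  have "f integrable_on {0..1} - F"
  proof (rule measurable_bounded_by_integrable_imp_integrable)
    show "f \<in> borel_measurable (lebesgue_on ({0..1} - F))"
      by (rule continuous_imp_measurable_on_sets_lebesgue[OF F(2) S])
    have "(\<lambda>_. B) integrable_on {0..1::real}" by (intro integrable_continuous_interval continuous_intros)
    then show "(\<lambda>_. B) integrable_on {0..1} - F"
      by (rule integrable_spike_set) (rule negligible_subset[OF negligible_finite[OF F(1)]]; auto)+
  qed (use B S in auto)
  then show ?thesis
    by (rule integrable_spike_set) (rule negligible_subset[OF negligible_finite[OF F(1)]]; auto)+
qed

lemma integral_mono_pw:
  assumes "pw f" "pw g" "finite F" "\<And>x. x \<in> {0..1} - F \<Longrightarrow> f x \<le> g x"
  shows "integral {0..1} f \<le> integral {0..1} g"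
proof -
  define g' where "g' x = (if x \<in> F then f x else g x)" for x
  have pg: "pw g'" by (rule pw_cong_finite[OF assms(2,3)]) (auto simp: g'_def)
  have "integral {0..1} f \<le> integral {0..1} g'"
    by (intro integral_le pw_integrable assms pg) (use assms(4) in \<open>auto simp: g'_def\<close>)
  also have "\<dots> = integral {0..1} g"
    by (rule integral_spike[OF negligible_finite[OF assms(3)]]) (auto simp: g'_def)
  finally show ?thesis .
qed

section \<open>The inner product on piecewise continuous functions\<close>

lemma l2_inner_commute: "l2_inner f g = l2_inner g f"
  by (simp add: l2_inner_def mult.commute)

lemma l2_inner_cong_finite:
  assumes "finite F" "\<And>x. x \<in> {0..1} - F \<Longrightarrow> f x * g x = f' x * g' x"
  shows "l2_inner f g = l2_inner f' g'"
  unfolding l2_inner_def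
  by (rule integral_spike[OF negligible_finite[OF assms(1)]]) (use assms(2) in auto)

lemma l2_inner_add_cmult_left:
  assumes "pw f" "pw g" "pw h"
  shows "l2_inner (\<lambda>x. f x + c * g x) h = l2_inner f h + c * l2_inner g h"
proof -
  have "l2_inner (\<lambda>x. f x + c * g x) h = integral {0..1} (\<lambda>x. f x * h x + c * (g x * h x))"
    by (simp add: l2_inner_def algebra_simps)
  also have "\<dots> = l2_inner f h + c * l2_inner g h"
    unfolding l2_inner_def
    by (subst integral_add) (simp_all add: pw_integrable pw_cmult pw_mult assms)
  finally show ?thesis .
qed

lemma l2_inner_add_left: "pw f \<Longrightarrow> pw g \<Longrightarrow> pw h \<Longrightarrow> l2_inner (\<lambda>x. f x + g x) h = l2_inner f h + l2_inner g h"
  using l2_inner_add_cmult_left[of f g h 1] by simp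

lemma l2_inner_diff_left: "pw f \<Longrightarrow> pw g \<Longrightarrow> pw h \<Longrightarrow> l2_inner (\<lambda>x. f x - g x) h = l2_inner f h - l2_inner g h"
  using l2_inner_add_cmult_left[of f g h "-1"] by simp

lemma l2_inner_cmult_left: "l2_inner (\<lambda>x. c * f x) h = c * l2_inner f h"
  by (simp add: l2_inner_def mult.assoc)

lemma l2_inner_sum_left:
  assumes "\<And>i. i \<in> I \<Longrightarrow> pw (f i)" "pw h"
  shows "l2_inner (\<lambda>x. \<Sum>i\<in>I. f i x) h = (\<Sum>i\<in>I. l2_inner (f i) h)"
  using assms
proof (induction I rule: infinite_finite_induct)
  case (insert i I)
  then show ?case using l2_inner_add_left[of "f i" "\<lambda>x. \<Sum>i\<in>I. f i x" h] by (simp add: pw_sum)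
qed (simp_all add: l2_inner_def)

lemma l2_inner_nonneg: "pw f \<Longrightarrow> 0 \<le> l2_inner f f"
  unfolding l2_inner_def by (intro integral_nonneg pw_integrable pw_mult) auto

lemma l2_norm_nonneg: "pw f \<Longrightarrow> 0 \<le> l2_norm f"
  by (simp add: l2_norm_def l2_inner_nonneg)

lemma l2_norm_power2: "pw f \<Longrightarrow> (l2_norm f)\<^sup>2 = l2_inner f f"
  by (simp add: l2_norm_def l2_inner_nonneg)

lemma l2_inner_cauchy_schwarz:
  assumes "pw f" "pw g"
  shows "\<bar>l2_inner f g\<bar> \<le> l2_norm f * l2_norm g"
proof -
  have q: "0 \<le> l2_inner f f + 2 * s * l2_inner f g + s\<^sup>2 * l2_inner g g" for s
  proof -
    have p: "pw (\<lambda>x. f x + s * g x)" using assms by (intro pw_intros)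
    have "0 \<le> l2_inner (\<lambda>x. f x + s * g x) (\<lambda>x. f x + s * g x)" by (rule l2_inner_nonneg[OF p])
    also have "\<dots> = l2_inner (\<lambda>x. f x + s * g x) f + s * l2_inner (\<lambda>x. f x + s * g x) g"
      using l2_inner_add_cmult_left[OF assms p, of s]
      by (simp add: l2_inner_commute[of f "\<lambda>x. f x + s * g x"] l2_inner_commute[of g "\<lambda>x. f x + s * g x"])
    also have "\<dots> = l2_inner f f + 2 * s * l2_inner f g + s\<^sup>2 * l2_inner g g"
      by (simp add: l2_inner_add_cmult_left assms l2_inner_commute[of g f] algebra_simps power2_eq_square)
    finally show ?thesis .
  qed
  have "(l2_inner f g)\<^sup>2 \<le> l2_inner f f * l2_inner g g"
  proof (cases "l2_inner g g = 0")
    case True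
    have "l2_inner f g = 0"
    proof (rule ccontr)
      assume "l2_inner f g \<noteq> 0"
      \<comment> \<open>For degenerate \<open>g\<close> the quadratic polynomial in \<open>s\<close>
        is affine, and this \<open>s\<close> would give it the value -1.\<close>
      then have "2 * (- (l2_inner f f + 1) / (2 * l2_inner f g)) * l2_inner f g = - (l2_inner f f + 1)"
        by (simp add: divide_simps)
      then show False using q[of "- (l2_inner f f + 1) / (2 * l2_inner f g)"] True by simp
    qed
    then show ?thesis using True by simp
  next
    case False
    then have "l2_inner g g > 0" using l2_inner_nonneg[OF assms(2)] by simp
    moreover have "0 \<le> l2_inner f f - (l2_inner f g)\<^sup>2 / l2_inner g g"
      using q[of "- l2_inner f g / l2_inner g g"] False by (simp add: power2_eq_square)
    ultimately show ?thesis by (simp add: pos_divide_le_eq)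
  qed
  then have "\<bar>l2_inner f g\<bar> \<le> sqrt (l2_inner f f * l2_inner g g)"
    by (metis real_sqrt_abs real_sqrt_le_mono)
  then show ?thesis by (simp add: l2_norm_def real_sqrt_mult)
qed

lemma l2_norm_le_sup:
  assumes "pw f" "finite F" "\<And>x. x \<in> {0..1} - F \<Longrightarrow> \<bar>f x\<bar> \<le> B" "0 \<le> B"
  shows "l2_norm f \<le> B"
proof -
  have "l2_inner f f \<le> integral {0..1} (\<lambda>x::real. B * B)"
    unfolding l2_inner_def
  proof (rule integral_mono_pw[OF _ _ assms(2)])
    show "f x * f x \<le> B * B" if "x \<in> {0..1} - F" for x
      using abs_mult_self_eq[of "f x"] mult_mono[OF assms(3)[OF that] assms(3)[OF that]] assms(4) by simp
  qed (intro pw_mult pw_const assms(1))+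
  then show ?thesis unfolding l2_norm_def using assms(4) by (intro real_le_lsqrt) (auto simp: power2_eq_square)
qed

text \<open>Squares are added with a factor 2 in place of the triangle inequality, since the energy
  estimate bounds squares.\<close>

lemma l2_norm_diff_power2_le:
  assumes "pw f" "pw g" "pw h"
  shows "(l2_norm (\<lambda>x. f x - h x))\<^sup>2 \<le> 2 * (l2_norm (\<lambda>x. f x - g x))\<^sup>2 + 2 * (l2_norm (\<lambda>x. g x - h x))\<^sup>2"
proof -
  have "integral {0..1} (\<lambda>x. (f x - h x) * (f x - h x))
    \<le> integral {0..1} (\<lambda>x. 2 * ((f x - g x) * (f x - g x)) + 2 * ((g x - h x) * (g x - h x)))"
  proof (rule integral_mono_pw[where F = "{}"])
    fix x
    show "(f x - h x) * (f x - h x) \<le> 2 * ((f x - g x) * (f x - g x)) + 2 * ((g x - h x) * (g x - h x))"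
      using zero_le_square[of "(f x - g x) - (g x - h x)"] by (simp add: algebra_simps)
  qed (intro pw_intros assms finite.emptyI)+
  also have "\<dots> = 2 * l2_inner (\<lambda>x. f x - g x) (\<lambda>x. f x - g x) + 2 * l2_inner (\<lambda>x. g x - h x) (\<lambda>x. g x - h x)"
    unfolding l2_inner_def by (subst integral_add) (simp_all add: pw_integrable pw_cmult pw_mult pw_diff assms)
  finally show ?thesis
    unfolding l2_norm_power2[OF pw_diff[OF assms(1,3)]] l2_norm_power2[OF pw_diff[OF assms(1,2)]]
      l2_norm_power2[OF pw_diff[OF assms(2,3)]] l2_inner_def .
qed

section \<open>Splines\<close>

definition mesh :: "nat \<Rightarrow> real set" where
  "mesh N = (\<lambda>i. real i / real N) ` {0..N}"

lemma finite_mesh: "finite (mesh N)"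
  by (simp add: mesh_def)

lemma mesh_cell:
  assumes "N \<ge> 1" "x \<in> {0..1} - mesh N"
  obtains i where "i \<in> {1..N}" "x \<in> {(real i - 1) / real N <..< real i / real N}"
proof -
  have N: "real N > 0" using assms by simp
  define k where "k = nat \<lfloor>x * real N\<rfloor>"
  have x: "0 \<le> x" "x \<le> 1" using assms by auto
  have k: "real k \<le> x * real N" "x * real N < real k + 1"
    using x N floor_correct[of "x * real N"] by (simp_all add: k_def of_nat_nat)
  have xN: "x * real N \<le> real N" using x N by (simp add: mult_left_le_one_le)
  then have "k \<le> N" using k by linarith
  then have "x \<noteq> real k / real N" using assms by (auto simp: mesh_def)
  then have "real k \<noteq> x * real N" using N by (auto simp: field_simps)
  then have "real k < x * real N" using k by simp
  moreover then have "Suc k \<le> N" using xN by linarith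
  ultimately show ?thesis using k N that[of "Suc k"] by (auto simp: field_simps)
qed

lemma spline_cell:
  assumes f: "f \<in> splines r N" and i: "i \<in> {1..N}"
  obtains p where "degree p \<le> r - 1"
    and "\<And>x. x \<in> {(real i - 1) / real N .. real i / real N} \<Longrightarrow> f x = poly p x"
    and "\<And>k x. x \<in> {(real i - 1) / real N <..< real i / real N} \<Longrightarrow> (deriv ^^ k) f x = poly ((pderiv ^^ k) p) x"
    and "\<And>k x. x \<in> {(real i - 1) / real N <..< real i / real N} \<Longrightarrow>
      ((deriv ^^ k) f has_real_derivative (deriv ^^ Suc k) f x) (at x)"
proof -
  let ?I = "{(real i - 1) / real N <..< real i / real N}"
  obtain p where p: "degree p \<le> r - 1" "\<And>x. x \<in> {(real i - 1) / real N .. real i / real N} \<Longrightarrow> f x = poly p x"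
    using f i unfolding splines_def by blast
  have der: "(deriv ^^ k) f x = poly ((pderiv ^^ k) p) x" if "x \<in> ?I" for k x
    using that
  proof (induction k arbitrary: x)
    case (Suc k)
    have "\<forall>\<^sub>F y in nhds x. y \<in> ?I" using Suc.prems by (intro eventually_nhds_in_open) auto
    then have "\<forall>\<^sub>F y in nhds x. (deriv ^^ k) f y = poly ((pderiv ^^ k) p) y"
      by eventually_elim (rule Suc.IH)
    then have "deriv ((deriv ^^ k) f) x = deriv (poly ((pderiv ^^ k) p)) x"
      by (rule deriv_cong_ev) simp
    then show ?case by (simp add: DERIV_imp_deriv[OF poly_DERIV])
  qed (use p in auto)
  have "((deriv ^^ k) f has_real_derivative (deriv ^^ Suc k) f x) (at x)" if x: "x \<in> ?I" for k x
  proof -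
    have "(poly ((pderiv ^^ k) p) has_real_derivative (deriv ^^ Suc k) f x) (at x)"
      using der[OF x, of "Suc k"] poly_DERIV[of "(pderiv ^^ k) p" x] by simp
    then show ?thesis
      by (rule has_field_derivative_transform_within_open[of _ _ _ ?I]) (use x der[of _ k] in auto)
  qed
  with that p der show ?thesis by blast
qed

lemma spline_pw_deriv:
  assumes f: "f \<in> splines r N" and N: "N \<ge> 1"
  shows "pw ((deriv ^^ k) f)"
proof -
  have "\<exists>B. \<forall>x\<in>{(real i - 1) / real N <..< real i / real N}. \<bar>(deriv ^^ k) f x\<bar> \<le> B" if i: "i \<in> {1..N}" for i
  proof -
    obtain p where p: "\<And>x. x \<in> {(real i - 1) / real N <..< real i / real N} \<Longrightarrow> (deriv ^^ k) f x = poly ((pderiv ^^ k) p) x"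
      using spline_cell[OF f i] by metis
    have "bounded (poly ((pderiv ^^ k) p) ` {(real i - 1) / real N .. real i / real N})"
      by (intro compact_imp_bounded compact_continuous_image continuous_intros) auto
    then obtain B where "\<forall>x\<in>{(real i - 1) / real N .. real i / real N}. \<bar>poly ((pderiv ^^ k) p) x\<bar> \<le> B"
      unfolding bounded_iff by auto
    then have "\<forall>x\<in>{(real i - 1) / real N <..< real i / real N}. \<bar>(deriv ^^ k) f x\<bar> \<le> B" using p by auto
    then show ?thesis by blast
  qed
  then obtain B where B: "\<And>i x. i \<in> {1..N} \<Longrightarrow> x \<in> {(real i - 1) / real N <..< real i / real N} \<Longrightarrow> \<bar>(deriv ^^ k) f x\<bar> \<le> B i"
    by metis
  \<comment> \<open>At the nodes the derivative may be arbitrary; it is set to zero there and put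
    back by \<open>pw_cong_finite\<close>.\<close>
  define g where "g x = (if x \<in> mesh N then 0 else (deriv ^^ k) f x)" for x
  have "\<bar>g x\<bar> \<le> (\<Sum>i=1..N. \<bar>B i\<bar>)" if x: "x \<in> {0..1}" for x
  proof (cases "x \<in> mesh N")
    case True
    then show ?thesis by (auto simp: g_def intro: sum_nonneg)
  next
    case False
    then obtain i where i: "i \<in> {1..N}" "x \<in> {(real i - 1) / real N <..< real i / real N}"
      using mesh_cell[OF N, of x] x by blast
    then have "\<bar>g x\<bar> \<le> \<bar>B i\<bar>" using B[OF i] False by (simp add: g_def)
    also have "\<dots> \<le> (\<Sum>i=1..N. \<bar>B i\<bar>)" using i by (intro member_le_sum) auto
    finally show ?thesis .
  qed
  moreover have "continuous_on ({0..1} - mesh N) g"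
  proof -
    have "continuous_on ({0..1} - mesh N) ((deriv ^^ k) f)"
    proof (intro continuous_at_imp_continuous_on ballI)
      fix x assume "x \<in> {0..1} - mesh N"
      then obtain i where i: "i \<in> {1..N}" "x \<in> {(real i - 1) / real N <..< real i / real N}"
        using mesh_cell[OF N, of x] by blast
      then show "isCont ((deriv ^^ k) f) x" using spline_cell[OF f i(1)] DERIV_isCont by metis
    qed
    then show ?thesis by (rule continuous_on_eq) (simp add: g_def)
  qed
  ultimately have "pw g" unfolding pw_def using finite_mesh[of N] by blast
  then show ?thesis by (rule pw_cong_finite[OF _ finite_mesh[of N]]) (simp add: g_def)
qed

text \<open>A common home for splines and smooth functions: C^1 with a bounded second derivative
  that exists off the nodes. All integrals of the scheme make sense here, and an antiderivative that
  involves only first derivatives is continuous across the nodes, so that integration leaves no jump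
  terms.\<close>

definition W2 :: "nat \<Rightarrow> (real \<Rightarrow> real) set" where
  "W2 N = {f. periodic1 f \<and> (\<forall>x. (f has_real_derivative deriv f x) (at x)) \<and> continuous_on UNIV (deriv f) \<and>
    (\<forall>x\<in>{0..1} - mesh N. (deriv f has_real_derivative (deriv ^^ 2) f x) (at x)) \<and> pw ((deriv ^^ 2) f)}"

lemma W2D:
  assumes "f \<in> W2 N"
  shows "periodic1 f" "(f has_real_derivative deriv f x) (at x)" "continuous_on UNIV (deriv f)"
    "x \<in> {0..1} - mesh N \<Longrightarrow> (deriv f has_real_derivative (deriv ^^ 2) f x) (at x)"
    "continuous_on UNIV f" "pw f" "pw (deriv f)" "pw ((deriv ^^ 2) f)" "periodic1 (deriv f)"
proof -
  show *: "periodic1 f" "(f has_real_derivative deriv f x) (at x)" "continuous_on UNIV (deriv f)"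
    "x \<in> {0..1} - mesh N \<Longrightarrow> (deriv f has_real_derivative (deriv ^^ 2) f x) (at x)" "pw ((deriv ^^ 2) f)" for x
    using assms by (auto simp: W2_def)
  show c: "continuous_on UNIV f"
    by (intro continuous_at_imp_continuous_on ballI DERIV_isCont[OF *(2)])
  show "pw f" "pw (deriv f)" using c * by (auto intro: pw_continuous)
  show "periodic1 (deriv f)" by (rule periodic1_deriv[OF *(1,2)])
qed

lemma C_per_W2:
  assumes "f \<in> C_per 2"
  shows "f \<in> W2 N"
proof -
  have "((deriv ^^ 0) f has_real_derivative (deriv ^^ 1) f x) (at x)" for x
    using C_perD(2)[OF assms, of 0] by simp
  moreover have "((deriv ^^ 1) f has_real_derivative (deriv ^^ 2) f x) (at x)" for x
    using C_perD(2)[OF assms, of 1] by (simp add: numeral_2_eq_2)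
  ultimately show ?thesis
    using C_perD(1)[OF assms] C_per_continuous[OF assms, of 1] C_per_continuous[OF assms, of 2]
    by (simp add: W2_def pw_continuous)
qed

text \<open>For \<open>r \<ge> 3\<close> splines are C^(r-2), hence C^1; the second derivative
  exists inside the cells, where a spline is a polynomial.\<close>

lemma splines_W2:
  assumes r: "r \<ge> 3" and N: "N \<ge> 1" and f: "f \<in> splines r N"
  shows "f \<in> W2 N"
proof -
  have C: "f \<in> C_per (r - 2)" using f by (simp add: splines_def)
  then have C1: "f \<in> C_per 1" by (rule C_per_mono) (use r in simp)
  have "(deriv f has_real_derivative (deriv ^^ 2) f x) (at x)" if x: "x \<in> {0..1} - mesh N" for x
  proof -
    obtain i where i: "i \<in> {1..N}" "x \<in> {(real i - 1) / real N <..< real i / real N}"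
      using mesh_cell[OF N x] by blast
    then have "((deriv ^^ 1) f has_real_derivative (deriv ^^ Suc 1) f x) (at x)"
      using spline_cell[OF f i(1)] by metis
    then show ?thesis by (simp add: numeral_2_eq_2)
  qed
  then show ?thesis
    using C_perD(1)[OF C1] C_perD(2)[OF C1, of 0] C_per_continuous[OF C1, of 1] spline_pw_deriv[OF f N, of 2]
    by (simp add: W2_def)
qed

lemma deriv_add_cmult_W2:
  assumes "f \<in> W2 N" "g \<in> W2 N"
  shows "deriv (\<lambda>x. f x + c * g x) = (\<lambda>x. deriv f x + c * deriv g x)"
    "x \<in> {0..1} - mesh N \<Longrightarrow> (deriv ^^ 2) (\<lambda>x. f x + c * g x) x = (deriv ^^ 2) f x + c * (deriv ^^ 2) g x"
proof -
  show *: "deriv (\<lambda>x. f x + c * g x) = (\<lambda>x. deriv f x + c * deriv g x)"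
    by (intro ext DERIV_imp_deriv DERIV_add DERIV_cmult W2D(2)[OF assms(1)] W2D(2)[OF assms(2)])
  show "(deriv ^^ 2) (\<lambda>x. f x + c * g x) x = (deriv ^^ 2) f x + c * (deriv ^^ 2) g x" if "x \<in> {0..1} - mesh N"
  proof -
    have "deriv (\<lambda>x. deriv f x + c * deriv g x) x = (deriv ^^ 2) f x + c * (deriv ^^ 2) g x"
      by (intro DERIV_imp_deriv DERIV_add DERIV_cmult W2D(4)[OF assms(1) that] W2D(4)[OF assms(2) that])
    then show ?thesis by (simp add: numeral_2_eq_2 *)
  qed
qed

lemma W2_function_space: "function_space (W2 N)"
proof
  show "(\<lambda>_. 0) \<in> W2 N" by (rule C_per_W2, rule C_perI(1)[where D = "\<lambda>_ _. 0"]) (auto simp: periodic1_def)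
  fix f g :: "real \<Rightarrow> real" and c
  assume fg: "f \<in> W2 N" "g \<in> W2 N"
  note d = deriv_add_cmult_W2[OF fg, where c = c]
  have "periodic1 (\<lambda>x. f x + c * g x)"
    using W2D(1)[OF fg(1)] W2D(1)[OF fg(2)] by (simp add: periodic1_def)
  moreover have "((\<lambda>x. f x + c * g x) has_real_derivative deriv f x + c * deriv g x) (at x)" for x
    by (intro DERIV_add DERIV_cmult W2D(2)[OF fg(1)] W2D(2)[OF fg(2)])
  moreover have "continuous_on UNIV (\<lambda>x. deriv f x + c * deriv g x)"
    by (intro continuous_intros W2D(3)[OF fg(1)] W2D(3)[OF fg(2)])
  moreover have "((\<lambda>x. deriv f x + c * deriv g x) has_real_derivative (deriv ^^ 2) f x + c * (deriv ^^ 2) g x) (at x)"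
    if "x \<in> {0..1} - mesh N" for x
    by (intro DERIV_add DERIV_cmult W2D(4)[OF fg(1) that] W2D(4)[OF fg(2) that])
  moreover have "pw (\<lambda>x. (deriv ^^ 2) f x + c * (deriv ^^ 2) g x)"
    by (intro pw_add pw_cmult W2D(8)[OF fg(1)] W2D(8)[OF fg(2)])
  then have "pw ((deriv ^^ 2) (\<lambda>x. f x + c * g x))"
    by (rule pw_cong_finite[OF _ finite_mesh[of N]]) (rule d(2))
  ultimately show "(\<lambda>x. f x + c * g x) \<in> W2 N"
    using d by (simp add: W2_def)
qed

lemma splines_function_space: "function_space (splines r N)"
proof
  have "(\<lambda>_. 0) \<in> C_per (r - 2)" by (rule C_perI(1)[where D = "\<lambda>_ _. 0"]) (auto simp: periodic1_def)
  moreover have "\<exists>p :: real poly. degree p \<le> r - 1 \<and> (\<forall>x\<in>S. 0 = poly p x)" for S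
    by (intro exI[of _ 0]) auto
  ultimately show "(\<lambda>_. 0) \<in> splines r N" unfolding splines_def by blast
  fix f g :: "real \<Rightarrow> real" and c
  assume fg: "f \<in> splines r N" "g \<in> splines r N"
  have "\<exists>p :: real poly. degree p \<le> r - 1 \<and>
        (\<forall>x\<in>{(real i - 1) / real N .. real i / real N}. f x + c * g x = poly p x)" if i: "i \<in> {1..N}" for i
  proof -
    obtain p where p: "degree p \<le> r - 1" "\<And>x. x \<in> {(real i - 1) / real N .. real i / real N} \<Longrightarrow> f x = poly p x"
      using fg(1) i unfolding splines_def by blast
    obtain q where q: "degree q \<le> r - 1" "\<And>x. x \<in> {(real i - 1) / real N .. real i / real N} \<Longrightarrow> g x = poly q x"
      using fg(2) i unfolding splines_def by blast
    have "degree (p + smult c q) \<le> r - 1"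
      using p q by (intro degree_add_le) (auto intro: order_trans[OF degree_smult_le])
    then show ?thesis using p q by (intro exI[of _ "p + smult c q"]) auto
  qed
  moreover have "(\<lambda>x. f x + c * g x) \<in> C_per (r - 2)"
    using fg by (intro C_per_add_cmult(1)) (auto simp: splines_def)
  ultimately show "(\<lambda>x. f x + c * g x) \<in> splines r N" unfolding splines_def by blast
qed

section \<open>The energy structure of the Camassa--Holm form\<close>

definition h1_inner :: "(real \<Rightarrow> real) \<Rightarrow> (real \<Rightarrow> real) \<Rightarrow> real" where
  "h1_inner f g = l2_inner f g + l2_inner (deriv f) (deriv g)"

text \<open>\<open>ch_form w w h\<close> is the nonlinear part of the scheme. Its two quadratic
  slots are separated, so that the form is trilinear and can be expanded at \<open>H - e\<close>;
  they are split such that in \<open>ch_form w e e\<close> the highest derivatives combine to an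
  exact derivative.\<close>

definition ch_form :: "(real \<Rightarrow> real) \<Rightarrow> (real \<Rightarrow> real) \<Rightarrow> (real \<Rightarrow> real) \<Rightarrow> real" where
  "ch_form w v h = 3 * l2_inner (\<lambda>x. w x * deriv v x) h + 1/2 * l2_inner (\<lambda>x. deriv w x * deriv v x) (deriv h)
     + l2_inner (\<lambda>x. w x * (deriv ^^ 2) v x) (deriv h)"

lemma h1_inner_commute: "h1_inner f g = h1_inner g f"
  by (simp add: h1_inner_def l2_inner_commute)

lemma h1_inner_add_cmult:
  assumes "f \<in> W2 N" "g \<in> W2 N" "h \<in> W2 N"
  shows "h1_inner (\<lambda>x. f x + c * g x) h = h1_inner f h + c * h1_inner g h"
  unfolding h1_inner_def deriv_add_cmult_W2(1)[OF assms(1,2)]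
  by (simp add: l2_inner_add_cmult_left W2D(6,7)[OF assms(1)] W2D(6,7)[OF assms(2)] W2D(6,7)[OF assms(3)] algebra_simps)

lemma ch_form_add_cmult_1:
  assumes "f \<in> W2 N" "g \<in> W2 N" "v \<in> W2 N" "h \<in> W2 N"
  shows "ch_form (\<lambda>x. f x + c * g x) v h = ch_form f v h + c * ch_form g v h"
proof -
  note pws = W2D(6-8)[OF assms(1)] W2D(6-8)[OF assms(2)] W2D(6-8)[OF assms(3)] W2D(6-8)[OF assms(4)]
  have *: "l2_inner (\<lambda>x. (a x + c * b x) * d x) e = l2_inner (\<lambda>x. a x * d x) e + c * l2_inner (\<lambda>x. b x * d x) e"
    if "pw a" "pw b" "pw d" "pw e" for a b d e
    using l2_inner_add_cmult_left[of "\<lambda>x. a x * d x" "\<lambda>x. b x * d x" e c] that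
    by (simp add: pw_mult algebra_simps)
  show ?thesis
    unfolding ch_form_def deriv_add_cmult_W2(1)[OF assms(1,2)] by (simp only: * pws) (simp add: algebra_simps)
qed

lemma ch_form_add_cmult_2:
  assumes "f \<in> W2 N" "g \<in> W2 N" "w \<in> W2 N" "h \<in> W2 N"
  shows "ch_form w (\<lambda>x. f x + c * g x) h = ch_form w f h + c * ch_form w g h"
proof -
  note pws = W2D(6-8)[OF assms(1)] W2D(6-8)[OF assms(2)] W2D(6-8)[OF assms(3)] W2D(6-8)[OF assms(4)]
  have *: "l2_inner (\<lambda>x. d x * (a x + c * b x)) e = l2_inner (\<lambda>x. d x * a x) e + c * l2_inner (\<lambda>x. d x * b x) e"
    if "pw a" "pw b" "pw d" "pw e" for a b d e
    using l2_inner_add_cmult_left[of "\<lambda>x. d x * a x" "\<lambda>x. d x * b x" e c] that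
    by (simp add: pw_mult algebra_simps)
  have "l2_inner (\<lambda>x. w x * (deriv ^^ 2) (\<lambda>x. f x + c * g x) x) (deriv h)
     = l2_inner (\<lambda>x. w x * ((deriv ^^ 2) f x + c * (deriv ^^ 2) g x)) (deriv h)"
    by (rule l2_inner_cong_finite[OF finite_mesh[of N]])
      (simp only: deriv_add_cmult_W2(2)[OF assms(1,2)])
  then show ?thesis
    unfolding ch_form_def deriv_add_cmult_W2(1)[OF assms(1,2)] by (simp only: * pws) (simp add: algebra_simps)
qed

lemma ch_form_add_cmult_3:
  assumes "f \<in> W2 N" "g \<in> W2 N" "w \<in> W2 N" "v \<in> W2 N"
  shows "ch_form w v (\<lambda>x. f x + c * g x) = ch_form w v f + c * ch_form w v g"
proof -
  note pws = W2D(6-8)[OF assms(1)] W2D(6-8)[OF assms(2)] W2D(6-8)[OF assms(3)] W2D(6-8)[OF assms(4)]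
  have *: "l2_inner d (\<lambda>x. a x + c * b x) = l2_inner d a + c * l2_inner d b"
    if "pw a" "pw b" "pw d" for a b d
    using l2_inner_add_cmult_left[of a b d c] that by (simp add: l2_inner_commute[of d])
  show ?thesis
    unfolding ch_form_def deriv_add_cmult_W2(1)[OF assms(1,2)] by (simp add: * pws pw_mult algebra_simps)
qed

section \<open>Cancellations for periodic functions\<close>

lemma integral_derivative_periodic_eq_0:
  fixes F :: "real \<Rightarrow> real"
  assumes "continuous_on {0..1} F" "F 0 = F 1" "finite S"
    "\<And>x. x \<in> {0..1} - S \<Longrightarrow> (F has_real_derivative f x) (at x)"
  shows "integral {0..1} f = 0"
proof -
  have "(f has_integral (F 1 - F 0)) {0..1}"
    using assms by (intro fundamental_theorem_of_calculus_interior_strong[of S])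
      (auto simp: has_real_derivative_iff_has_vector_derivative)
  then show ?thesis using assms(2) by (simp add: integral_unique)
qed

lemma l2_inner_by_parts:
  assumes "periodic1 f" "periodic1 g"
    and f: "\<And>x. (f has_real_derivative f' x) (at x)" and g: "\<And>x. (g has_real_derivative g' x) (at x)"
    and c: "continuous_on UNIV f'" "continuous_on UNIV g'"
  shows "l2_inner f g' = - l2_inner f' g"
proof -
  have cf: "continuous_on UNIV f" "continuous_on UNIV g"
    using f g by (auto intro!: continuous_at_imp_continuous_on DERIV_isCont)
  have "f 1 = f 0" "g 1 = g 0" using assms(1,2) unfolding periodic1_def by (metis add_0)+
  then have "integral {0..1} (\<lambda>x. f' x * g x + f x * g' x) = 0"
    by (intro integral_derivative_periodic_eq_0[where F = "\<lambda>x. f x * g x" and S = "{}"])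
      (auto intro!: derivative_eq_intros f g continuous_intros continuous_on_subset[OF cf(1)] continuous_on_subset[OF cf(2)])
  moreover have "integral {0..1} (\<lambda>x. f' x * g x + f x * g' x) = l2_inner f' g + l2_inner f g'"
    unfolding l2_inner_def by (intro integral_add pw_integrable pw_mult pw_continuous cf c)
  ultimately show ?thesis by simp
qed

text \<open>The two terms tested with the derivative of \<open>e\<close> are together the derivative
  of w e'^2 / 2, which is periodic and continuous across the nodes. So no second derivative of
  \<open>e\<close> survives.\<close>

lemma ch_form_diag:
  assumes w: "w \<in> W2 N" and e: "e \<in> W2 N"
  shows "ch_form w e e = 3 * l2_inner (\<lambda>x. w x * deriv e x) e"
proof -
  note pws = W2D(6-8)[OF w] W2D(6-8)[OF e]
  have p: "w 1 = w 0" "deriv e 1 = deriv e 0"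
    using W2D(1)[OF w] W2D(9)[OF e] unfolding periodic1_def by (metis add_0)+
  have "integral {0..1} (\<lambda>x. 1/2 * (deriv w x * deriv e x * deriv e x) + w x * (deriv ^^ 2) e x * deriv e x) = 0"
  proof (rule integral_derivative_periodic_eq_0[where F = "\<lambda>x. 1/2 * (w x * (deriv e x * deriv e x))" and S = "mesh N"])
    show "continuous_on {0..1} (\<lambda>x. 1/2 * (w x * (deriv e x * deriv e x)))"
      by (intro continuous_intros continuous_on_subset[OF W2D(5)[OF w]] continuous_on_subset[OF W2D(3)[OF e]]) auto
    fix x assume x: "x \<in> {0..1} - mesh N"
    show "((\<lambda>x. 1/2 * (w x * (deriv e x * deriv e x))) has_real_derivative
        1/2 * (deriv w x * deriv e x * deriv e x) + w x * (deriv ^^ 2) e x * deriv e x) (at x)"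
      by (rule derivative_eq_intros W2D(2)[OF w] W2D(4)[OF e x] refl | simp add: algebra_simps)+
  qed (use p finite_mesh in auto)
  moreover have "integral {0..1} (\<lambda>x. 1/2 * (deriv w x * deriv e x * deriv e x) + w x * (deriv ^^ 2) e x * deriv e x)
     = 1/2 * l2_inner (\<lambda>x. deriv w x * deriv e x) (deriv e) + l2_inner (\<lambda>x. w x * (deriv ^^ 2) e x) (deriv e)"
    unfolding l2_inner_def by (subst integral_add) (simp_all only: pw_integrable pw_cmult pw_mult pws integral_mult_right)
  ultimately show ?thesis by (simp add: ch_form_def)
qed

text \<open>What \<open>ch_form_diag\<close> leaves is the integral of 3 e^2 e', the derivative of
  e^3.\<close>

lemma ch_form_self_eq_0:
  assumes e: "e \<in> W2 N"
  shows "ch_form e e e = 0"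
proof -
  have p: "e 1 = e 0" using W2D(1)[OF e] unfolding periodic1_def by (metis add_0)
  have "integral {0..1} (\<lambda>x. e x * deriv e x * e x) = 0"
  proof (rule integral_derivative_periodic_eq_0[where F = "\<lambda>x. 1/3 * (e x * (e x * e x))" and S = "{}"])
    show "continuous_on {0..1} (\<lambda>x. 1/3 * (e x * (e x * e x)))"
      by (intro continuous_intros continuous_on_subset[OF W2D(5)[OF e]]) auto
    show "((\<lambda>x. 1/3 * (e x * (e x * e x))) has_real_derivative e x * deriv e x * e x) (at x)" for x
      by (rule derivative_eq_intros W2D(2)[OF e] refl | simp add: algebra_simps)+
  qed (use p in auto)
  then show ?thesis by (simp add: ch_form_diag[OF e e] l2_inner_def)
qed

text \<open>In the expansion at \<open>H - e\<close> the term cubic in \<open>e\<close> vanishes,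
  and \<open>ch_form_diag\<close> removes the second derivative of \<open>e\<close>. What remains is
  quadratic in \<open>e\<close> and its first derivative, with derivatives of \<open>H\<close> of
  order at most 2 as coefficients.\<close>

lemma ch_form_diff_energy_bound:
  assumes H: "H \<in> W2 N" and e: "e \<in> W2 N"
    and M: "\<And>x. x \<in> {0..1} - mesh N \<Longrightarrow> \<bar>H x\<bar> \<le> M \<and> \<bar>deriv H x\<bar> \<le> M \<and> \<bar>(deriv ^^ 2) H x\<bar> \<le> M"
  shows "\<bar>ch_form H H e - ch_form (\<lambda>x. H x - e x) (\<lambda>x. H x - e x) e\<bar> \<le> 5 * M * h1_inner e e"
proof -
  interpret function_space "W2 N" by (rule W2_function_space)
  note pws = W2D(6-8)[OF H] W2D(6-8)[OF e]
  have D: "(\<lambda>x. H x + (-1) * e x) \<in> W2 N" by (rule add_cmult[OF H e])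
  have "ch_form (\<lambda>x. H x + (-1) * e x) (\<lambda>x. H x + (-1) * e x) e
     = ch_form H H e - ch_form e H e - ch_form H e e + ch_form e e e"
    by (simp only: ch_form_add_cmult_1[OF H e D e] ch_form_add_cmult_2[OF H e H e] ch_form_add_cmult_2[OF H e e e]) simp
  then have "ch_form H H e - ch_form (\<lambda>x. H x - e x) (\<lambda>x. H x - e x) e = ch_form e H e + 3 * l2_inner (\<lambda>x. H x * deriv e x) e"
    by (simp add: ch_form_self_eq_0[OF e] ch_form_diag[OF H e])
  also have "\<dots> = integral {0..1} (\<lambda>x. 3 * (e x * deriv H x * e x) + 1/2 * (deriv e x * deriv H x * deriv e x)
      + e x * (deriv ^^ 2) H x * deriv e x + 3 * (H x * deriv e x * e x))" (is "_ = integral _ ?G")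
    unfolding ch_form_def l2_inner_def
    by (simp only: integral_add pw_integrable pw_cmult pw_mult pw_add pws integral_mult_right)
  finally have eq: "ch_form H H e - ch_form (\<lambda>x. H x - e x) (\<lambda>x. H x - e x) e = integral {0..1} ?G" .
  have pG: "pw ?G" by (intro pw_add pw_cmult pw_mult pws)
  let ?K = "\<lambda>x. 5 * M * (e x * e x + deriv e x * deriv e x)"
  have pK: "pw ?K" "pw (\<lambda>x. - 5 * M * (e x * e x + deriv e x * deriv e x))" by (intro pw_add pw_cmult pw_mult pws)+
  have K: "integral {0..1} (\<lambda>x. c * (e x * e x + deriv e x * deriv e x)) = c * h1_inner e e" for c
    unfolding h1_inner_def l2_inner_def
    by (subst integral_mult_right, subst integral_add) (simp_all only: pw_integrable pw_mult pws)
  have bnd: "\<bar>?G x\<bar> \<le> ?K x" if "x \<in> {0..1} - mesh N" for x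
  proof -
    define a b where "a = e x" and "b = deriv e x"
    note m = M[OF that]
    then have M0: "0 \<le> M" by linarith
    have 1: "\<bar>p * q\<bar> \<le> M * q'" if "\<bar>p\<bar> \<le> M" "\<bar>q\<bar> \<le> q'" for p q q' :: real
      using mult_mono[OF that] M0 by (simp add: abs_mult)
    have ab: "\<bar>a * b\<bar> \<le> (a * a + b * b) / 2"
      using zero_le_square[of "\<bar>a\<bar> - \<bar>b\<bar>"] by (simp add: abs_mult algebra_simps)
    have t1: "\<bar>deriv H x * (a * a)\<bar> \<le> M * (a * a)" by (rule 1) (use m in auto)
    have t2: "\<bar>deriv H x * (b * b)\<bar> \<le> M * (b * b)" by (rule 1) (use m in auto)
    have t3: "\<bar>(deriv ^^ 2) H x * (a * b)\<bar> \<le> M * ((a * a + b * b) / 2)" by (rule 1) (use m ab in auto)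
    have t4: "\<bar>H x * (a * b)\<bar> \<le> M * ((a * a + b * b) / 2)" by (rule 1) (use m ab in auto)
    have n: "0 \<le> M * (a * a)" "0 \<le> M * (b * b)" using M0 by auto
    \<comment> \<open>The weight of \<open>A\<close> is 3 + 1/2 + 3/2 = 5, that of \<open>B\<close>
      only 5/2.\<close>
    have gen: "\<bar>3 * p + 1/2 * q + s + 3 * t\<bar> \<le> 5 * A + 5 * B"
      if "\<bar>p\<bar> \<le> A" "\<bar>q\<bar> \<le> B" "\<bar>s\<bar> \<le> (A + B) / 2" "\<bar>t\<bar> \<le> (A + B) / 2" "0 \<le> A" "0 \<le> B"
      for p q s t A B :: real
      using that unfolding abs_le_iff by auto
    have G: "?G x = 3 * (deriv H x * (a * a)) + 1/2 * (deriv H x * (b * b)) + (deriv ^^ 2) H x * (a * b) + 3 * (H x * (a * b))"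
      by (simp add: a_def b_def mult_ac)
    have K: "?K x = 5 * (M * (a * a)) + 5 * (M * (b * b))" by (simp add: a_def b_def algebra_simps)
    have "M * ((a * a + b * b) / 2) = (M * (a * a) + M * (b * b)) / 2" by (simp add: algebra_simps)
    then show ?thesis unfolding G K using t1 t2 t3 t4 n by (intro gen) simp_all
  qed
  have "integral {0..1} ?G \<le> integral {0..1} ?K"
    by (rule integral_mono_pw[OF pG pK(1) finite_mesh[of N]]) (use bnd in \<open>meson abs_le_D1\<close>)
  moreover have "integral {0..1} (\<lambda>x. - 5 * M * (e x * e x + deriv e x * deriv e x)) \<le> integral {0..1} ?G"
    by (rule integral_mono_pw[OF pK(2) pG finite_mesh[of N]]) (use bnd in force)
  ultimately show ?thesis unfolding eq K by (simp add: abs_le_iff)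
qed

lemma spline_l2_definite:
  assumes "f \<in> W2 N" "l2_inner f f = 0"
  shows "f = (\<lambda>_. 0)"
proof -
  have c: "continuous_on {0..1} (\<lambda>x. f x * f x)"
    by (intro continuous_intros continuous_on_subset[OF W2D(5)[OF assms(1)]]) auto
  have "((\<lambda>x. f x * f x) has_integral 0) {0..1}"
    using assms(2) integrable_integral[OF integrable_continuous_interval[OF c]] by (simp add: l2_inner_def)
  then have z: "f x * f x = 0" if "x \<in> {0..1}" for x
    using has_integral_0_cbox_imp_0[of 0 1 "\<lambda>x. f x * f x" x] c that by (simp add: box_real)
  show ?thesis
  proof
    fix x show "f x = 0"
      by (rule periodic1_reduce[OF W2D(1)[OF assms(1)], of x]) (use z in force)
  qed
qed

lemma splines_l2_inner_space:
  assumes "r \<ge> 3" "N \<ge> 1"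
  shows "function_inner_space (splines r N) l2_inner"
proof -
  interpret function_space "splines r N" by (rule splines_function_space)
  note W = splines_W2[OF assms]
  show ?thesis
  proof
    show "l2_inner (\<lambda>x. f x + c * g x) h = l2_inner f h + c * l2_inner g h"
      if "f \<in> splines r N" "g \<in> splines r N" "h \<in> splines r N" for f g h c
      by (intro l2_inner_add_cmult_left W2D(6)[OF W] that)
    show "f = (\<lambda>_. 0)" if "f \<in> splines r N" "l2_inner f f = 0" for f
      by (rule spline_l2_definite[OF W[OF that(1)] that(2)])
    show "0 \<le> l2_inner f f" if "f \<in> splines r N" for f
      by (intro l2_inner_nonneg W2D(6)[OF W] that)
  qed (rule l2_inner_commute)
qed

lemma splines_h1_inner_space:
  assumes "r \<ge> 3" "N \<ge> 1"
  shows "function_inner_space (splines r N) h1_inner"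
proof -
  interpret function_space "splines r N" by (rule splines_function_space)
  note W = splines_W2[OF assms]
  have nn: "0 \<le> l2_inner f f" "0 \<le> l2_inner (deriv f) (deriv f)" if "f \<in> splines r N" for f
    by (rule l2_inner_nonneg, rule W2D[OF W[OF that]])+
  show ?thesis
  proof
    show "h1_inner (\<lambda>x. f x + c * g x) h = h1_inner f h + c * h1_inner g h"
      if "f \<in> splines r N" "g \<in> splines r N" "h \<in> splines r N" for f g h c
      by (rule h1_inner_add_cmult[OF W[OF that(1)] W[OF that(2)] W[OF that(3)]])
    show "f = (\<lambda>_. 0)" if "f \<in> splines r N" "h1_inner f f = 0" for f
      using nn[OF that(1)] that(2) by (intro spline_l2_definite[OF W[OF that(1)]]) (simp add: h1_inner_def)
    show "0 \<le> h1_inner f f" if "f \<in> splines r N" for f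
      using nn[OF that] by (simp add: h1_inner_def)
  qed (rule h1_inner_commute)
qed

section \<open>Inverse estimates for the quasiinterpolant\<close>

definition polys :: "nat \<Rightarrow> (real \<Rightarrow> real) set" where
  "polys n = {poly p |p. degree p \<le> n}"

lemma polys_l2_inner_space: "function_inner_space (polys n) l2_inner"
proof
  have pp: "pw f" if "f \<in> polys n" for f
    using that by (auto simp: polys_def intro!: pw_continuous continuous_intros)
  show "(\<lambda>_. 0) \<in> polys n" unfolding polys_def by (auto intro!: exI[of _ 0] simp: fun_eq_iff)
  show "(\<lambda>x. f x + c * g x) \<in> polys n" if fg: "f \<in> polys n" "g \<in> polys n" for f g c
  proof -
    obtain p q where "f = poly p" "g = poly q" "degree p \<le> n" "degree q \<le> n"
      using fg by (auto simp: polys_def)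
    then show ?thesis unfolding polys_def
      by (auto intro!: exI[of _ "p + smult c q"] degree_add_le order_trans[OF degree_smult_le] simp: fun_eq_iff)
  qed
  show "l2_inner f g = l2_inner g f" for f g by (rule l2_inner_commute)
  show "l2_inner (\<lambda>x. f x + c * g x) h = l2_inner f h + c * l2_inner g h"
    if "f \<in> polys n" "g \<in> polys n" "h \<in> polys n" for f g h c
    by (intro l2_inner_add_cmult_left pp that)
  show "0 \<le> l2_inner f f" if "f \<in> polys n" for f
    by (intro l2_inner_nonneg pp that)
  show "f = (\<lambda>_. 0)" if f: "f \<in> polys n" "l2_inner f f = 0" for f
  proof -
    obtain p where p: "f = poly p" using f by (auto simp: polys_def)
    have c: "continuous_on {0..1} (\<lambda>x. f x * f x)"
      unfolding p by (intro continuous_intros)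
    have "((\<lambda>x. f x * f x) has_integral 0) {0..1}"
      using f(2) integrable_integral[OF integrable_continuous_interval[OF c]] by (simp add: l2_inner_def)
    then have z: "poly p x = 0" if "x \<in> {0..1}" for x
      using has_integral_0_cbox_imp_0[of 0 1 "\<lambda>x. f x * f x" x] c that p by (simp add: box_real)
    have "p = 0"
    proof (rule ccontr)
      assume "p \<noteq> 0"
      then have "finite {x. poly p x = 0}" by (rule poly_roots_finite)
      then have "finite {0..1::real}" by (rule finite_subset[rotated]) (use z in auto)
      then show False by (simp add: infinite_Icc)
    qed
    then show ?thesis using p by (simp add: fun_eq_iff)
  qed
qed

text \<open>Equivalence of norms in finite dimension, made explicit: the coordinates in an
  L2-orthonormal basis of the polynomials are bounded by the norm, and each basis element has
  bounded derivatives on the unit interval.\<close>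

lemma poly_deriv_le_l2_norm:
  obtains C where "C \<ge> 0"
    "\<And>p x. degree p \<le> n \<Longrightarrow> x \<in> {0..1} \<Longrightarrow> \<bar>poly ((pderiv ^^ k) p) x\<bar> \<le> C * l2_norm (poly p)"
proof -
  interpret function_inner_space "polys n" l2_inner by (rule polys_l2_inner_space)
  have b: "poly (monom 1 j) \<in> polys n" if "j \<in> {..n}" for j
    using that unfolding polys_def by (auto intro!: exI[of _ "monom 1 j"] order_trans[OF degree_monom_le])
  have span: "\<exists>c. f = (\<lambda>x. \<Sum>j\<in>{..n}. c j * poly (monom 1 j) x)" if fV: "f \<in> polys n" for f
  proof -
    obtain p where p: "f = poly p" "degree p \<le> n" using fV by (auto simp: polys_def)
    have "poly p x = (\<Sum>j\<le>n. coeff p j * poly (monom 1 j) x)" for x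
      by (subst poly_as_sum_of_monoms'[OF p(2), symmetric]) (simp add: poly_sum poly_monom)
    then show ?thesis using p by blast
  qed
  obtain m :: nat and e where e: "\<And>i. i < m \<Longrightarrow> e i \<in> polys n"
    and orth: "\<And>i j. i < m \<Longrightarrow> j < m \<Longrightarrow> l2_inner (e i) (e j) = (if i = j then 1 else 0)"
    and rep: "\<And>f. f \<in> polys n \<Longrightarrow> f = (\<lambda>x. \<Sum>i<m. l2_inner f (e i) * e i x)"
    using orthonormal_basis[of "{..n}" "\<lambda>j. poly (monom 1 j)"] b span by blast
  have "\<exists>q. e i = poly q" if "i < m" for i using e[OF that] by (auto simp: polys_def)
  then obtain q where q: "\<And>i. i < m \<Longrightarrow> e i = poly (q i)" by metis
  have pe: "pw (e i)" if "i < m" for i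
    unfolding q[OF that] by (intro pw_continuous continuous_intros)
  have "\<exists>B. \<forall>x\<in>{0..1}. \<bar>poly ((pderiv ^^ k) (q i)) x\<bar> \<le> B" for i
  proof -
    have "bounded (poly ((pderiv ^^ k) (q i)) ` {0..1})"
      by (intro compact_imp_bounded compact_continuous_image continuous_intros) auto
    then show ?thesis unfolding bounded_iff real_norm_def by blast
  qed
  then obtain B where B: "\<And>i x. x \<in> {0..1} \<Longrightarrow> \<bar>poly ((pderiv ^^ k) (q i)) x\<bar> \<le> B i" by metis
  have B0: "0 \<le> B i" for i using B[of 0 i] by (meson abs_ge_zero atLeastAtMost_iff order_refl order_trans zero_le_one)
  have "\<bar>poly ((pderiv ^^ k) p) x\<bar> \<le> (\<Sum>i<m. B i) * l2_norm (poly p)" if p: "degree p \<le> n" and x: "x \<in> {0..1}" for p x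
  proof -
    have pV: "poly p \<in> polys n" using p by (auto simp: polys_def)
    have pwp: "pw (poly p)" by (intro pw_continuous continuous_intros)
    define c where "c i = l2_inner (poly p) (e i)" for i
    have "poly p y = (\<Sum>i<m. c i * poly (q i) y)" for y
      using fun_cong[OF rep[OF pV], of y] q by (simp add: c_def)
    then have "poly p = poly (\<Sum>i<m. smult (c i) (q i))" by (simp add: fun_eq_iff poly_sum)
    then have "p = (\<Sum>i<m. smult (c i) (q i))" by (simp only: poly_eq_poly_eq_iff)
    then have "poly ((pderiv ^^ k) p) x = (\<Sum>i<m. c i * poly ((pderiv ^^ k) (q i)) x)"
      by (simp add: higher_pderiv_sum higher_pderiv_smult poly_sum)
    then have "\<bar>poly ((pderiv ^^ k) p) x\<bar> \<le> (\<Sum>i<m. \<bar>c i * poly ((pderiv ^^ k) (q i)) x\<bar>)"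
      by (simp add: sum_abs)
    also have "\<dots> \<le> (\<Sum>i<m. l2_norm (poly p) * B i)"
    proof (rule sum_mono)
      fix i assume "i \<in> {..<m}"
      then have i: "i < m" by simp
      have "l2_norm (e i) = 1" using orth[OF i i] by (simp add: l2_norm_def)
      then have "\<bar>c i\<bar> \<le> l2_norm (poly p)"
        using l2_inner_cauchy_schwarz[OF pwp pe[OF i]] by (simp add: c_def)
      then show "\<bar>c i * poly ((pderiv ^^ k) (q i)) x\<bar> \<le> l2_norm (poly p) * B i"
        unfolding abs_mult using B[OF x] B0 by (intro mult_mono) (auto simp: l2_norm_nonneg pwp)
    qed
    finally show ?thesis by (simp add: sum_distrib_left mult.commute)
  qed
  then show ?thesis using that[of "\<Sum>i<m. B i"] B0 by (simp add: sum_nonneg)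
qed

lemma higher_pderiv_pcompose_affine:
  "(pderiv ^^ k) (pcompose p [:a, h:]) = smult (h ^ k) (pcompose ((pderiv ^^ k) p) [:a, h::real:])"
  by (induction k) (simp_all add: pderiv_smult pderiv_pcompose pderiv_pCons mult.commute)

text \<open>Scaling to the unit interval: each derivative contributes a factor \<open>h\<close>, and
  the substitution in the integral contributes \<open>sqrt h\<close>. Both stand on the left, so
  that nothing is divided.\<close>

lemma poly_inverse_inequality:
  obtains C where "C \<ge> 0"
    "\<And>p x a h. degree p \<le> n \<Longrightarrow> h > 0 \<Longrightarrow> x \<in> {a..a + h} \<Longrightarrow>
      \<bar>poly ((pderiv ^^ k) p) x\<bar> * h ^ k * sqrt h \<le> C * sqrt (integral {a..a + h} (\<lambda>y. poly p y * poly p y))"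
proof -
  obtain C where C: "C \<ge> 0"
    "\<And>p x. degree p \<le> n \<Longrightarrow> x \<in> {0..1} \<Longrightarrow> \<bar>poly ((pderiv ^^ k) p) x\<bar> \<le> C * l2_norm (poly p)"
    using poly_deriv_le_l2_norm[of n k] by blast
  have "\<bar>poly ((pderiv ^^ k) p) x\<bar> * h ^ k * sqrt h \<le> C * sqrt (integral {a..a + h} (\<lambda>y. poly p y * poly p y))"
    if p: "degree p \<le> n" and h: "h > 0" and x: "x \<in> {a..a + h}" for p x a h
  proof -
    define s where "s = (x - a) / h"
    have s: "s \<in> {0..1}" "a + s * h = x" using x h by (auto simp: s_def field_simps)
    let ?q = "pcompose p [:a, h:]"
    have "degree ?q \<le> n" using p degree_pcompose_le[of p "[:a, h:]"] by (auto split: if_splits)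
    then have 1: "\<bar>poly ((pderiv ^^ k) ?q) s\<bar> \<le> C * l2_norm (poly ?q)" using C(2) s(1) by blast
    have 2: "poly ((pderiv ^^ k) ?q) s = h ^ k * poly ((pderiv ^^ k) p) x"
      using s(2) by (simp add: higher_pderiv_pcompose_affine poly_pcompose)
    have "(\<lambda>y. poly p y * poly p y) integrable_on {a..a + h}"
      by (intro integrable_continuous_interval continuous_intros)
    then have "((\<lambda>y. poly p y * poly p y) has_integral integral {a..a + h} (\<lambda>y. poly p y * poly p y)) (cbox a (a + h))"
      by (simp add: integrable_integral)
    from has_integral_affinity'[OF this h, of a]
    have "((\<lambda>y. poly ?q y * poly ?q y) has_integral integral {a..a + h} (\<lambda>y. poly p y * poly p y) / h) {0..1}"
      using h by (simp add: poly_pcompose algebra_simps divide_inverse)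
    then have "l2_norm (poly ?q) = sqrt (integral {a..a + h} (\<lambda>y. poly p y * poly p y)) / sqrt h"
      by (simp add: l2_norm_def l2_inner_def integral_unique real_sqrt_divide)
    then have 3: "l2_norm (poly ?q) * sqrt h = sqrt (integral {a..a + h} (\<lambda>y. poly p y * poly p y))"
      using h by simp
    have "\<bar>poly ((pderiv ^^ k) p) x\<bar> * h ^ k * sqrt h = \<bar>poly ((pderiv ^^ k) ?q) s\<bar> * sqrt h"
      using h unfolding 2 by (simp add: abs_mult)
    also have "\<dots> \<le> C * l2_norm (poly ?q) * sqrt h" using 1 h by (intro mult_right_mono) auto
    finally show ?thesis by (simp only: mult.assoc 3)
  qed
  then show ?thesis using that C(1) by blast
qed

text \<open>The coefficients come from an arbitrary sequence \<open>d\<close>, not from a function,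
  so that differentiating only shifts \<open>d\<close> and lowers \<open>n\<close>.\<close>

definition taylor_poly :: "(nat \<Rightarrow> real) \<Rightarrow> nat \<Rightarrow> real \<Rightarrow> real poly" where
  "taylor_poly d n c = (\<Sum>m<n. smult (d m / fact m) ([:- c, 1:] ^ m))"

lemma degree_taylor_poly: "degree (taylor_poly d n c) \<le> n - 1"
  unfolding taylor_poly_def
proof (rule degree_sum_le)
  fix m assume "m \<in> {..<n}"
  then show "degree (smult (d m / fact m) ([:- c, 1:] ^ m)) \<le> n - 1"
    using degree_power_le[of "[:- c, 1:]" m] by (intro order_trans[OF degree_smult_le]) auto
qed simp

lemma poly_taylor_poly: "poly (taylor_poly d n c) x = (\<Sum>m<n. d m / fact m * (x - c) ^ m)"
  by (simp add: taylor_poly_def poly_sum)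

lemma pderiv_taylor_poly: "pderiv (taylor_poly d n c) = taylor_poly (\<lambda>m. d (Suc m)) (n - 1) c"
proof (cases n)
  case (Suc k)
  have "pderiv (smult (d (Suc m) / fact (Suc m)) ([:- c, 1:] ^ Suc m)) = smult (d (Suc m) / fact m) ([:- c, 1:] ^ m)" for m
  proof -
    have "pderiv (smult (d (Suc m) / fact (Suc m)) ([:- c, 1:] ^ Suc m))
      = smult (d (Suc m) / fact (Suc m) * real (Suc m)) ([:- c, 1:] ^ m)"
      unfolding pderiv_smult pderiv_power_Suc by (simp add: pderiv_pCons del: power_Suc of_nat_Suc)
    also have "d (Suc m) / fact (Suc m) * real (Suc m) = d (Suc m) / fact m"
      by (simp add: field_simps del: of_nat_Suc)
    finally show ?thesis .
  qed
  then show ?thesis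
    unfolding taylor_poly_def Suc sum.lessThan_Suc_shift pderiv_add higher_pderiv_sum[where n = 1, simplified]
    by (simp add: pderiv_smult del: power_Suc)
qed (simp add: taylor_poly_def)

lemma higher_pderiv_taylor_poly: "(pderiv ^^ k) (taylor_poly d n c) = taylor_poly (\<lambda>m. d (m + k)) (n - k) c"
  by (induction k) (simp_all add: pderiv_taylor_poly)

lemma taylor_poly_error:
  assumes v: "v \<in> CB r M" and k: "k < r" and x: "x \<in> {c..c + h}"
  shows "\<bar>(deriv ^^ k) v x - poly ((pderiv ^^ k) (taylor_poly (\<lambda>m. (deriv ^^ m) v c) r c)) x\<bar> \<le> M * h ^ (r - k)"
proof -
  have vC: "v \<in> C_per r" and vB: "\<And>j y. j \<le> r \<Longrightarrow> \<bar>(deriv ^^ j) v y\<bar> \<le> M" using v by (auto simp: CB_def)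
  have M: "0 \<le> M" by (rule CB_nonneg[OF v])
  show ?thesis
  \<comment> \<open>The Lagrange form of the remainder needs a point other than the centre.\<close>
  proof (cases "x = c")
    case True
    have "poly ((pderiv ^^ k) (taylor_poly (\<lambda>m. (deriv ^^ m) v c) r c)) c = (\<Sum>m<r - k. (deriv ^^ (m + k)) v c / fact m * 0 ^ m)"
      by (simp add: higher_pderiv_taylor_poly poly_taylor_poly)
    also have "\<dots> = (\<Sum>m<r - k. if m = 0 then (deriv ^^ k) v c else 0)"
      by (rule sum.cong) auto
    also have "\<dots> = (deriv ^^ k) v c" using k by simp
    finally show ?thesis using True M x by simp
  next
    case False
    have "\<exists>t. (if x < c then x < t \<and> t < c else c < t \<and> t < x) \<and>
      (deriv ^^ k) v x = (\<Sum>m<r - k. ((deriv ^^ (m + k)) v c / fact m) * (x - c) ^ m)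
        + ((deriv ^^ (r - k + k)) v t / fact (r - k)) * (x - c) ^ (r - k)"
    proof (rule Taylor[where diff = "\<lambda>m. (deriv ^^ (m + k)) v" and a = c and b = "c + h"])
      show "\<forall>m t. m < r - k \<and> c \<le> t \<and> t \<le> c + h \<longrightarrow>
         ((deriv ^^ (m + k)) v has_real_derivative (deriv ^^ (Suc m + k)) v t) (at t)"
        using C_perD(2)[OF vC] by (metis add_Suc less_diff_conv)
    qed (use k x False in auto)
    then obtain t where t: "(deriv ^^ k) v x = (\<Sum>m<r - k. ((deriv ^^ (m + k)) v c / fact m) * (x - c) ^ m)
        + ((deriv ^^ (r - k + k)) v t / fact (r - k)) * (x - c) ^ (r - k)" by blast
    have "\<bar>(deriv ^^ (r - k + k)) v t / fact (r - k)\<bar> \<le> M"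
    proof -
      have "\<bar>(deriv ^^ (r - k + k)) v t\<bar> / fact (r - k) \<le> M / 1"
        using vB[of "r - k + k" t] k M by (intro frac_le) auto
      then show ?thesis by simp
    qed
    moreover have "\<bar>(x - c) ^ (r - k)\<bar> \<le> h ^ (r - k)"
      unfolding power_abs using x by (intro power_mono) auto
    ultimately have "\<bar>((deriv ^^ (r - k + k)) v t / fact (r - k)) * (x - c) ^ (r - k)\<bar> \<le> M * h ^ (r - k)"
      unfolding abs_mult using M by (intro mult_mono) auto
    then show ?thesis unfolding t by (simp add: higher_pderiv_taylor_poly poly_taylor_poly)
  qed
qed

section \<open>Errors of the quasiinterpolant and of its derivatives\<close>

lemma quasi_interp_in_splines:
  assumes "is_spline_basis r N (\<phi> N)"
  shows "quasi_interp \<phi> N v \<in> splines r N"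
proof -
  interpret function_space "splines r N" by (rule splines_function_space)
  show ?thesis unfolding quasi_interp_def
    by (rule lincomb) (use assms in \<open>auto simp: is_spline_basis_def\<close>)
qed

lemma l2_norm_le_CB:
  assumes "v \<in> CB m M" "j \<le> m"
  shows "l2_norm ((deriv ^^ j) v) \<le> M"
proof (rule l2_norm_le_sup[where F = "{}"])
  show "pw ((deriv ^^ j) v)"
    by (rule pw_continuous, rule C_per_continuous) (use assms in \<open>auto simp: CB_def\<close>)
  show "0 \<le> M" by (rule CB_nonneg[OF assms(1)])
qed (use assms in \<open>auto simp: CB_def\<close>)

lemma quasi_interp_l2_error:
  assumes "approximation_property r \<phi>"
  obtains m C where "C \<ge> 0"
    "\<And>v M N. v \<in> CB m M \<Longrightarrow> N \<ge> 1 \<Longrightarrow> l2_norm (\<lambda>x. quasi_interp \<phi> N v x - v x) \<le> C * M * (1 / real N) ^ r"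
proof -
  obtain m C where C: "\<And>v N. v \<in> C_per m \<Longrightarrow> N \<ge> 1 \<Longrightarrow>
     l2_norm (\<lambda>x. quasi_interp \<phi> N v x - v x) \<le> C * (1 / real N) ^ r * l2_norm ((deriv ^^ r) v)"
    using assms unfolding approximation_property_def by blast
  \<comment> \<open>The ball must also control the derivative of order \<open>r\<close>, hence
    \<open>max m r\<close>; the modulus is taken because the sign of the given constant is
    unknown.\<close>
  have "l2_norm (\<lambda>x. quasi_interp \<phi> N v x - v x) \<le> \<bar>C\<bar> * M * (1 / real N) ^ r"
    if v: "v \<in> CB (max m r) M" and N: "N \<ge> 1" for v M N
  proof -
    have vr: "v \<in> CB r M" by (rule CB_mono[OF v]) auto
    have vm: "v \<in> CB m M" by (rule CB_mono[OF v]) auto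
    have n0: "0 \<le> l2_norm ((deriv ^^ r) v)"
      using vr C_per_continuous[of v r r] by (intro l2_norm_nonneg pw_continuous) (auto simp: CB_def)
    have "l2_norm (\<lambda>x. quasi_interp \<phi> N v x - v x) \<le> C * (1 / real N) ^ r * l2_norm ((deriv ^^ r) v)"
      using C[of v N] vm N by (auto simp: CB_def)
    also have "\<dots> \<le> \<bar>C\<bar> * (1 / real N) ^ r * l2_norm ((deriv ^^ r) v)"
      by (intro mult_right_mono n0) auto
    also have "\<dots> \<le> \<bar>C\<bar> * (1 / real N) ^ r * M"
      by (intro mult_left_mono l2_norm_le_CB[OF vr]) auto
    finally show ?thesis by (simp add: mult_ac)
  qed
  then show ?thesis using that[of "\<bar>C\<bar>" "max m r"] by simp
qed

text \<open>The inverse inequality is for polynomials, so on each cell the Taylor polynomial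
  \<open>q\<close> of \<open>v\<close> at the left node is inserted. The difference
  \<open>p - q\<close> is a polynomial, small in L2 by the global error of the quasiinterpolant and
  Taylor's theorem, hence pointwise small with its derivatives. The rest, \<open>v\<close> minus
  \<open>q\<close>, is Taylor's theorem again.\<close>

lemma quasi_interp_pointwise_error:
  assumes r: "r \<ge> 3" and \<phi>: "quasi_interp_basis r \<phi>"
  obtains m C where "C \<ge> 0"
    "\<And>v M N k x. v \<in> CB m M \<Longrightarrow> N \<ge> 1 \<Longrightarrow> k \<le> 2 \<Longrightarrow> x \<in> {0..1} - mesh N \<Longrightarrow>
      \<bar>(deriv ^^ k) (quasi_interp \<phi> N v) x - (deriv ^^ k) v x\<bar> * (1 / real N) ^ k * sqrt (1 / real N) \<le> C * M * (1 / real N) ^ r"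
proof -
  obtain m C0 where C0: "C0 \<ge> 0"
    "\<And>v M N. v \<in> CB m M \<Longrightarrow> N \<ge> 1 \<Longrightarrow> l2_norm (\<lambda>x. quasi_interp \<phi> N v x - v x) \<le> C0 * M * (1 / real N) ^ r"
    using quasi_interp_l2_error[of r \<phi>] \<phi> unfolding quasi_interp_basis_def by metis
  have "\<exists>C\<ge>0. \<forall>p x a h. degree p \<le> r - 1 \<longrightarrow> h > 0 \<longrightarrow> x \<in> {a..a + h} \<longrightarrow>
      \<bar>poly ((pderiv ^^ k) p) x\<bar> * h ^ k * sqrt h \<le> C * sqrt (integral {a..a + h} (\<lambda>y. poly p y * poly p y))" for k
    by (rule poly_inverse_inequality[of "r - 1" k], rule exI, rule conjI, assumption) blast
  then obtain C1 where C1: "\<And>k. C1 k \<ge> 0" "\<And>k p x a h. degree p \<le> r - 1 \<Longrightarrow> h > 0 \<Longrightarrow> x \<in> {a..a + h} \<Longrightarrow>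
      \<bar>poly ((pderiv ^^ k) p) x\<bar> * h ^ k * sqrt h \<le> C1 k * sqrt (integral {a..a + h} (\<lambda>y. poly p y * poly p y))"
    by metis
  define C2 where "C2 = C1 0 + C1 1 + C1 2"
  have C12: "C1 k \<le> C2" if "k \<le> 2" for k
  proof -
    have "k = 0 \<or> k = 1 \<or> k = 2" using that by auto
    then show ?thesis using C1(1)[of 0] C1(1)[of 1] C1(1)[of 2] by (auto simp: C2_def)
  qed
  \<comment> \<open>The inverse inequality applied to the L2 bound of \<open>p - q\<close>, plus 1
    for the Taylor remainder at the point itself.\<close>
  define C where "C = C2 * (2 * (C0 + 1)) + 1"
  have C2: "0 \<le> C2" using C1(1) by (simp add: C2_def)
  have C: "0 \<le> C" using C2 C0(1) by (simp add: C_def)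
  have "\<bar>(deriv ^^ k) (quasi_interp \<phi> N v) x - (deriv ^^ k) v x\<bar> * (1 / real N) ^ k * sqrt (1 / real N) \<le> C * M * (1 / real N) ^ r"
    if v: "v \<in> CB (max m r) M" and N: "N \<ge> 1" and k: "k \<le> 2" and x: "x \<in> {0..1} - mesh N" for v M N k x
  proof -
    define h where "h = 1 / real N"
    have h: "0 < h" "h \<le> 1" using N by (auto simp: h_def)
    have vm: "v \<in> CB m M" and vr: "v \<in> CB r M" by (rule CB_mono[OF v]; simp)+
    have M: "0 \<le> M" by (rule CB_nonneg[OF v])
    let ?Q = "quasi_interp \<phi> N v"
    have Q: "?Q \<in> splines r N" using \<phi> N by (intro quasi_interp_in_splines) (auto simp: quasi_interp_basis_def)
    obtain i where i: "i \<in> {1..N}" "x \<in> {(real i - 1) / real N <..< real i / real N}"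
      using mesh_cell[OF N x] by blast
    define a where "a = (real i - 1) / real N"
    have ah: "a + h = real i / real N" using N by (simp add: a_def h_def field_simps)
    have x': "x \<in> {a<..<a + h}" using i(2) ah by (simp add: a_def)
    have "0 \<le> a" "a + h \<le> 1" unfolding ah using i(1) N by (auto simp: a_def)
    then have sub: "{a..a + h} \<subseteq> {0..1}" by auto
    obtain p where p: "degree p \<le> r - 1" "\<And>y. y \<in> {a..a + h} \<Longrightarrow> ?Q y = poly p y"
      "\<And>k y. y \<in> {a<..<a + h} \<Longrightarrow> (deriv ^^ k) ?Q y = poly ((pderiv ^^ k) p) y"
      using spline_cell[OF Q i(1)] unfolding ah a_def[symmetric] by metis
    define q where "q = taylor_poly (\<lambda>m. (deriv ^^ m) v a) r a"
    have terr: "\<bar>(deriv ^^ k) v y - poly ((pderiv ^^ k) q) y\<bar> \<le> M * h ^ (r - k)" if "k < r" "y \<in> {a..a + h}" for k y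
      unfolding q_def by (rule taylor_poly_error[OF vr that])
    have dq: "degree (p - q) \<le> r - 1"
      using p(1) degree_taylor_poly[of "\<lambda>m. (deriv ^^ m) v a" r a] by (intro degree_diff_le) (auto simp: q_def)
    let ?th = "\<lambda>y. ?Q y - v y"
    have pwQ: "pw ?Q" and pwv: "pw v"
      using W2D(6)[OF splines_W2[OF r N Q]] C_per_continuous[of v r 0] vr by (auto simp: CB_def intro: pw_continuous)
    have int_le: "integral {a..a + h} (\<lambda>y. poly (p - q) y * poly (p - q) y) \<le> (2 * (C0 + 1) * M * h ^ r)\<^sup>2"
    proof -
      have cQ: "continuous_on UNIV ?Q" by (rule W2D(5)[OF splines_W2[OF r N Q]])
      have cv: "continuous_on UNIV v" using C_per_continuous[of v r 0] vr by (simp add: CB_def)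
      have ci: "(\<lambda>y. ?th y * ?th y) integrable_on S" if "S = {c..d}" for S c d
        unfolding that by (intro integrable_continuous_interval continuous_intros continuous_on_subset[OF cQ] continuous_on_subset[OF cv]) auto
      have "integral {a..a + h} (\<lambda>y. poly (p - q) y * poly (p - q) y)
          \<le> integral {a..a + h} (\<lambda>y. 2 * (?th y * ?th y) + 2 * (M * h ^ r)\<^sup>2)"
      proof (rule integral_le)
        show "(\<lambda>y. poly (p - q) y * poly (p - q) y) integrable_on {a..a + h}"
          by (intro integrable_continuous_interval continuous_intros)
        show "(\<lambda>y. 2 * (?th y * ?th y) + 2 * (M * h ^ r)\<^sup>2) integrable_on {a..a + h}"
          by (intro integrable_continuous_interval continuous_intros continuous_on_subset[OF cQ] continuous_on_subset[OF cv]) auto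
        fix y assume y: "y \<in> {a..a + h}"
        define s t where "s = ?th y" and "t = v y - poly q y"
        have "\<bar>t\<bar> \<le> M * h ^ r" using terr[of 0 y] y r by (simp add: t_def)
        then have "t * t \<le> (M * h ^ r)\<^sup>2"
          using abs_mult_self_eq[of t] mult_mono[of "\<bar>t\<bar>" "M * h ^ r" "\<bar>t\<bar>" "M * h ^ r"] M h
          by (simp add: power2_eq_square)
        moreover have "poly (p - q) y = s + t" using p(2)[OF y] by (simp add: s_def t_def)
        moreover have "(s + t) * (s + t) \<le> 2 * (s * s) + 2 * (t * t)"
          using zero_le_square[of "s - t"] by (simp add: algebra_simps)
        ultimately show "poly (p - q) y * poly (p - q) y \<le> 2 * (?th y * ?th y) + 2 * (M * h ^ r)\<^sup>2"
          unfolding s_def by simp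
      qed
      also have "\<dots> = 2 * integral {a..a + h} (\<lambda>y. ?th y * ?th y) + 2 * (M * h ^ r)\<^sup>2 * h"
        using ci h by (subst integral_add) auto
      also have "\<dots> \<le> 2 * (C0 * M * h ^ r)\<^sup>2 + 2 * (M * h ^ r)\<^sup>2 * 1"
      proof -
        \<comment> \<open>Bounding one cell by the whole interval leaves the factor
          \<open>sqrt h\<close> of the inverse inequality uncompensated.\<close>
        have "integral {a..a + h} (\<lambda>y. ?th y * ?th y) \<le> integral {0..1} (\<lambda>y. ?th y * ?th y)"
          using sub ci by (intro integral_subset_le) auto
        also have "\<dots> = (l2_norm ?th)\<^sup>2" using l2_norm_power2[of ?th] pwQ pwv by (simp add: pw_diff l2_inner_def)
        also have "\<dots> \<le> (C0 * M * h ^ r)\<^sup>2"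
          using C0(2)[OF vm N] pwQ pwv by (intro power_mono l2_norm_nonneg) (auto simp: h_def pw_diff)
        finally have i1: "integral {a..a + h} (\<lambda>y. ?th y * ?th y) \<le> (C0 * M * h ^ r)\<^sup>2" .
        have "2 * (M * h ^ r)\<^sup>2 * h \<le> 2 * (M * h ^ r)\<^sup>2 * 1" using h by (intro mult_left_mono) auto
        with i1 show ?thesis by linarith
      qed
      also have "\<dots> = (2 * C0\<^sup>2 + 2) * (M * h ^ r)\<^sup>2" by (simp add: power2_eq_square algebra_simps)
      also have "\<dots> \<le> (2 * (C0 + 1))\<^sup>2 * (M * h ^ r)\<^sup>2"
        using C0(1) by (intro mult_right_mono zero_le_power2) (auto simp: power2_eq_square algebra_simps)
      also have "\<dots> = (2 * (C0 + 1) * M * h ^ r)\<^sup>2" by (simp add: power_mult_distrib)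
      finally show ?thesis .
    qed
    have nn: "0 \<le> 2 * (C0 + 1) * M * h ^ r" using C0(1) M h by simp
    have "\<bar>poly ((pderiv ^^ k) (p - q)) x\<bar> * h ^ k * sqrt h \<le> C1 k * sqrt (integral {a..a + h} (\<lambda>y. poly (p - q) y * poly (p - q) y))"
      by (rule C1(2)[OF dq h(1)]) (use x' in auto)
    also have "\<dots> \<le> C2 * (2 * (C0 + 1) * M * h ^ r)"
    proof (intro mult_mono)
      show "0 \<le> sqrt (integral {a..a + h} (\<lambda>y. poly (p - q) y * poly (p - q) y))"
        by (intro real_sqrt_ge_zero integral_nonneg integrable_continuous_interval continuous_intros) auto
    qed (use real_sqrt_le_mono[OF int_le] nn C12[OF k] C2 in auto)
    finally have e1: "\<bar>poly ((pderiv ^^ k) (p - q)) x\<bar> * h ^ k * sqrt h \<le> C2 * (2 * (C0 + 1) * M * h ^ r)" .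
    have kr: "k < r" using k r by simp
    have e2: "\<bar>(deriv ^^ k) v x - poly ((pderiv ^^ k) q) x\<bar> * h ^ k * sqrt h \<le> M * h ^ r"
    proof -
      have "\<bar>(deriv ^^ k) v x - poly ((pderiv ^^ k) q) x\<bar> * h ^ k * sqrt h \<le> (M * h ^ (r - k)) * h ^ k * 1"
        using terr[OF kr, of x] x' h M by (intro mult_mono) auto
      also have "\<dots> = M * h ^ r" using kr by (simp add: mult.assoc flip: power_add)
      finally show ?thesis .
    qed
    have sp: "(deriv ^^ k) ?Q x - (deriv ^^ k) v x = poly ((pderiv ^^ k) (p - q)) x - ((deriv ^^ k) v x - poly ((pderiv ^^ k) q) x)"
      using p(3)[OF x', of k] higher_pderiv_add[of k "p - q" q] by simp
    have "\<bar>(deriv ^^ k) ?Q x - (deriv ^^ k) v x\<bar> * h ^ k * sqrt h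
      \<le> (\<bar>poly ((pderiv ^^ k) (p - q)) x\<bar> + \<bar>(deriv ^^ k) v x - poly ((pderiv ^^ k) q) x\<bar>) * h ^ k * sqrt h"
      unfolding sp using h by (intro mult_right_mono abs_triangle_ineq4) auto
    also have "\<dots> \<le> C2 * (2 * (C0 + 1) * M * h ^ r) + M * h ^ r"
      using e1 e2 by (simp add: algebra_simps)
    also have "\<dots> = C * M * h ^ r" by (simp add: C_def algebra_simps)
    finally show ?thesis by (simp add: h_def)
  qed
  then show ?thesis using that[of C "max m r"] C by simp
qed

text \<open>Dividing out the powers of h leaves h^(r-k-1/2), bounded for \<open>k \<le> 2\<close>,
  and h^(2r-3) for the square of the first derivative, which is at most h^r. Both use
  \<open>r \<ge> 3\<close> and h at most 1.\<close>

lemma quasi_interp_derivative_bounds: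
  assumes r: "r \<ge> 3" and \<phi>: "quasi_interp_basis r \<phi>"
  obtains m C where "C \<ge> 0"
    "\<And>v M N k x. v \<in> CB m M \<Longrightarrow> N \<ge> 1 \<Longrightarrow> k \<le> 2 \<Longrightarrow> x \<in> {0..1} - mesh N \<Longrightarrow>
      \<bar>(deriv ^^ k) (quasi_interp \<phi> N v) x - (deriv ^^ k) v x\<bar> \<le> C * M"
    "\<And>v M N x. v \<in> CB m M \<Longrightarrow> N \<ge> 1 \<Longrightarrow> x \<in> {0..1} - mesh N \<Longrightarrow>
      (deriv (quasi_interp \<phi> N v) x - deriv v x)\<^sup>2 \<le> (C * M)\<^sup>2 * (1 / real N) ^ r"
proof -
  obtain m C where C: "C \<ge> 0"
    "\<And>v M N k x. v \<in> CB m M \<Longrightarrow> N \<ge> 1 \<Longrightarrow> k \<le> 2 \<Longrightarrow> x \<in> {0..1} - mesh N \<Longrightarrow>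
      \<bar>(deriv ^^ k) (quasi_interp \<phi> N v) x - (deriv ^^ k) v x\<bar> * (1 / real N) ^ k * sqrt (1 / real N) \<le> C * M * (1 / real N) ^ r"
    using quasi_interp_pointwise_error[OF assms] by metis
  show ?thesis
  proof (rule that[OF C(1)])
    fix v M N k and x :: real
    assume v: "v \<in> CB m M" and N: "N \<ge> 1" and x: "x \<in> {0..1} - mesh N"
    define h where "h = 1 / real N"
    have h: "0 < h" "h \<le> 1" using N by (auto simp: h_def)
    have M: "0 \<le> M" by (rule CB_nonneg[OF v])
    {
      assume k: "k \<le> (2::nat)"
      let ?t = "\<bar>(deriv ^^ k) (quasi_interp \<phi> N v) x - (deriv ^^ k) v x\<bar>"
      have sq: "h \<le> sqrt h" using h real_sqrt_le_mono[of "h\<^sup>2" h] by (simp add: power2_eq_square mult_left_le)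
      have "?t * (h ^ k * sqrt h) \<le> C * M * h ^ r" using C(2)[OF v N k x] by (simp add: h_def mult.assoc)
      also have "\<dots> \<le> C * M * (h ^ k * h)"
        using C(1) M h k r power_decreasing[of "Suc k" r h] by (intro mult_left_mono) (auto simp: mult.commute)
      also have "\<dots> \<le> C * M * (h ^ k * sqrt h)"
        using C(1) M h sq by (intro mult_left_mono) auto
      finally show "?t \<le> C * M" using h by simp
    }
    let ?t = "deriv (quasi_interp \<phi> N v) x - deriv v x"
    have "\<bar>?t\<bar> * h * sqrt h \<le> C * M * h ^ r" using C(2)[OF v N _ x, of 1] by (simp add: h_def)
    then have "(\<bar>?t\<bar> * h * sqrt h)\<^sup>2 \<le> (C * M * h ^ r)\<^sup>2" using h by (intro power_mono) auto
    then have "?t\<^sup>2 * h ^ 3 \<le> (C * M)\<^sup>2 * (h ^ r * h ^ r)"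
      using h by (simp add: power_mult_distrib power2_eq_square[of h] power2_eq_square[of "h ^ r"] power3_eq_cube mult_ac)
    also have "\<dots> \<le> (C * M)\<^sup>2 * (h ^ r * h ^ 3)"
      using h r power_decreasing[of 3 r h] by (intro mult_left_mono) auto
    finally have "?t\<^sup>2 * h ^ 3 \<le> ((C * M)\<^sup>2 * h ^ r) * h ^ 3" by (simp add: mult.assoc)
    then show "?t\<^sup>2 \<le> (C * M)\<^sup>2 * (1 / real N) ^ r" using h by (simp add: h_def)
  qed
qed

section \<open>Consistency\<close>

lemma CB_deriv:
  assumes f: "f \<in> CB (m + k) M"
  shows "(deriv ^^ k) f \<in> CB m M"
proof -
  have fC: "f \<in> C_per (m + k)" using f by (simp add: CB_def)
  have 1: "(deriv ^^ j) ((deriv ^^ k) f) = (deriv ^^ (j + k)) f" for j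
    by (simp add: funpow_add)
  have "(deriv ^^ k) f \<in> C_per m"
  proof (rule C_perI(1)[where D = "\<lambda>j. (deriv ^^ (j + k)) f"])
    show "periodic1 ((deriv ^^ k) f)" by (rule C_per_periodic_deriv[OF fC]) simp
    show "((deriv ^^ (j + k)) f has_real_derivative (deriv ^^ (Suc j + k)) f x) (at x)" if "j < m" for j x
      using C_perD(2)[OF fC, of "j + k" x] that by simp
    show "continuous_on UNIV ((deriv ^^ (m + k)) f)" by (rule C_perD(3)[OF fC])
  qed simp
  moreover have "\<bar>(deriv ^^ j) ((deriv ^^ k) f) x\<bar> \<le> M" if "j \<le> m" for j x
    unfolding 1 using f that by (simp add: CB_def del: funpow.simps)
  ultimately show "(deriv ^^ k) f \<in> CB m M" by (simp add: CB_def)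
qed

lemma CB_const: "\<bar>c\<bar> \<le> M \<Longrightarrow> (\<lambda>_. c) \<in> CB m M"
proof -
  assume c: "\<bar>c\<bar> \<le> M"
  have "(\<lambda>_. c) \<in> C_per m" "\<And>j. j \<le> m \<Longrightarrow> (deriv ^^ j) (\<lambda>_. c) = (\<lambda>_. if j = 0 then c else 0)"
    by (rule C_perI[where D = "\<lambda>j _. if j = 0 then c else 0"]; auto simp: periodic1_def)+
  then show ?thesis using c by (auto simp: CB_def)
qed

lemma CB_diff: "f \<in> CB m M \<Longrightarrow> g \<in> CB m M \<Longrightarrow> (\<lambda>x. f x - g x) \<in> CB m (2 * M)"
proof -
  assume fg: "f \<in> CB m M" "g \<in> CB m M"
  then have C: "f \<in> C_per m" "g \<in> C_per m" by (auto simp: CB_def)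
  note * = C_per_add_cmult[OF C, where c = "-1"]
  have "\<bar>(deriv ^^ j) (\<lambda>x. f x - g x) x\<bar> \<le> 2 * M" if "j \<le> m" for j x
  proof -
    have "\<bar>(deriv ^^ j) f x\<bar> \<le> M" "\<bar>(deriv ^^ j) g x\<bar> \<le> M" using fg that by (auto simp: CB_def)
    then show ?thesis using *(2)[OF that] by simp
  qed
  then show ?thesis using *(1) by (simp add: CB_def)
qed

lemma l2_inner_le_sup:
  assumes "pw f" "pw g" "\<And>x. x \<in> {0..1} \<Longrightarrow> \<bar>f x\<bar> \<le> A" "\<And>x. x \<in> {0..1} \<Longrightarrow> \<bar>g x\<bar> \<le> B"
  shows "\<bar>l2_inner f g\<bar> \<le> A * B"
proof -
  have AB: "0 \<le> A" "0 \<le> B" using assms(3)[of 0] assms(4)[of 0] by auto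
  have "l2_norm f \<le> A" "l2_norm g \<le> B"
    using assms AB by (auto intro!: l2_norm_le_sup[where F = "{}"])
  then have "l2_norm f * l2_norm g \<le> A * B" by (intro mult_mono AB l2_norm_nonneg assms)
  then show ?thesis using l2_inner_cauchy_schwarz[OF assms(1,2)] by linarith
qed

lemma l2_norm_mult_le:
  assumes "pw f" "pw g" "finite F" "\<And>x. x \<in> {0..1} - F \<Longrightarrow> \<bar>g x\<bar> \<le> B" "0 \<le> B"
  shows "l2_norm (\<lambda>x. f x * g x) \<le> B * l2_norm f"
proof -
  have "integral {0..1} (\<lambda>x. (f x * g x) * (f x * g x)) \<le> integral {0..1} (\<lambda>x. B\<^sup>2 * (f x * f x))"
  proof (rule integral_mono_pw[OF _ _ assms(3)])
    show "(f x * g x) * (f x * g x) \<le> B\<^sup>2 * (f x * f x)" if "x \<in> {0..1} - F" for x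
    proof -
      have "g x * g x \<le> B\<^sup>2"
        using abs_mult_self_eq[of "g x"] mult_mono[OF assms(4)[OF that] assms(4)[OF that]] assms(5)
        by (simp add: power2_eq_square)
      then have "(g x * g x) * (f x * f x) \<le> B\<^sup>2 * (f x * f x)" by (rule mult_right_mono) simp
      then show ?thesis by (simp add: mult_ac)
    qed
  qed (intro pw_mult pw_cmult assms)+
  also have "\<dots> = B\<^sup>2 * l2_inner f f" by (simp add: l2_inner_def)
  finally have "sqrt (l2_inner (\<lambda>x. f x * g x) (\<lambda>x. f x * g x)) \<le> sqrt (B\<^sup>2 * l2_inner f f)"
    unfolding l2_inner_def by (rule real_sqrt_le_mono)
  then show ?thesis using assms(5) by (simp add: l2_norm_def real_sqrt_mult)
qed

section \<open>Property (iii) with constants uniform in the functions\<close>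

lemma higher_deriv_spline_lincomb:
  assumes r: "r \<ge> 3" and N: "N \<ge> 1" and k: "k \<le> 2" and x: "x \<in> {0..1} - mesh N"
    and b: "\<And>j. j \<in> J \<Longrightarrow> b j \<in> splines r N" and J: "finite J"
  shows "(deriv ^^ k) (\<lambda>x. \<Sum>j\<in>J. c j * b j x) x = (\<Sum>j\<in>J. c j * (deriv ^^ k) (b j) x)"
proof -
  interpret function_space "splines r N" by (rule splines_function_space)
  show ?thesis
  proof (rule linear_lincomb[OF _ J b])
    fix f g c assume fg: "f \<in> splines r N" "g \<in> splines r N"
    have "k = 0 \<or> k = 1 \<or> k = 2" using k by auto
    then show "(deriv ^^ k) (\<lambda>x. f x + c * g x) x = (deriv ^^ k) f x + c * (deriv ^^ k) g x"
      using deriv_add_cmult_W2[OF splines_W2[OF r N fg(1)] splines_W2[OF r N fg(2)], where c = c] x by auto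
  qed auto
qed

text \<open>The Leibniz rule written out for \<open>\<kappa> \<le> 1\<close>: in this form
  bilinearity is visible, and the nodal values can be bounded and matched with the equation.\<close>

definition product_deriv :: "nat \<Rightarrow> nat \<Rightarrow> (real \<Rightarrow> real) \<Rightarrow> (real \<Rightarrow> real) \<Rightarrow> real \<Rightarrow> real" where
  "product_deriv \<kappa> \<nu> f g x =
    (if \<kappa> = 0 then f x * (deriv ^^ \<nu>) g x else deriv f x * (deriv ^^ \<nu>) g x + f x * (deriv ^^ Suc \<nu>) g x)"

lemma product_deriv_eq:
  assumes "\<kappa> \<le> 1" "\<nu> \<le> 2" "f \<in> C_per 5" "g \<in> C_per 5"
  shows "(deriv ^^ \<kappa>) (\<lambda>x. f x * (deriv ^^ \<nu>) g x) x = product_deriv \<kappa> \<nu> f g x"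
proof -
  have 1: "(f has_real_derivative deriv f x) (at x)" for x using C_perD(2)[OF assms(3), of 0] by simp
  have 2: "((deriv ^^ \<nu>) g has_real_derivative (deriv ^^ Suc \<nu>) g x) (at x)" for x
    by (rule C_perD(2)[OF assms(4)]) (use assms in simp)
  have "deriv (\<lambda>x. f x * (deriv ^^ \<nu>) g x) x = deriv f x * (deriv ^^ \<nu>) g x + f x * (deriv ^^ Suc \<nu>) g x"
    using DERIV_mult[OF 1 2, of x] by (intro DERIV_imp_deriv) (simp add: mult.commute add.commute)
  moreover have "\<kappa> = 0 \<or> \<kappa> = 1" using assms by auto
  ultimately show ?thesis by (auto simp: product_deriv_def)
qed

text \<open>The error in property (iii), with the quasiinterpolant of the product expanded in the
  basis: from this term only nodal values remain, weighted by entries of the Gram matrix.\<close>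

definition product_error ::
  "(nat \<Rightarrow> nat \<Rightarrow> real \<Rightarrow> real) \<Rightarrow> nat \<Rightarrow> nat \<Rightarrow> nat \<Rightarrow> nat \<Rightarrow> (real \<Rightarrow> real) \<Rightarrow> (real \<Rightarrow> real) \<Rightarrow> real" where
  "product_error \<phi> N i \<kappa> \<nu> f g = l2_inner (\<lambda>x. f x * (deriv ^^ \<nu>) (quasi_interp \<phi> N g) x) ((deriv ^^ \<kappa>) (\<phi> N i))
      - (-1) ^ \<kappa> * (\<Sum>j=1..N. product_deriv \<kappa> \<nu> f g (real j / real N) * l2_inner (\<phi> N j) (\<phi> N i))"

text \<open>For a fixed mesh and \<open>i\<close> the error is a bounded bilinear functional of
  \<open>f\<close> and \<open>g\<close>, with a bound that may depend on the mesh. Property (iii)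
  bounds the scaled errors for each pair of functions, and uniform boundedness does the rest. The
  power kept, \<open>r + 1\<close>, leaves O(h^r) after the loss of one power in property
  (i).\<close>

lemma product_superconvergence_uniform:
  assumes r: "r \<ge> 3" and \<phi>: "quasi_interp_basis r \<phi>"
  obtains m where "m \<ge> 5"
    "\<And>M \<nu> \<kappa>. \<nu> \<le> 2 \<Longrightarrow> \<kappa> \<le> 1 \<Longrightarrow> \<exists>C. \<forall>f\<in>CB m M. \<forall>g\<in>CB m M. \<forall>N\<ge>1. \<forall>i\<in>{1..N}.
      \<bar>product_error \<phi> N i \<kappa> \<nu> f g\<bar> \<le> C * (1 / real N) ^ (r + 1)"
proof -
  obtain m0 where m0: "\<And>\<nu> \<kappa> f g. \<nu> \<le> r - 1 \<Longrightarrow> \<kappa> \<le> r - 1 \<Longrightarrow> f \<in> C_per m0 \<Longrightarrow> g \<in> C_per m0 \<Longrightarrow>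
     \<exists>C. \<forall>N\<ge>1. \<forall>i\<in>{1..N}.
       \<bar>l2_inner (\<lambda>x. f x * (deriv ^^ \<nu>) (quasi_interp \<phi> N g) x) ((deriv ^^ \<kappa>) (\<phi> N i))
          - (-1) ^ \<kappa> * l2_inner (quasi_interp \<phi> N ((deriv ^^ \<kappa>) (\<lambda>x. f x * (deriv ^^ \<nu>) g x))) (\<phi> N i)\<bar>
       \<le> C * (1 / real N) ^ (2 * r + parity_gain (\<nu> + \<kappa>) - (\<nu> + \<kappa>))"
    using \<phi> unfolding quasi_interp_basis_def product_superconvergence_property_def by blast
  define m where "m = max m0 5"
  have m: "m0 \<le> m" "5 \<le> m" by (auto simp: m_def)
  have b: "\<phi> N j \<in> splines r N" if "N \<ge> 1" "j \<in> {1..N}" for N j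
    using \<phi> that by (simp add: quasi_interp_basis_def is_spline_basis_def)
  have C5: "f \<in> C_per 5" if "f \<in> C_per m" for f using C_per_mono[OF that m(2)] .
  have pwf: "pw f" if "f \<in> C_per m" for f
    using C_per_continuous[OF that, of 0] by (simp add: pw_continuous)
  have "\<exists>C. \<forall>f\<in>CB m M. \<forall>g\<in>CB m M. \<forall>N\<ge>1. \<forall>i\<in>{1..N}.
      \<bar>product_error \<phi> N i \<kappa> \<nu> f g\<bar> \<le> C * (1 / real N) ^ (r + 1)" if \<nu>: "\<nu> \<le> 2" and \<kappa>: "\<kappa> \<le> 1" for M \<nu> \<kappa>
  proof -
    define I where "I = {(N, i). N \<ge> (1::nat) \<and> i \<in> {1..N}}"
    define L where "L N i j f = l2_inner (\<lambda>x. f x * (deriv ^^ \<nu>) (\<phi> N j) x) ((deriv ^^ \<kappa>) (\<phi> N i))" for N i j f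
    define G where "G N i j = l2_inner (\<phi> N j) (\<phi> N i)" for N i j
    define S1 where "S1 N i f g = (\<Sum>j=1..N. g (real j / real N) * L N i j f)" for N i f g
    define S2 where "S2 N i f g = (\<Sum>j=1..N. product_deriv \<kappa> \<nu> f g (real j / real N) * G N i j)" for N i f g
    \<comment> \<open>The error divided by h^(r+1), so that the claim is boundedness over the index
      set \<open>I\<close>.\<close>
    define E where "E p f g = (case p of (N, i) \<Rightarrow> (S1 N i f g - (-1) ^ \<kappa> * S2 N i f g) * real N ^ (r + 1))" for p f g
    have pwb: "pw ((deriv ^^ k) (\<phi> N j))" if "N \<ge> 1" "j \<in> {1..N}" for N j k
      by (rule spline_pw_deriv[OF b[OF that] that(1)])
    have Lsum: "l2_inner (\<lambda>x. f x * (deriv ^^ \<nu>) (quasi_interp \<phi> N g) x) ((deriv ^^ \<kappa>) (\<phi> N i))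
        = S1 N i f g"
      if f: "f \<in> C_per m" and N: "N \<ge> 1" and i: "i \<in> {1..N}" for f g N i
    proof -
      have "l2_inner (\<lambda>x. f x * (deriv ^^ \<nu>) (quasi_interp \<phi> N g) x) ((deriv ^^ \<kappa>) (\<phi> N i))
        = l2_inner (\<lambda>x. \<Sum>j=1..N. g (real j / real N) * (f x * (deriv ^^ \<nu>) (\<phi> N j) x)) ((deriv ^^ \<kappa>) (\<phi> N i))"
      proof (rule l2_inner_cong_finite[OF finite_mesh[of N]])
        fix x assume x: "x \<in> {0..1} - mesh N"
        have "(deriv ^^ \<nu>) (quasi_interp \<phi> N g) x = (\<Sum>j=1..N. g (real j / real N) * (deriv ^^ \<nu>) (\<phi> N j) x)"
          unfolding quasi_interp_def
          by (rule higher_deriv_spline_lincomb[OF r N \<nu> x]) (use b N in auto)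
        then show "f x * (deriv ^^ \<nu>) (quasi_interp \<phi> N g) x * (deriv ^^ \<kappa>) (\<phi> N i) x
          = (\<Sum>j=1..N. g (real j / real N) * (f x * (deriv ^^ \<nu>) (\<phi> N j) x)) * (deriv ^^ \<kappa>) (\<phi> N i) x"
          by (simp add: sum_distrib_left mult_ac)
      qed
      also have "\<dots> = S1 N i f g"
        unfolding S1_def L_def l2_inner_cmult_left[symmetric]
        by (intro l2_inner_sum_left pw_cmult pw_mult pwf[OF f] pwb[OF N] i)
      finally show ?thesis .
    qed
    have Esum: "product_error \<phi> N i \<kappa> \<nu> f g = E (N, i) f g * (1 / real N) ^ (r + 1)"
      if f: "f \<in> C_per m" and N: "N \<ge> 1" and i: "i \<in> {1..N}" for f g N i
      using N by (simp add: product_error_def Lsum[OF that] E_def S2_def G_def power_divide del: power_Suc)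
    have Llin: "L N i j (\<lambda>x. f x + c * g x) = L N i j f + c * L N i j g"
      if "f \<in> C_per m" "g \<in> C_per m" "N \<ge> 1" "i \<in> {1..N}" "j \<in> {1..N}" for N i j f g c
      using l2_inner_add_cmult_left[of "\<lambda>x. f x * (deriv ^^ \<nu>) (\<phi> N j) x" "\<lambda>x. g x * (deriv ^^ \<nu>) (\<phi> N j) x"
          "(deriv ^^ \<kappa>) (\<phi> N i)" c] pwf[OF that(1)] pwf[OF that(2)] pwb[OF that(3,4)] pwb[OF that(3,5)]
      by (simp add: L_def pw_mult algebra_simps)
    have "\<exists>C. \<forall>p\<in>I. \<forall>f\<in>CB m M. \<forall>g\<in>CB m M. \<bar>E p f g\<bar> \<le> C"
    proof (rule uniform_boundedness_C_per_bilinear)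
      fix p f g h c assume p: "p \<in> I" and f: "f \<in> C_per m" "g \<in> C_per m" "h \<in> C_per m"
      obtain N i where Ni: "p = (N, i)" "N \<ge> 1" "i \<in> {1..N}" using p by (auto simp: I_def)
      note d1 = C_per_add_cmult(2)[OF f(1,2), of 1 c]
      have P1: "product_deriv \<kappa> \<nu> (\<lambda>x. f x + c * g x) h y = product_deriv \<kappa> \<nu> f h y + c * product_deriv \<kappa> \<nu> g h y" for y
        using d1 m by (simp add: product_deriv_def algebra_simps)
      have P2: "product_deriv \<kappa> \<nu> h (\<lambda>x. f x + c * g x) y = product_deriv \<kappa> \<nu> h f y + c * product_deriv \<kappa> \<nu> h g y" for y
        using C_per_add_cmult(2)[OF f(1,2), of \<nu> c] C_per_add_cmult(2)[OF f(1,2), of "Suc \<nu>" c] m \<nu>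
        by (simp add: product_deriv_def algebra_simps del: funpow.simps)
      have "S1 N i (\<lambda>x. f x + c * g x) h = S1 N i f h + c * S1 N i g h"
        "S2 N i (\<lambda>x. f x + c * g x) h = S2 N i f h + c * S2 N i g h"
        "S1 N i h (\<lambda>x. f x + c * g x) = S1 N i h f + c * S1 N i h g"
        "S2 N i h (\<lambda>x. f x + c * g x) = S2 N i h f + c * S2 N i h g"
        using Ni unfolding S1_def S2_def sum_distrib_left sum.distrib[symmetric] P1 P2
        by (auto intro!: sum.cong simp: Llin[OF f(1,2)] algebra_simps)
      then show "E p (\<lambda>x. f x + c * g x) h = E p f h + c * E p g h"
        "E p h (\<lambda>x. f x + c * g x) = E p h f + c * E p h g"
        unfolding Ni(1) E_def prod.case by (simp_all only:) (simp_all only: algebra_simps)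
    next
      fix p M' assume p: "p \<in> I"
      obtain N i where Ni: "p = (N, i)" "N \<ge> 1" "i \<in> {1..N}" using p by (auto simp: I_def)
      have "\<exists>B. \<forall>x\<in>{0..1}. \<bar>(deriv ^^ \<nu>) (\<phi> N j) x\<bar> \<le> B" if "j \<in> {1..N}" for j
        using pwb[OF Ni(2) that, of \<nu>] by (auto simp: pw_def)
      then obtain B where B: "\<And>j x. j \<in> {1..N} \<Longrightarrow> x \<in> {0..1} \<Longrightarrow> \<bar>(deriv ^^ \<nu>) (\<phi> N j) x\<bar> \<le> B j" by metis
      obtain B' where B': "\<And>x. x \<in> {0..1} \<Longrightarrow> \<bar>(deriv ^^ \<kappa>) (\<phi> N i) x\<bar> \<le> B'"
        using pwb[OF Ni(2,3), of \<kappa>] unfolding pw_def by blast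
      \<comment> \<open>Any bound for this one pair \<open>(N, i)\<close> is good enough, so all
        factors are estimated by their suprema.\<close>
      define K where "K = ((\<Sum>j=1..N. M' * (M' * B j * B')) + (\<Sum>j=1..N. (2 * (M' * M')) * \<bar>G N i j\<bar>)) * real N ^ (r + 1)"
      have "\<bar>E p f g\<bar> \<le> K" if f: "f \<in> CB m M'" and g: "g \<in> CB m M'" for f g
      proof -
        have fb: "\<bar>(deriv ^^ j) f x\<bar> \<le> M'" and gb: "\<bar>(deriv ^^ j) g x\<bar> \<le> M'" if "j \<le> m" for j x
          using f g that by (auto simp: CB_def)
        have M': "0 \<le> M'" by (rule CB_nonneg[OF f])
        have fC: "f \<in> C_per m" using f by (simp add: CB_def)
        have f0: "\<bar>f x\<bar> \<le> M'" for x using fb[of 0] by simp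
        have mm: "\<bar>a * b\<bar> \<le> M' * M'" if "\<bar>a\<bar> \<le> M'" "\<bar>b\<bar> \<le> M'" for a b
          unfolding abs_mult using that M' by (intro mult_mono) auto
        have LB: "\<bar>L N i j f\<bar> \<le> M' * B j * B'" if j: "j \<in> {1..N}" for j
          unfolding L_def
        proof (rule l2_inner_le_sup)
          show "\<bar>f x * (deriv ^^ \<nu>) (\<phi> N j) x\<bar> \<le> M' * B j" if "x \<in> {0..1}" for x
            unfolding abs_mult using B[OF j that] f0 M' by (intro mult_mono) auto
        qed (use B' pwf[OF fC] pwb[OF Ni(2,3)] pwb[OF Ni(2) j] in \<open>auto intro: pw_mult\<close>)
        have s1: "\<bar>S1 N i f g\<bar> \<le> (\<Sum>j=1..N. M' * (M' * B j * B'))"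
          unfolding S1_def
        proof (rule order_trans[OF sum_abs], rule sum_mono)
          fix j assume j: "j \<in> {1..N}"
          show "\<bar>g (real j / real N) * L N i j f\<bar> \<le> M' * (M' * B j * B')"
            unfolding abs_mult using gb[of 0] LB[OF j] M' by (intro mult_mono) auto
        qed
        have PB: "\<bar>product_deriv \<kappa> \<nu> f g y\<bar> \<le> 2 * (M' * M')" for y
        proof -
          have f1: "\<bar>deriv f y\<bar> \<le> M'" using fb[of 1 y] m by simp
          have g1: "\<bar>(deriv ^^ \<nu>) g y\<bar> \<le> M'" and g2: "\<bar>(deriv ^^ Suc \<nu>) g y\<bar> \<le> M'"
            by (rule gb; use m \<nu> in simp)+
          note mm[OF f0[of y] g1] mm[OF f1 g1] mm[OF f0[of y] g2]
          moreover have "\<bar>a + b\<bar> \<le> 2 * K" if "\<bar>a\<bar> \<le> K" "\<bar>b\<bar> \<le> K" for a b K :: real using that by linarith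
          moreover have "\<bar>a\<bar> \<le> 2 * K" if "\<bar>a\<bar> \<le> K" for a K :: real using that by linarith
          ultimately show ?thesis unfolding product_deriv_def by (simp only: split: if_split) blast
        qed
        have s2: "\<bar>S2 N i f g\<bar> \<le> (\<Sum>j=1..N. (2 * (M' * M')) * \<bar>G N i j\<bar>)"
          unfolding S2_def
        proof (rule order_trans[OF sum_abs], rule sum_mono)
          fix j
          show "\<bar>product_deriv \<kappa> \<nu> f g (real j / real N) * G N i j\<bar> \<le> (2 * (M' * M')) * \<bar>G N i j\<bar>"
            unfolding abs_mult using PB by (intro mult_right_mono) auto
        qed
        have "\<bar>S1 N i f g - (-1) ^ \<kappa> * S2 N i f g\<bar>
          \<le> (\<Sum>j=1..N. M' * (M' * B j * B')) + (\<Sum>j=1..N. (2 * (M' * M')) * \<bar>G N i j\<bar>)"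
          using s1 s2 by (intro order_trans[OF abs_triangle_ineq4] add_mono) (simp_all add: abs_mult power_abs)
        then show ?thesis unfolding Ni(1) E_def K_def by (simp add: abs_mult mult_right_mono del: power_Suc)
      qed
      then show "\<exists>K. \<forall>f\<in>CB m M'. \<forall>g\<in>CB m M'. \<bar>E p f g\<bar> \<le> K" by blast
    next
      fix f g assume f: "f \<in> C_per m" and g: "g \<in> C_per m"
      have le: "\<nu> \<le> r - 1" "\<kappa> \<le> r - 1" using \<nu> \<kappa> r by simp_all
      obtain C where C: "\<And>N i. N \<ge> 1 \<Longrightarrow> i \<in> {1..N} \<Longrightarrow>
       \<bar>l2_inner (\<lambda>x. f x * (deriv ^^ \<nu>) (quasi_interp \<phi> N g) x) ((deriv ^^ \<kappa>) (\<phi> N i))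
          - (-1) ^ \<kappa> * l2_inner (quasi_interp \<phi> N ((deriv ^^ \<kappa>) (\<lambda>x. f x * (deriv ^^ \<nu>) g x))) (\<phi> N i)\<bar>
       \<le> C * (1 / real N) ^ (2 * r + parity_gain (\<nu> + \<kappa>) - (\<nu> + \<kappa>))"
        using m0[OF le C_per_mono[OF f m(1)] C_per_mono[OF g m(1)]] by blast
      have "\<bar>E (N, i) f g\<bar> \<le> \<bar>C\<bar>" if N: "N \<ge> 1" and i: "i \<in> {1..N}" for N i
      proof -
        have "l2_inner (quasi_interp \<phi> N ((deriv ^^ \<kappa>) (\<lambda>x. f x * (deriv ^^ \<nu>) g x))) (\<phi> N i)
          = (\<Sum>j=1..N. product_deriv \<kappa> \<nu> f g (real j / real N) * l2_inner (\<phi> N j) (\<phi> N i))"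
          unfolding quasi_interp_def product_deriv_eq[OF \<kappa> \<nu> C5[OF f] C5[OF g]]
          using pwb[OF N, of _ 0] i by (subst l2_inner_sum_left) (auto simp: pw_cmult l2_inner_cmult_left)
        then have "\<bar>E (N, i) f g * (1 / real N) ^ (r + 1)\<bar> \<le> C * (1 / real N) ^ (2 * r + parity_gain (\<nu> + \<kappa>) - (\<nu> + \<kappa>))"
          using C[OF N i] by (simp only: Esum[OF f N i, symmetric] product_error_def)
        also have "\<dots> \<le> \<bar>C\<bar> * (1 / real N) ^ (2 * r + parity_gain (\<nu> + \<kappa>) - (\<nu> + \<kappa>))"
          by (intro mult_right_mono) auto
        \<comment> \<open>The exponent is \<open>2 * r + 1\<close> for
          \<open>\<nu> + \<kappa> \<le> 1\<close> and \<open>2 * r - 1\<close> for the values 2 and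
          3, so it is at least \<open>r + 1\<close>.\<close>
        also have "\<dots> \<le> \<bar>C\<bar> * (1 / real N) ^ (r + 1)"
        proof (intro mult_left_mono power_decreasing)
          have "\<nu> + \<kappa> \<le> 3" using \<nu> \<kappa> by simp
          then have "\<nu> + \<kappa> = 0 \<or> \<nu> + \<kappa> = 1 \<or> \<nu> + \<kappa> = 2 \<or> \<nu> + \<kappa> = 3" by auto
          then show "r + 1 \<le> 2 * r + parity_gain (\<nu> + \<kappa>) - (\<nu> + \<kappa>)" using r by (auto simp: parity_gain_def)
        qed (use N in auto)
        finally have le: "\<bar>E (N, i) f g * (1 / real N) ^ (r + 1)\<bar> \<le> \<bar>C\<bar> * (1 / real N) ^ (r + 1)" .
        have pos: "0 < (1 / real N) ^ (r + 1)" using N by simp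
        from le have "\<bar>E (N, i) f g\<bar> * (1 / real N) ^ (r + 1) \<le> \<bar>C\<bar> * (1 / real N) ^ (r + 1)"
          unfolding abs_mult abs_of_pos[OF pos] .
        then show ?thesis by (rule mult_right_le_imp_le[OF _ pos])
      qed
      then show "\<exists>K. \<forall>p\<in>I. \<bar>E p f g\<bar> \<le> K"
        unfolding I_def by (intro exI[of _ "\<bar>C\<bar>"] ballI) (metis (mono_tags, lifting) case_prodE mem_Collect_eq)
    qed
    then obtain C where C: "\<And>N i f g. N \<ge> 1 \<Longrightarrow> i \<in> {1..N} \<Longrightarrow> f \<in> CB m M \<Longrightarrow> g \<in> CB m M \<Longrightarrow> \<bar>E (N, i) f g\<bar> \<le> C"
      unfolding I_def by blast
    show ?thesis
    proof (intro exI ballI allI impI)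
      fix f g and N i :: nat assume *: "f \<in> CB m M" "g \<in> CB m M" "1 \<le> N" "i \<in> {1..N}"
      then have f: "f \<in> C_per m" by (simp add: CB_def)
      show "\<bar>product_error \<phi> N i \<kappa> \<nu> f g\<bar> \<le> C * (1 / real N) ^ (r + 1)"
        unfolding Esum[OF f *(3,4)] abs_mult using C[OF *(3,4,1,2)] by (simp add: mult_right_mono del: power_Suc)
    qed
  qed
  then show ?thesis using that m(2) by blast
qed

section \<open>The part of the consistency error that is linear in the quasiinterpolants\<close>

lemma spline_basisD:
  assumes "is_spline_basis r N b"
  shows "j \<in> {1..N} \<Longrightarrow> b j \<in> splines r N"
    "f \<in> splines r N \<Longrightarrow> \<exists>c. f = (\<lambda>x. \<Sum>j\<in>{1..N}. c j * b j x)"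
proof -
  show "j \<in> {1..N} \<Longrightarrow> b j \<in> splines r N" using assms by (simp add: is_spline_basis_def)
  assume f: "f \<in> splines r N"
  obtain c where "\<forall>x. f x = (\<Sum>j=1..N. c j * b j x)"
    using assms f unfolding is_spline_basis_def by blast
  then show "\<exists>c. f = (\<lambda>x. \<Sum>j\<in>{1..N}. c j * b j x)" by (intro exI[of _ c] ext) simp
qed

text \<open>The stability property bounds a spline by its inner products with the basis functions.
  To use it for a functional that is estimated only on basis functions, the functional is
  represented by a spline.\<close>

lemma spline_riesz_l2:
  assumes r: "r \<ge> 3" and N: "N \<ge> 1" and basis: "is_spline_basis r N b"
    and L: "\<And>f g c. f \<in> splines r N \<Longrightarrow> g \<in> splines r N \<Longrightarrow> L (\<lambda>x. f x + c * g x) = L f + c * L g"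
  obtains \<psi> where "\<psi> \<in> splines r N" "\<And>f. f \<in> splines r N \<Longrightarrow> L f = l2_inner \<psi> f"
proof -
  interpret function_inner_space "splines r N" l2_inner by (rule splines_l2_inner_space[OF r N])
  obtain n :: nat and e where e: "\<And>i. i < n \<Longrightarrow> e i \<in> splines r N"
    and rep: "\<And>f. f \<in> splines r N \<Longrightarrow> f = (\<lambda>x. \<Sum>i<n. l2_inner f (e i) * e i x)"
    by (rule orthonormal_basis[OF finite_atLeastAtMost spline_basisD[OF basis]]) blast+
  define \<psi> where "\<psi> x = (\<Sum>i<n. L (e i) * e i x)" for x
  have \<psi>V: "\<psi> \<in> splines r N" unfolding \<psi>_def[abs_def] by (rule lincomb) (use e in auto)
  have "L f = l2_inner \<psi> f" if f: "f \<in> splines r N" for f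
  proof -
    have "L f = L (\<lambda>x. \<Sum>i<n. l2_inner f (e i) * e i x)" using rep[OF f] by simp
    also have "\<dots> = (\<Sum>i<n. l2_inner f (e i) * L (e i))"
      by (rule linear_lincomb) (use L e in auto)
    also have "\<dots> = (\<Sum>i<n. L (e i) * l2_inner (e i) f)" by (simp add: l2_inner_commute[of f] mult.commute)
    also have "\<dots> = l2_inner \<psi> f"
      unfolding \<psi>_def[abs_def] by (rule ip_lincomb[symmetric]) (use e f in auto)
    finally show ?thesis .
  qed
  then show ?thesis using that \<psi>V by blast
qed

text \<open>The equation at one instant, with \<open>vt\<close> in the role of the time derivative,
  so that consistency becomes a statement about pairs of functions of \<open>x\<close>.\<close>

definition ch_equation :: "(real \<Rightarrow> real) \<Rightarrow> (real \<Rightarrow> real) \<Rightarrow> bool" where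
  "ch_equation v vt \<longleftrightarrow> (\<forall>x\<in>{0..1}. vt x - (deriv ^^ 2) vt x + 3 * v x * deriv v x
     = 2 * deriv v x * (deriv ^^ 2) v x + v x * (deriv ^^ 3) v x)"

text \<open>Each product of derivatives of the quasiinterpolant of \<open>v\<close> is replaced by
  its linearization at \<open>v\<close>, where one of the two factors is exact. The interpolant of
  \<open>vt x - (deriv ^^ 2) vt x\<close> stands for the terms in \<open>v\<close> alone, which the
  equation turns into this expression.\<close>

definition ch_linearized ::
  "(nat \<Rightarrow> nat \<Rightarrow> real \<Rightarrow> real) \<Rightarrow> nat \<Rightarrow> (real \<Rightarrow> real) \<Rightarrow> (real \<Rightarrow> real) \<Rightarrow> (real \<Rightarrow> real) \<Rightarrow> real" where
  "ch_linearized \<phi> N v vt f =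
    l2_inner (\<lambda>x. quasi_interp \<phi> N vt x
      + 3 * (v x * deriv (quasi_interp \<phi> N v) x + deriv v x * quasi_interp \<phi> N v x)
      + quasi_interp \<phi> N (\<lambda>x. vt x - (deriv ^^ 2) vt x) x) f
    + l2_inner (\<lambda>x. deriv (quasi_interp \<phi> N vt) x + deriv v x * deriv (quasi_interp \<phi> N v) x
      + v x * (deriv ^^ 2) (quasi_interp \<phi> N v) x + (deriv ^^ 2) v x * quasi_interp \<phi> N v x) (deriv f)"

lemma l2_inner_quasi_interp:
  assumes "\<And>j. j \<in> {1..N} \<Longrightarrow> pw (\<phi> N j)" "pw f"
  shows "l2_inner (quasi_interp \<phi> N v) f = (\<Sum>j=1..N. v (real j / real N) * l2_inner (\<phi> N j) f)"
  unfolding quasi_interp_def l2_inner_cmult_left[symmetric]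
  by (intro l2_inner_sum_left pw_cmult assms)

lemma CB_W2: "v \<in> CB m M \<Longrightarrow> 2 \<le> m \<Longrightarrow> v \<in> W2 N"
  by (rule C_per_W2, rule C_per_mono) (auto simp: CB_def)

text \<open>Tested with a basis function, each term agrees up to O(h^(r+1)) with a sum of nodal
  values weighted by (\<phi>_j, \<phi>_i), and at each node these values cancel by the equation.
  Riesz representation and the stability property turn this into O(h^r) for all test
  splines.\<close>

lemma ch_linearized_bound:
  assumes r: "r \<ge> 3" and \<phi>: "quasi_interp_basis r \<phi>"
  obtains m where "m \<ge> 5"
    "\<And>M. \<exists>C\<ge>0. \<forall>v\<in>CB m M. \<forall>vt\<in>CB m M. \<forall>N f. ch_equation v vt \<longrightarrow> N \<ge> 1 \<longrightarrow> f \<in> splines r N \<longrightarrow>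
      \<bar>ch_linearized \<phi> N v vt f\<bar> \<le> C * (1 / real N) ^ r * l2_norm f"
proof -
  obtain m1 where m1: "m1 \<ge> 5"
    "\<And>M \<nu> \<kappa>. \<nu> \<le> 2 \<Longrightarrow> \<kappa> \<le> 1 \<Longrightarrow> \<exists>C. \<forall>f\<in>CB m1 M. \<forall>g\<in>CB m1 M. \<forall>N\<ge>1. \<forall>i\<in>{1..N}.
      \<bar>product_error \<phi> N i \<kappa> \<nu> f g\<bar> \<le> C * (1 / real N) ^ (r + 1)"
    by (rule product_superconvergence_uniform[OF r \<phi>]) blast
  have "stability_property r \<phi>" using \<phi> by (simp add: quasi_interp_basis_def)
  then obtain Cs where Cs: "\<And>N \<psi>. N \<ge> 1 \<Longrightarrow> \<psi> \<in> splines r N \<Longrightarrow>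
     l2_norm \<psi> \<le> Cs * inverse (1 / real N) * (MAX i\<in>{1..N}. \<bar>l2_inner \<psi> (\<phi> N i)\<bar>)"
    unfolding stability_property_def by blast
  have basis: "is_spline_basis r N (\<phi> N)" if "N \<ge> 1" for N using \<phi> that by (simp add: quasi_interp_basis_def)
  have bV: "\<phi> N j \<in> splines r N" if "N \<ge> 1" "j \<in> {1..N}" for N j
    using spline_basisD(1)[OF basis[OF that(1)] that(2)] .
  \<comment> \<open>Two more derivatives, as \<open>(deriv ^^ 2) v\<close> is used as the factor
    \<open>f\<close> in the product estimate.\<close>
  have "\<exists>C\<ge>0. \<forall>v\<in>CB (m1 + 2) M. \<forall>vt\<in>CB (m1 + 2) M. \<forall>N f. ch_equation v vt \<longrightarrow> N \<ge> 1 \<longrightarrow> f \<in> splines r N \<longrightarrow>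
      \<bar>ch_linearized \<phi> N v vt f\<bar> \<le> C * (1 / real N) ^ r * l2_norm f" for M
  proof -
    \<comment> \<open>Large enough for the constant function 1, which is the factor \<open>f\<close>
      in the term with the derivative of the interpolant of \<open>vt\<close>.\<close>
    define B where "B = \<bar>M\<bar> + 1"
    define P where "P \<nu> \<kappa> k \<longleftrightarrow> (\<forall>f\<in>CB m1 B. \<forall>g\<in>CB m1 B. \<forall>N\<ge>1. \<forall>i\<in>{1..N}.
      \<bar>product_error \<phi> N i \<kappa> \<nu> f g\<bar> \<le> k * (1 / real N) ^ (r + 1))" for \<nu> \<kappa> k
    define K where "K \<nu> \<kappa> = (SOME k. P \<nu> \<kappa> k)" for \<nu> \<kappa>
    have PK: "P \<nu> \<kappa> (K \<nu> \<kappa>)" if "\<nu> \<le> 2" "\<kappa> \<le> 1" for \<nu> \<kappa>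
      unfolding K_def by (rule someI_ex) (unfold P_def, rule m1(2)[OF that])
    have K: "\<bar>product_error \<phi> N i \<kappa> \<nu> f g\<bar> \<le> K \<nu> \<kappa> * (1 / real N) ^ (r + 1)"
      if "\<nu> \<le> 2" "\<kappa> \<le> 1" "f \<in> CB m1 B" "g \<in> CB m1 B" "N \<ge> 1" "i \<in> {1..N}" for \<nu> \<kappa> f g N i
      using PK[OF that(1,2)] that unfolding P_def by blast
    \<comment> \<open>One constant per product term: \<open>K 1 1\<close> occurs for the term of
      \<open>vt\<close> and for the one with the factor \<open>deriv v\<close>, and the weights 3
      are those of the convective terms.\<close>
    define K' where "K' = \<bar>K 1 1\<bar> + 3 * \<bar>K 1 0\<bar> + 3 * \<bar>K 0 0\<bar> + \<bar>K 1 1\<bar> + \<bar>K 2 1\<bar> + \<bar>K 0 1\<bar>"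
    have "\<bar>ch_linearized \<phi> N v vt f\<bar> \<le> \<bar>Cs\<bar> * K' * (1 / real N) ^ r * l2_norm f"
      if v: "v \<in> CB (m1 + 2) M" and vt: "vt \<in> CB (m1 + 2) M" and ch: "ch_equation v vt"
        and N: "N \<ge> 1" and f: "f \<in> splines r N" for v vt N f
    proof -
      define w where "w x = vt x - (deriv ^^ 2) vt x" for x
      have w_eq: "(\<lambda>x. vt x - (deriv ^^ 2) vt x) = w" by (simp add: w_def fun_eq_iff)
      have pde: "w x + 3 * v x * deriv v x = 2 * deriv v x * (deriv ^^ 2) v x + v x * (deriv ^^ 3) v x"
        if "x \<in> {0..1}" for x
        using ch that by (simp add: ch_equation_def w_def)
      define h where "h = 1 / real N"
      have h: "0 < h" using N by (simp add: h_def)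
      let ?Q = "quasi_interp \<phi> N"
      let ?L = "ch_linearized \<phi> N v vt"
      have MB: "M \<le> B" by (simp add: B_def)
      have "(deriv ^^ 1) v \<in> CB m1 M" by (rule CB_deriv, rule CB_mono[OF v]) auto
      moreover have "(deriv ^^ 2) v \<in> CB m1 M" by (rule CB_deriv[OF v])
      ultimately have cb: "(\<lambda>_. 1) \<in> CB m1 B" "v \<in> CB m1 B" "vt \<in> CB m1 B" "deriv v \<in> CB m1 B" "(deriv ^^ 2) v \<in> CB m1 B"
        using CB_mono[OF v, of m1 B] CB_mono[OF vt, of m1 B] CB_mono[of _ m1 M m1 B] MB
        by (auto intro!: CB_const simp: B_def)
      have vW: "v \<in> W2 N" and v1W: "deriv v \<in> W2 N" and v2W: "(deriv ^^ 2) v \<in> W2 N"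
        using cb m1(1) by (auto intro: CB_W2)
      have QV: "?Q g \<in> splines r N" for g by (rule quasi_interp_in_splines[of r N \<phi>, OF basis[OF N]])
      note QW = splines_W2[OF r N QV]
      note pws = W2D(6-8)[OF QW] W2D(6)[OF vW] W2D(6)[OF v1W] W2D(6)[OF v2W]
      have small: "\<bar>?L (\<phi> N i)\<bar> \<le> K' * h ^ (r + 1)" if i: "i \<in> {1..N}" for i
      proof -
        let ?b = "\<phi> N i"
        note bW = splines_W2[OF r N bV[OF N i]]
        note pwb = W2D(6-8)[OF bW]
        define G where "G j = l2_inner (\<phi> N j) ?b" for j
        define x where "x j = real j / real N" for j
        have pwj: "pw (\<phi> N j)" if "j \<in> {1..N}" for j by (rule W2D(6)[OF splines_W2[OF r N bV[OF N that]]])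
        have xI: "x j \<in> {0..1}" if "j \<in> {1..N}" for j using that N by (auto simp: x_def)
        \<comment> \<open>Interpolants without derivative or factor are nodal sums exactly and
          contribute no error.\<close>
        have Q0: "l2_inner (?Q g) ?b = (\<Sum>j=1..N. g (x j) * G j)" for g
          unfolding G_def x_def by (rule l2_inner_quasi_interp[of N \<phi>, OF pwj pwb(1)])
        let ?S = "\<lambda>\<kappa> \<nu> f g. \<Sum>j=1..N. product_deriv \<kappa> \<nu> f g (x j) * G j"
        have E: "\<bar>l2_inner (\<lambda>x. f x * (deriv ^^ \<nu>) (?Q g) x) ((deriv ^^ \<kappa>) ?b) - (-1) ^ \<kappa> * ?S \<kappa> \<nu> f g\<bar> \<le> \<bar>K \<nu> \<kappa>\<bar> * h ^ (r + 1)"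
          if "\<nu> \<le> 2" "\<kappa> \<le> 1" "f \<in> CB m1 B" "g \<in> CB m1 B" for \<nu> \<kappa> f g
        proof -
          have "K \<nu> \<kappa> * h ^ (r + 1) \<le> \<bar>K \<nu> \<kappa>\<bar> * h ^ (r + 1)"
            using h by (intro mult_right_mono) auto
          with K[OF that N i] show ?thesis unfolding product_error_def G_def x_def h_def by (rule order_trans)
        qed
        let ?k = "\<lambda>\<nu> \<kappa>. \<bar>K \<nu> \<kappa>\<bar> * h ^ (r + 1)"
        have e1: "\<bar>l2_inner (deriv (?Q vt)) (deriv ?b) + ?S 1 1 (\<lambda>_. 1) vt\<bar> \<le> ?k 1 1"
          using E[of 1 1 "\<lambda>_. 1" vt] cb by simp
        have e2: "\<bar>l2_inner (\<lambda>x. v x * deriv (?Q v) x) ?b - ?S 0 1 v v\<bar> \<le> ?k 1 0"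
          using E[of 1 0 v v] cb by simp
        have e3: "\<bar>l2_inner (\<lambda>x. deriv v x * ?Q v x) ?b - ?S 0 0 (deriv v) v\<bar> \<le> ?k 0 0"
          using E[of 0 0 "deriv v" v] cb by simp
        have e4: "\<bar>l2_inner (\<lambda>x. deriv v x * deriv (?Q v) x) (deriv ?b) + ?S 1 1 (deriv v) v\<bar> \<le> ?k 1 1"
          using E[of 1 1 "deriv v" v] cb by simp
        have e5: "\<bar>l2_inner (\<lambda>x. v x * (deriv ^^ 2) (?Q v) x) (deriv ?b) + ?S 1 2 v v\<bar> \<le> ?k 2 1"
          using E[of 2 1 v v] cb by simp
        have e6: "\<bar>l2_inner (\<lambda>x. (deriv ^^ 2) v x * ?Q v x) (deriv ?b) + ?S 1 0 ((deriv ^^ 2) v) v\<bar> \<le> ?k 0 1"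
          using E[of 0 1 "(deriv ^^ 2) v" v] cb by simp
        have pd: "product_deriv 1 1 (\<lambda>_. 1) vt y = (deriv ^^ 2) vt y"
          "product_deriv 0 1 v v y = v y * deriv v y"
          "product_deriv 0 0 (deriv v) v y = deriv v y * v y"
          "product_deriv 1 1 (deriv v) v y = (deriv ^^ 2) v y * deriv v y + deriv v y * (deriv ^^ 2) v y"
          "product_deriv 1 2 v v y = deriv v y * (deriv ^^ 2) v y + v y * (deriv ^^ 3) v y"
          "product_deriv 1 0 ((deriv ^^ 2) v) v y = (deriv ^^ 3) v y * v y + (deriv ^^ 2) v y * deriv v y" for y
          by (simp_all add: product_deriv_def numeral_2_eq_2 numeral_3_eq_3)
        \<comment> \<open>Each coefficient is twice the residual of the equation at the node:
          \<open>w\<close> occurs once explicitly and once as \<open>vt\<close> minus its second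
          derivative.\<close>
        have "(\<Sum>j=1..N. (vt (x j) + w (x j) - product_deriv 1 1 (\<lambda>_. 1) vt (x j)
            + 3 * product_deriv 0 1 v v (x j) + 3 * product_deriv 0 0 (deriv v) v (x j)
            - product_deriv 1 1 (deriv v) v (x j) - product_deriv 1 2 v v (x j)
            - product_deriv 1 0 ((deriv ^^ 2) v) v (x j)) * G j) = 0"
        proof (rule sum.neutral, rule ballI)
          fix j assume j: "j \<in> {1..N}"
          have z: "vt (x j) + w (x j) - product_deriv 1 1 (\<lambda>_. 1) vt (x j)
            + 3 * product_deriv 0 1 v v (x j) + 3 * product_deriv 0 0 (deriv v) v (x j)
            - product_deriv 1 1 (deriv v) v (x j) - product_deriv 1 2 v v (x j)
            - product_deriv 1 0 ((deriv ^^ 2) v) v (x j) = 0"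
            unfolding pd using w_def[of "x j"] pde[OF xI[OF j]] by (simp add: algebra_simps)
          show "(vt (x j) + w (x j) - product_deriv 1 1 (\<lambda>_. 1) vt (x j)
            + 3 * product_deriv 0 1 v v (x j) + 3 * product_deriv 0 0 (deriv v) v (x j)
            - product_deriv 1 1 (deriv v) v (x j) - product_deriv 1 2 v v (x j)
            - product_deriv 1 0 ((deriv ^^ 2) v) v (x j)) * G j = 0"
            unfolding z by simp
        qed
        then have z: "(\<Sum>j=1..N. vt (x j) * G j) + (\<Sum>j=1..N. w (x j) * G j) - ?S 1 1 (\<lambda>_. 1) vt
            + 3 * ?S 0 1 v v + 3 * ?S 0 0 (deriv v) v - ?S 1 1 (deriv v) v - ?S 1 2 v v
            - ?S 1 0 ((deriv ^^ 2) v) v = 0"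
          by (simp only: left_diff_distrib distrib_right sum.distrib sum_subtractf mult.assoc sum_distrib_left[symmetric])
        have L: "?L ?b = l2_inner (?Q vt) ?b + 3 * (l2_inner (\<lambda>x. v x * deriv (?Q v) x) ?b + l2_inner (\<lambda>x. deriv v x * ?Q v x) ?b)
            + l2_inner (?Q w) ?b
            + (l2_inner (deriv (?Q vt)) (deriv ?b) + l2_inner (\<lambda>x. deriv v x * deriv (?Q v) x) (deriv ?b)
            + l2_inner (\<lambda>x. v x * (deriv ^^ 2) (?Q v) x) (deriv ?b) + l2_inner (\<lambda>x. (deriv ^^ 2) v x * ?Q v x) (deriv ?b))"
          unfolding ch_linearized_def w_eq
          by (simp only: l2_inner_add_left l2_inner_cmult_left pw_add pw_mult pw_cmult pws pwb)
        have gen: "\<bar>q1 + 3 * (a2 + a3) + q2 + (a1 + a4 + a5 + a6)\<bar> \<le> k1 + 3 * k2 + 3 * k3 + k4 + k5 + k6"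
          if "\<bar>a1 + s1\<bar> \<le> k1" "\<bar>a2 - s2\<bar> \<le> k2" "\<bar>a3 - s3\<bar> \<le> k3" "\<bar>a4 + s4\<bar> \<le> k4" "\<bar>a5 + s5\<bar> \<le> k5" "\<bar>a6 + s6\<bar> \<le> k6"
            "q1 + q2 - s1 + 3 * s2 + 3 * s3 - s4 - s5 - s6 = 0"
          for q1 q2 a1 a2 a3 a4 a5 a6 s1 s2 s3 s4 s5 s6 k1 k2 k3 k4 k5 k6 :: real
        proof -
          have "q1 + 3 * (a2 + a3) + q2 + (a1 + a4 + a5 + a6)
            = (a1 + s1) + 3 * (a2 - s2) + 3 * (a3 - s3) + (a4 + s4) + (a5 + s5) + (a6 + s6)"
            using that(7) by (simp add: algebra_simps)
          moreover have "\<bar>d1 + 3 * d2 + 3 * d3 + d4 + d5 + d6\<bar> \<le> k1 + 3 * k2 + 3 * k3 + k4 + k5 + k6"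
            if "\<bar>d1\<bar> \<le> k1" "\<bar>d2\<bar> \<le> k2" "\<bar>d3\<bar> \<le> k3" "\<bar>d4\<bar> \<le> k4" "\<bar>d5\<bar> \<le> k5" "\<bar>d6\<bar> \<le> k6"
            for d1 d2 d3 d4 d5 d6 :: real
            using that unfolding abs_le_iff by auto
          ultimately show ?thesis using that(1-6) by (simp only:)
        qed
        have "\<bar>?L ?b\<bar> \<le> ?k 1 1 + 3 * ?k 1 0 + 3 * ?k 0 0 + ?k 1 1 + ?k 2 1 + ?k 0 1"
          unfolding L Q0 by (rule gen[OF e1 e2 e3 e4 e5 e6 z])
        also have "\<dots> = K' * h ^ (r + 1)" by (simp only: K'_def distrib_right mult.assoc)
        finally show ?thesis .
      qed
      have pA: "pw (\<lambda>x. ?Q vt x + 3 * (v x * deriv (?Q v) x + deriv v x * ?Q v x) + ?Q w x)"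
        and pB: "pw (\<lambda>x. deriv (?Q vt) x + deriv v x * deriv (?Q v) x + v x * (deriv ^^ 2) (?Q v) x + (deriv ^^ 2) v x * ?Q v x)"
        by (intro pw_add pw_cmult pw_mult pws)+
      have lin: "?L (\<lambda>x. f x + c * g x) = ?L f + c * ?L g" if "f \<in> splines r N" "g \<in> splines r N" for f g c
      proof -
        have W: "f \<in> W2 N" "g \<in> W2 N" using splines_W2[OF r N] that by auto
        have l: "l2_inner a (\<lambda>x. p x + c * q x) = l2_inner a p + c * l2_inner a q" if "pw a" "pw p" "pw q" for a p q
          using l2_inner_add_cmult_left[of p q a c] that by (simp add: l2_inner_commute[of a])
        show ?thesis
          unfolding ch_linearized_def w_eq deriv_add_cmult_W2(1)[OF W] l[OF pA W2D(6)[OF W(1)] W2D(6)[OF W(2)]]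
            l[OF pB W2D(7)[OF W(1)] W2D(7)[OF W(2)]]
          by (simp add: distrib_left)
      qed
      obtain \<psi> where \<psi>: "\<psi> \<in> splines r N" "\<And>f. f \<in> splines r N \<Longrightarrow> ?L f = l2_inner \<psi> f"
        using spline_riesz_l2[OF r N basis[OF N], of ?L] lin by metis
      have K'0: "0 \<le> K'" by (simp add: K'_def)
      have "l2_norm \<psi> \<le> Cs * inverse h * (MAX i\<in>{1..N}. \<bar>l2_inner \<psi> (\<phi> N i)\<bar>)"
        using Cs[OF N \<psi>(1)] by (simp add: h_def)
      \<comment> \<open>The factor \<open>inverse h\<close> of the stability property uses up the
        extra power of \<open>h\<close>.\<close>
      also have "\<dots> \<le> \<bar>Cs\<bar> * inverse h * (K' * h ^ (r + 1))"
      proof (intro mult_mono)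
        show "(MAX i\<in>{1..N}. \<bar>l2_inner \<psi> (\<phi> N i)\<bar>) \<le> K' * h ^ (r + 1)"
          using N small \<psi>(2)[OF bV[OF N]] by (subst Max_le_iff) auto
        have "0 \<le> \<bar>l2_inner \<psi> (\<phi> N 1)\<bar>" by simp
        also have "\<dots> \<le> (MAX i\<in>{1..N}. \<bar>l2_inner \<psi> (\<phi> N i)\<bar>)" using N by (intro Max_ge) auto
        finally show "0 \<le> (MAX i\<in>{1..N}. \<bar>l2_inner \<psi> (\<phi> N i)\<bar>)" .
      qed (use h in auto)
      also have "\<dots> = \<bar>Cs\<bar> * K' * h ^ r" using h by (simp add: field_simps)
      finally have n: "l2_norm \<psi> \<le> \<bar>Cs\<bar> * K' * h ^ r" .
      have pf: "pw \<psi>" "pw f" by (rule W2D(6)[OF splines_W2[OF r N \<psi>(1)]], rule W2D(6)[OF splines_W2[OF r N f]])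
      have "\<bar>?L f\<bar> \<le> l2_norm \<psi> * l2_norm f"
        unfolding \<psi>(2)[OF f] by (rule l2_inner_cauchy_schwarz[OF pf])
      also have "\<dots> \<le> \<bar>Cs\<bar> * K' * h ^ r * l2_norm f"
        by (rule mult_right_mono[OF n l2_norm_nonneg[OF pf(2)]])
      finally show ?thesis by (simp add: h_def)
    qed
    moreover have "0 \<le> \<bar>Cs\<bar> * K'" by (simp add: K'_def)
    ultimately show ?thesis by (intro exI[of _ "\<bar>Cs\<bar> * K'"] conjI) blast+
  qed
  then show ?thesis using that[of "m1 + 2"] m1(1) by auto
qed

text \<open>Writing \<open>H\<close> as \<open>v\<close> plus \<open>t0\<close> splits its products
  into the linear terms subtracted here, products of two of \<open>t0\<close>, \<open>t1\<close>,
  \<open>t2\<close>, and terms in \<open>v\<close> alone. By the equation and an integration by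
  parts the last ones reduce to \<open>p\<close>, which meets \<open>q\<close>. In the application
  \<open>H\<close> and \<open>q\<close> are the quasiinterpolants of \<open>v\<close> and
  \<open>p\<close>, and \<open>\<epsilon>\<close> is h^r.\<close>

lemma ch_remainder_bound:
  assumes N: "N \<ge> 1" and H: "H \<in> W2 N" and v: "v \<in> C_per 3" and f: "f \<in> W2 N" and q: "pw q"
    and p0: "pw p"
    and pde: "\<And>x. x \<in> {0..1} \<Longrightarrow> p x + 3 * v x * deriv v x = 2 * deriv v x * (deriv ^^ 2) v x + v x * (deriv ^^ 3) v x"
    and b0: "l2_norm (\<lambda>x. H x - v x) \<le> A * \<epsilon>"
    and bq: "l2_norm (\<lambda>x. q x - p x) \<le> A * \<epsilon>"
    and b1: "\<And>x. x \<in> {0..1} - mesh N \<Longrightarrow> \<bar>deriv H x - deriv v x\<bar> \<le> A"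
    and b2: "\<And>x. x \<in> {0..1} - mesh N \<Longrightarrow> \<bar>(deriv ^^ 2) H x - (deriv ^^ 2) v x\<bar> \<le> A"
    and b3: "\<And>x. x \<in> {0..1} - mesh N \<Longrightarrow> (deriv H x - deriv v x)\<^sup>2 \<le> A\<^sup>2 * \<epsilon>"
    and A: "0 \<le> A" "0 \<le> \<epsilon>"
  shows "\<bar>l2_inner (\<lambda>x. 3 * (H x * deriv H x) - 3 * (v x * deriv H x + deriv v x * H x) - q x) f
     + l2_inner (\<lambda>x. 1/2 * (deriv H x * deriv H x) + H x * (deriv ^^ 2) H x - deriv v x * deriv H x
        - v x * (deriv ^^ 2) H x - (deriv ^^ 2) v x * H x) (deriv f)\<bar>
     \<le> (6 * A\<^sup>2 + A) * \<epsilon> * sqrt (h1_inner f f)"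
proof -
  have v2: "v \<in> C_per 2" by (rule C_per_mono[OF v]) simp
  have vW: "v \<in> W2 N" by (rule C_per_W2[OF v2])
  have d0: "(v has_real_derivative deriv v x) (at x)" for x using C_perD(2)[OF v, of 0] by simp
  have d1: "(deriv v has_real_derivative (deriv ^^ 2) v x) (at x)" for x
    using C_perD(2)[OF v, of 1] by (simp add: numeral_2_eq_2)
  have d2: "((deriv ^^ 2) v has_real_derivative (deriv ^^ 3) v x) (at x)" for x
    using C_perD(2)[OF v, of 2] by (simp add: numeral_3_eq_3)
  have cv: "continuous_on UNIV v" "continuous_on UNIV (deriv v)" "continuous_on UNIV ((deriv ^^ 2) v)" "continuous_on UNIV ((deriv ^^ 3) v)"
    using C_per_continuous[OF v, of 0] C_per_continuous[OF v, of 1] C_per_continuous[OF v, of 2] C_per_continuous[OF v, of 3]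
    by simp_all
  note pws = W2D(6-8)[OF H] W2D(6-8)[OF f] pw_continuous[OF cv(1)] pw_continuous[OF cv(2)]
    pw_continuous[OF cv(3)] pw_continuous[OF cv(4)] q p0
  define t0 t1 t2 where "t0 x = H x - v x" and "t1 x = deriv H x - deriv v x" and "t2 x = (deriv ^^ 2) H x - (deriv ^^ 2) v x" for x
  have pt: "pw t0" "pw t1" "pw t2" unfolding t0_def[abs_def] t1_def[abs_def] t2_def[abs_def] by (intro pw_diff pws)+
  \<comment> \<open>\<open>z\<close> is the right-hand side of the equation and \<open>g\<close> its
    antiderivative.\<close>
  define z where "z x = 2 * (deriv v x * (deriv ^^ 2) v x) + v x * (deriv ^^ 3) v x" for x
  define g where "g x = 1/2 * (deriv v x * deriv v x) + v x * (deriv ^^ 2) v x" for x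
  have cz: "continuous_on UNIV z" unfolding z_def[abs_def] by (intro continuous_intros cv)
  have pz: "pw z" "pw g" unfolding z_def[abs_def] g_def[abs_def] by (intro pw_add pw_cmult pw_mult pws)+
  have gz: "l2_inner z f + l2_inner g (deriv f) = 0"
  proof -
    have "l2_inner g (deriv f) = - l2_inner z f"
    proof (rule l2_inner_by_parts)
      show "periodic1 g"
        using C_perD(1)[OF v] C_per_periodic_deriv[OF v, of 1] C_per_periodic_deriv[OF v, of 2]
        by (simp add: g_def periodic1_def)
      show "(g has_real_derivative z x) (at x)" for x
        unfolding g_def[abs_def] z_def
        by (rule derivative_eq_intros d0 d1 d2 refl | simp)+
    qed (use W2D[OF f] cz in auto)
    then show ?thesis by simp
  qed
  define P R where "P x = 3 * (t0 x * t1 x) - (q x - p x)" and "R x = 1/2 * (t1 x * t1 x) + t0 x * t2 x" for x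
  have pPR: "pw P" "pw R" unfolding P_def[abs_def] R_def[abs_def] by (intro pw_diff pw_add pw_cmult pw_mult pt pws)+
  have "l2_inner (\<lambda>x. 3 * (H x * deriv H x) - 3 * (v x * deriv H x + deriv v x * H x) - q x) f = l2_inner (\<lambda>x. P x - z x) f"
  proof (rule l2_inner_cong_finite[where F = "{}"])
    fix x :: real assume "x \<in> {0..1} - {}"
    then have e: "p x = z x - 3 * (v x * deriv v x)" using pde[of x] by (simp add: z_def)
    have "3 * (H x * deriv H x) - 3 * (v x * deriv H x + deriv v x * H x) - q x = P x - z x"
      unfolding P_def e t0_def t1_def by (simp add: algebra_simps)
    then show "(3 * (H x * deriv H x) - 3 * (v x * deriv H x + deriv v x * H x) - q x) * f x = (P x - z x) * f x"
      by (simp only:)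
  qed simp
  moreover have "l2_inner (\<lambda>x. 1/2 * (deriv H x * deriv H x) + H x * (deriv ^^ 2) H x - deriv v x * deriv H x
        - v x * (deriv ^^ 2) H x - (deriv ^^ 2) v x * H x) (deriv f) = l2_inner (\<lambda>x. R x - g x) (deriv f)"
  proof (rule l2_inner_cong_finite[where F = "{}"])
    fix x :: real
    have "1/2 * (deriv H x * deriv H x) + H x * (deriv ^^ 2) H x - deriv v x * deriv H x
        - v x * (deriv ^^ 2) H x - (deriv ^^ 2) v x * H x = R x - g x"
      unfolding R_def g_def t0_def t1_def t2_def by (simp add: algebra_simps)
    then show "(1/2 * (deriv H x * deriv H x) + H x * (deriv ^^ 2) H x - deriv v x * deriv H x
        - v x * (deriv ^^ 2) H x - (deriv ^^ 2) v x * H x) * deriv f x = (R x - g x) * deriv f x"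
      by (simp only:)
  qed simp
  moreover have "l2_inner (\<lambda>x. P x - z x) f + l2_inner (\<lambda>x. R x - g x) (deriv f) = l2_inner P f + l2_inner R (deriv f)"
    using gz by (simp add: l2_inner_diff_left pPR pz pws)
  ultimately have eq: "l2_inner (\<lambda>x. 3 * (H x * deriv H x) - 3 * (v x * deriv H x + deriv v x * H x) - q x) f
     + l2_inner (\<lambda>x. 1/2 * (deriv H x * deriv H x) + H x * (deriv ^^ 2) H x - deriv v x * deriv H x
        - v x * (deriv ^^ 2) H x - (deriv ^^ 2) v x * H x) (deriv f) = l2_inner P f + l2_inner R (deriv f)" by simp
  define n where "n = sqrt (h1_inner f f)"
  have nf: "l2_norm f \<le> n" "l2_norm (deriv f) \<le> n" "0 \<le> n"
    unfolding n_def l2_norm_def h1_inner_def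
    using l2_inner_nonneg[OF W2D(6)[OF f]] l2_inner_nonneg[OF W2D(7)[OF f]] by auto
  have bnd: "\<bar>l2_inner a b\<bar> \<le> C * n" if "pw a" "pw b" "l2_norm a \<le> C" "l2_norm b \<le> n" for a b C
  proof -
    have "l2_norm a * l2_norm b \<le> C * n"
      using that nf(3) l2_norm_nonneg[OF that(1)] l2_norm_nonneg[OF that(2)] by (intro mult_mono) auto
    then show ?thesis using l2_inner_cauchy_schwarz[OF that(1,2)] by linarith
  qed
  have n0: "l2_norm t0 \<le> A * \<epsilon>" using b0 by (simp add: t0_def[abs_def])
  \<comment> \<open>In the mixed products \<open>t0\<close> is small in L2 and the other factor
    merely bounded; the square of \<open>t1\<close> contains no such factor and relies on the
    pointwise bound \<open>b3\<close>.\<close>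
  have m1: "l2_norm (\<lambda>x. t0 x * t1 x) \<le> A * (A * \<epsilon>)"
    using l2_norm_mult_le[OF pt(1,2) finite_mesh[of N], of A] b1 A mult_left_mono[OF n0 A(1)]
    by (force simp: t1_def)
  have m2: "l2_norm (\<lambda>x. t0 x * t2 x) \<le> A * (A * \<epsilon>)"
    using l2_norm_mult_le[OF pt(1,3) finite_mesh[of N], of A] b2 A mult_left_mono[OF n0 A(1)]
    by (force simp: t2_def)
  have m3: "l2_norm (\<lambda>x. t1 x * t1 x) \<le> A\<^sup>2 * \<epsilon>"
    by (rule l2_norm_le_sup[OF pw_mult[OF pt(2,2)] finite_mesh[of N]])
      (use b3 A in \<open>auto simp: t1_def power2_eq_square\<close>)
  have P: "l2_inner P f = 3 * l2_inner (\<lambda>x. t0 x * t1 x) f - l2_inner (\<lambda>x. q x - p x) f"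
    unfolding P_def[abs_def] by (simp only: l2_inner_diff_left l2_inner_cmult_left pw_diff pw_cmult pw_mult pt pws)
  have R: "l2_inner R (deriv f) = 1/2 * l2_inner (\<lambda>x. t1 x * t1 x) (deriv f) + l2_inner (\<lambda>x. t0 x * t2 x) (deriv f)"
    unfolding R_def[abs_def] by (simp only: l2_inner_add_left l2_inner_cmult_left pw_add pw_cmult pw_mult pt pws)
  have "\<bar>l2_inner (\<lambda>x. t0 x * t1 x) f\<bar> \<le> A * (A * \<epsilon>) * n" by (rule bnd[OF pw_mult[OF pt(1,2)] _ m1 nf(1)]) (rule pws)
  moreover have "\<bar>l2_inner (\<lambda>x. q x - p x) f\<bar> \<le> A * \<epsilon> * n" by (rule bnd[OF pw_diff[OF q p0] _ bq nf(1)]) (rule pws)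
  moreover have "\<bar>l2_inner (\<lambda>x. t1 x * t1 x) (deriv f)\<bar> \<le> A\<^sup>2 * \<epsilon> * n" by (rule bnd[OF pw_mult[OF pt(2,2)] _ m3 nf(2)]) (rule pws)
  moreover have "\<bar>l2_inner (\<lambda>x. t0 x * t2 x) (deriv f)\<bar> \<le> A * (A * \<epsilon>) * n" by (rule bnd[OF pw_mult[OF pt(1,3)] _ m2 nf(2)]) (rule pws)
  moreover have "A * (A * \<epsilon>) * n = A\<^sup>2 * \<epsilon> * n" by (simp add: power2_eq_square)
  moreover have "0 \<le> A\<^sup>2 * \<epsilon> * n" using A nf by simp
  \<comment> \<open>The quadratic terms weigh 3 + 1/2 + 1, rounded up to 6.\<close>
  ultimately have "\<bar>l2_inner P f + l2_inner R (deriv f)\<bar> \<le> 6 * (A\<^sup>2 * \<epsilon> * n) + A * \<epsilon> * n"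
    unfolding P R by linarith
  also have "\<dots> = (6 * A\<^sup>2 + A) * \<epsilon> * n" by (simp add: algebra_simps)
  finally show ?thesis unfolding eq n_def .
qed

text \<open>All constants depend on the functions only through the radius \<open>M\<close>. The
  consistency error is \<open>ch_linearized\<close> plus the remainder of
  \<open>ch_remainder_bound\<close>; the other two conclusions supply the derivative bounds that the
  energy estimate needs and the interpolation error.\<close>

lemma ch_consistency:
  assumes r: "r \<ge> 3" and \<phi>: "quasi_interp_basis r \<phi>"
  obtains m where "m \<ge> 5"
    "\<And>M. \<exists>C\<ge>0. \<forall>v\<in>CB m M. \<forall>vt\<in>CB m M. \<forall>N f. ch_equation v vt \<longrightarrow> N \<ge> 1 \<longrightarrow> f \<in> splines r N \<longrightarrow>
      \<bar>h1_inner (quasi_interp \<phi> N vt) f + ch_form (quasi_interp \<phi> N v) (quasi_interp \<phi> N v) f\<bar>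
        \<le> C * (1 / real N) ^ r * sqrt (h1_inner f f)"
    "\<And>M. \<exists>B\<ge>0. \<forall>v\<in>CB m M. \<forall>N\<ge>1. \<forall>k\<le>2. \<forall>x\<in>{0..1} - mesh N. \<bar>(deriv ^^ k) (quasi_interp \<phi> N v) x\<bar> \<le> B"
    "\<And>M. \<exists>C\<ge>0. \<forall>v\<in>CB m M. \<forall>N\<ge>1. l2_norm (\<lambda>x. quasi_interp \<phi> N v x - v x) \<le> C * (1 / real N) ^ r"
proof -
  obtain m1 where m1: "m1 \<ge> 5"
    and lb: "\<And>M. \<exists>C\<ge>0. \<forall>v\<in>CB m1 M. \<forall>vt\<in>CB m1 M. \<forall>N f. ch_equation v vt \<longrightarrow> N \<ge> 1 \<longrightarrow> f \<in> splines r N \<longrightarrow>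
      \<bar>ch_linearized \<phi> N v vt f\<bar> \<le> C * (1 / real N) ^ r * l2_norm f"
    by (rule ch_linearized_bound[OF r \<phi>]) blast
  have "approximation_property r \<phi>" using \<phi> by (simp add: quasi_interp_basis_def)
  then obtain m2 C0 where C0: "C0 \<ge> 0"
    "\<And>v M N. v \<in> CB m2 M \<Longrightarrow> N \<ge> 1 \<Longrightarrow> l2_norm (\<lambda>x. quasi_interp \<phi> N v x - v x) \<le> C0 * M * (1 / real N) ^ r"
    by (rule quasi_interp_l2_error) blast
  obtain m3 C1 where C1: "C1 \<ge> 0"
    "\<And>v M N k x. v \<in> CB m3 M \<Longrightarrow> N \<ge> 1 \<Longrightarrow> k \<le> 2 \<Longrightarrow> x \<in> {0..1} - mesh N \<Longrightarrow>
      \<bar>(deriv ^^ k) (quasi_interp \<phi> N v) x - (deriv ^^ k) v x\<bar> \<le> C1 * M"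
    "\<And>v M N x. v \<in> CB m3 M \<Longrightarrow> N \<ge> 1 \<Longrightarrow> x \<in> {0..1} - mesh N \<Longrightarrow>
      (deriv (quasi_interp \<phi> N v) x - deriv v x)\<^sup>2 \<le> (C1 * M)\<^sup>2 * (1 / real N) ^ r"
    by (rule quasi_interp_derivative_bounds[OF r \<phi>]) blast
  \<comment> \<open>\<open>m2 + 2\<close> because the L2 error bound is also applied to
    \<open>vt\<close> minus its second derivative.\<close>
  define m where "m = max m1 (max (m2 + 2) m3)"
  have m: "m1 \<le> m" "m2 + 2 \<le> m" "m2 \<le> m" "m3 \<le> m" "5 \<le> m" using m1 by (auto simp: m_def)
  have basis: "is_spline_basis r N (\<phi> N)" if "N \<ge> 1" for N using \<phi> that by (simp add: quasi_interp_basis_def)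
  show ?thesis
  proof (rule that[OF m(5)])
    fix M
    show "\<exists>C\<ge>0. \<forall>v\<in>CB m M. \<forall>N\<ge>1. l2_norm (\<lambda>x. quasi_interp \<phi> N v x - v x) \<le> C * (1 / real N) ^ r"
    \<comment> \<open>A negative \<open>M\<close> gives an empty ball, for which any constant works;
      on a nonempty one \<open>M\<close> is nonnegative.\<close>
    proof (cases "CB m M = {}")
      case False
      then have M: "0 \<le> M" using CB_nonneg by blast
      have "l2_norm (\<lambda>x. quasi_interp \<phi> N v x - v x) \<le> C0 * M * (1 / real N) ^ r" if "v \<in> CB m M" "N \<ge> 1" for v N
        by (rule C0(2)[OF CB_mono[OF that(1) m(3) order_refl] that(2)])
      then show ?thesis using M C0(1) by (intro exI[of _ "C0 * M"]) auto
    qed auto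
    show "\<exists>B\<ge>0. \<forall>v\<in>CB m M. \<forall>N\<ge>1. \<forall>k\<le>2. \<forall>x\<in>{0..1} - mesh N. \<bar>(deriv ^^ k) (quasi_interp \<phi> N v) x\<bar> \<le> B"
    proof (cases "CB m M = {}")
      case False
      then have M: "0 \<le> M" using CB_nonneg by blast
      have "\<bar>(deriv ^^ k) (quasi_interp \<phi> N v) x\<bar> \<le> C1 * M + M"
        if v: "v \<in> CB m M" and *: "N \<ge> 1" "k \<le> 2" "x \<in> {0..1} - mesh N" for v N k x
      proof -
        have "\<bar>(deriv ^^ k) v x\<bar> \<le> M" using v *(2) m(5) by (simp add: CB_def)
        then show ?thesis using C1(2)[OF CB_mono[OF v m(4) order_refl] *] by linarith
      qed
      then show ?thesis using M C1(1) by (intro exI[of _ "C1 * M + M"]) auto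
    qed auto
    show "\<exists>C\<ge>0. \<forall>v\<in>CB m M. \<forall>vt\<in>CB m M. \<forall>N f. ch_equation v vt \<longrightarrow> N \<ge> 1 \<longrightarrow> f \<in> splines r N \<longrightarrow>
      \<bar>h1_inner (quasi_interp \<phi> N vt) f + ch_form (quasi_interp \<phi> N v) (quasi_interp \<phi> N v) f\<bar>
        \<le> C * (1 / real N) ^ r * sqrt (h1_inner f f)"
    proof -
      obtain C2 where C2: "C2 \<ge> 0" and lb: "\<And>v vt N f. v \<in> CB m1 M \<Longrightarrow> vt \<in> CB m1 M \<Longrightarrow> ch_equation v vt \<Longrightarrow>
        N \<ge> 1 \<Longrightarrow> f \<in> splines r N \<Longrightarrow> \<bar>ch_linearized \<phi> N v vt f\<bar> \<le> C2 * (1 / real N) ^ r * l2_norm f"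
        using lb[of M] by blast
      \<comment> \<open>The factor 2 comes from the radius \<open>2 * M\<close> of the ball that
        contains \<open>w\<close>.\<close>
      define A where "A = 2 * C0 * \<bar>M\<bar> + C1 * \<bar>M\<bar>"
      have A: "0 \<le> A" "C0 * \<bar>M\<bar> \<le> A" "2 * C0 * \<bar>M\<bar> \<le> A" "C1 * \<bar>M\<bar> \<le> A" using C0(1) C1(1) by (auto simp: A_def)
      define C where "C = C2 + (6 * A\<^sup>2 + A)"
      have C: "0 \<le> C" using C2 A by (simp add: C_def)
      have "\<bar>h1_inner (quasi_interp \<phi> N vt) f + ch_form (quasi_interp \<phi> N v) (quasi_interp \<phi> N v) f\<bar>
        \<le> C * (1 / real N) ^ r * sqrt (h1_inner f f)"
        if v: "v \<in> CB m M" and vt: "vt \<in> CB m M"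
          and ch: "ch_equation v vt"
          and N: "N \<ge> 1" and f: "f \<in> splines r N" for v vt N f
      proof -
        have M: "\<bar>M\<bar> = M" using CB_nonneg[OF v] by simp
        define \<epsilon> where "\<epsilon> = (1 / real N) ^ r"
        have \<epsilon>: "0 \<le> \<epsilon>" by (simp add: \<epsilon>_def)
        define w where "w x = vt x - (deriv ^^ 2) vt x" for x
        have w_eq: "(\<lambda>x. vt x - (deriv ^^ 2) vt x) = w" by (simp add: w_def fun_eq_iff)
        let ?Q = "quasi_interp \<phi> N"
        have QV: "?Q g \<in> splines r N" for g by (rule quasi_interp_in_splines[of r N \<phi>, OF basis[OF N]])
        note QW = splines_W2[OF r N QV]
        note fW = splines_W2[OF r N f]
        have v3: "v \<in> C_per 3" and vt2: "(deriv ^^ 2) vt \<in> CB m2 M" and vtm: "vt \<in> CB m2 M"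
          using C_per_mono[of v m 3] v m CB_deriv[OF CB_mono[OF vt m(2) order_refl]] CB_mono[OF vt m(3) order_refl]
          by (auto simp: CB_def)
        have wCB: "w \<in> CB m2 (2 * M)" unfolding w_def[abs_def] by (rule CB_diff[OF vtm vt2])
        have vW: "v \<in> W2 N" by (rule CB_W2[OF v]) (use m in simp)
        have cv: "pw v" "pw (deriv v)" "pw ((deriv ^^ 2) v)"
          by (rule W2D(6-8)[OF vW])+
        have pw_w: "pw w" using wCB C_per_continuous[of w m2 0] by (auto simp: CB_def intro: pw_continuous)
        note pws = W2D(6-8)[OF QW] W2D(6-8)[OF fW] cv
        have "\<bar>ch_linearized \<phi> N v vt f\<bar> \<le> C2 * \<epsilon> * l2_norm f"
          unfolding \<epsilon>_def
          by (rule lb[OF CB_mono[OF v m(1) order_refl] CB_mono[OF vt m(1) order_refl] ch N f])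
        also have "\<dots> \<le> C2 * \<epsilon> * sqrt (h1_inner f f)"
          unfolding l2_norm_def h1_inner_def using C2 \<epsilon> l2_inner_nonneg[OF W2D(7)[OF fW]]
          by (intro mult_left_mono real_sqrt_le_mono) auto
        finally have L: "\<bar>ch_linearized \<phi> N v vt f\<bar> \<le> C2 * \<epsilon> * sqrt (h1_inner f f)" .
        let ?D = "l2_inner (\<lambda>x. 3 * (?Q v x * deriv (?Q v) x) - 3 * (v x * deriv (?Q v) x + deriv v x * ?Q v x) - ?Q w x) f
           + l2_inner (\<lambda>x. 1/2 * (deriv (?Q v) x * deriv (?Q v) x) + ?Q v x * (deriv ^^ 2) (?Q v) x - deriv v x * deriv (?Q v) x
            - v x * (deriv ^^ 2) (?Q v) x - (deriv ^^ 2) v x * ?Q v x) (deriv f)"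
        have D: "\<bar>?D\<bar> \<le> (6 * A\<^sup>2 + A) * \<epsilon> * sqrt (h1_inner f f)"
        proof (rule ch_remainder_bound[OF N QW v3 fW W2D(6)[OF QW] pw_w])
          show "w x + 3 * v x * deriv v x = 2 * deriv v x * (deriv ^^ 2) v x + v x * (deriv ^^ 3) v x" if "x \<in> {0..1}" for x
            using ch that by (simp add: ch_equation_def w_def)
          have "l2_norm (\<lambda>x. ?Q v x - v x) \<le> C0 * M * \<epsilon>"
            unfolding \<epsilon>_def by (rule C0(2)[OF CB_mono[OF v m(3) order_refl] N])
          also have "\<dots> \<le> A * \<epsilon>" using A(2) \<epsilon> M by (intro mult_right_mono) auto
          finally show "l2_norm (\<lambda>x. ?Q v x - v x) \<le> A * \<epsilon>" .
          have "l2_norm (\<lambda>x. ?Q w x - w x) \<le> C0 * (2 * M) * \<epsilon>"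
            unfolding \<epsilon>_def by (rule C0(2)[OF wCB N])
          also have "\<dots> \<le> A * \<epsilon>" using A(3) \<epsilon> M by (intro mult_right_mono) auto
          finally show "l2_norm (\<lambda>x. ?Q w x - w x) \<le> A * \<epsilon>" .
          fix x assume x: "x \<in> {0..1} - mesh N"
          have C1A: "C1 * M \<le> A" "0 \<le> C1 * M" using A(4) M CB_nonneg[OF v] C1(1) by auto
          note v_m3 = CB_mono[OF v m(4) order_refl]
          show "\<bar>deriv (?Q v) x - deriv v x\<bar> \<le> A" using C1(2)[OF v_m3 N _ x, of 1] C1A by simp
          show "\<bar>(deriv ^^ 2) (?Q v) x - (deriv ^^ 2) v x\<bar> \<le> A" using C1(2)[OF v_m3 N _ x, of 2] C1A by linarith
          have "(deriv (?Q v) x - deriv v x)\<^sup>2 \<le> (C1 * M)\<^sup>2 * \<epsilon>" unfolding \<epsilon>_def by (rule C1(3)[OF v_m3 N x])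
          also have "\<dots> \<le> A\<^sup>2 * \<epsilon>" using C1A \<epsilon> by (intro mult_right_mono power_mono) auto
          finally show "(deriv (?Q v) x - deriv v x)\<^sup>2 \<le> A\<^sup>2 * \<epsilon>" .
        qed (use A \<epsilon> in auto)
        have eq: "h1_inner (?Q vt) f + ch_form (?Q v) (?Q v) f = ch_linearized \<phi> N v vt f + ?D"
          unfolding h1_inner_def ch_form_def ch_linearized_def w_eq
          by (simp only: l2_inner_add_left l2_inner_diff_left l2_inner_cmult_left pw_add pw_diff pw_mult pw_cmult pws)
        have "\<bar>ch_linearized \<phi> N v vt f + ?D\<bar> \<le> C2 * \<epsilon> * sqrt (h1_inner f f) + (6 * A\<^sup>2 + A) * \<epsilon> * sqrt (h1_inner f f)"
          by (rule order_trans[OF abs_triangle_ineq add_mono[OF L D]])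
        also have "\<dots> = C * \<epsilon> * sqrt (h1_inner f f)" by (simp add: C_def algebra_simps)
        finally show ?thesis unfolding eq \<epsilon>_def .
      qed
      then show ?thesis using C by (intro exI[of _ C] conjI) blast+
    qed
  qed
qed

section \<open>The semidiscrete problem\<close>

lemma real_derivative_unique_within_Icc:
  fixes f :: "real \<Rightarrow> real"
  assumes "T > 0" "t \<in> {0..T}" "(f has_real_derivative a) (at t within {0..T})" "(f has_real_derivative b) (at t within {0..T})"
  shows "a = b"
  using assms by (intro vector_derivative_unique_within_closed_interval[of 0 T t f a b])
    (simp_all add: has_real_derivative_iff_has_vector_derivative)

text \<open>On a nondegenerate interval even the one-sided derivatives at the end points are unique,
  so the choice in \<open>vector_derivative\<close> is forced.\<close>

lemma time_derivI:
  assumes "T > 0" "t \<in> {0..T}" "((\<lambda>s. u s x) has_real_derivative d) (at t within {0..T})"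
  shows "time_deriv T u t x = d"
proof -
  have v: "((\<lambda>s. u s x) has_vector_derivative d) (at t within {0..T})"
    using assms(3) by (simp add: has_real_derivative_iff_has_vector_derivative)
  then have "((\<lambda>s. u s x) has_vector_derivative time_deriv T u t x) (at t within {0..T})"
    unfolding time_deriv_def using vector_derivative_works differentiableI_vector by blast
  then show ?thesis
    using real_derivative_unique_within_Icc[OF assms(1,2) _ assms(3)]
    by (simp add: has_real_derivative_iff_has_vector_derivative)
qed

lemma differentiable_time_deriv:
  assumes "(\<lambda>s. u s x) differentiable (at t within {0..T})"
  shows "((\<lambda>s. u s x) has_real_derivative time_deriv T u t x) (at t within {0..T})"
  unfolding has_real_derivative_iff_has_vector_derivative time_deriv_def
  using assms vector_derivative_works by blast

lemma spline_lagrange_basis: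
  assumes "is_spline_basis r N b"
  obtains m :: nat and p g where "\<And>k. k < m \<Longrightarrow> g k \<in> splines r N"
    and "\<And>f. f \<in> splines r N \<Longrightarrow> f = (\<lambda>x. \<Sum>k<m. f (p k) * g k x)"
proof -
  interpret function_space "splines r N" by (rule splines_function_space)
  obtain m :: nat and p g where g: "\<And>k. k < m \<Longrightarrow> g k \<in> splines r N"
    and rep: "\<And>f x. f \<in> splines r N \<Longrightarrow> f x = (\<Sum>k<m. f (p k) * g k x)"
    by (rule lagrange_basis[OF finite_atLeastAtMost spline_basisD[OF assms]]) blast+
  show ?thesis by (rule that[OF g]) (assumption, rule ext, rule rep)
qed

text \<open>A spline depends linearly on its values at the finitely many points \<open>p k\<close>.
  So a pointwise derivative in time is a combination of the same splines \<open>g k\<close>, and the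
  H^1 square norm is a quadratic polynomial in differentiable coefficients.\<close>

lemma spline_curve_derivative:
  assumes r: "r \<ge> 3" and N: "N \<ge> 1" and basis: "is_spline_basis r N b" and T: "T > 0"
    and w: "\<And>t. t \<in> {0..T} \<Longrightarrow> w t \<in> splines r N"
    and w': "\<And>t x. t \<in> {0..T} \<Longrightarrow> ((\<lambda>s. w s x) has_real_derivative w' t x) (at t within {0..T})"
    and t: "t \<in> {0..T}"
  shows "w' t \<in> splines r N"
    and "((\<lambda>s. h1_inner (w s) (w s)) has_real_derivative 2 * h1_inner (w' t) (w t)) (at t within {0..T})"
proof -
  interpret function_inner_space "splines r N" h1_inner by (rule splines_h1_inner_space[OF r N])
  obtain m :: nat and p g where g: "\<And>k. k < m \<Longrightarrow> g k \<in> splines r N"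
    and rep: "\<And>f. f \<in> splines r N \<Longrightarrow> f = (\<lambda>x. \<Sum>k<m. f (p k) * g k x)"
    by (rule spline_lagrange_basis[OF basis]) blast
  have eq: "w' t x = (\<Sum>k<m. w' t (p k) * g k x)" for x
  proof (rule real_derivative_unique_within_Icc[OF T t w'[OF t]])
    have "((\<lambda>s. \<Sum>k<m. w s (p k) * g k x) has_real_derivative (\<Sum>k<m. w' t (p k) * g k x)) (at t within {0..T})"
      by (intro DERIV_sum DERIV_cmult_right w' t)
    then show "((\<lambda>s. w s x) has_real_derivative (\<Sum>k<m. w' t (p k) * g k x)) (at t within {0..T})"
      by (rule has_field_derivative_transform_within[where d = 1]) (use t fun_cong[OF rep[OF w]] in auto)
  qed
  then have w'_rep: "w' t = (\<lambda>x. \<Sum>k<m. w' t (p k) * g k x)" by blast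
  show w'V: "w' t \<in> splines r N"
    by (subst w'_rep, rule lincomb) (use g in auto)
  have ip: "h1_inner f f' = (\<Sum>k<m. \<Sum>l<m. f (p k) * f' (p l) * h1_inner (g k) (g l))"
    if f: "f \<in> splines r N" and f': "f' \<in> splines r N" for f f'
  proof -
    have "h1_inner f f' = h1_inner (\<lambda>x. \<Sum>k<m. f (p k) * g k x) f'" using rep[OF f] by simp
    also have "\<dots> = (\<Sum>k<m. f (p k) * h1_inner (g k) f')"
      by (rule ip_lincomb) (use g f' in auto)
    also have "\<dots> = (\<Sum>k<m. f (p k) * (\<Sum>l<m. f' (p l) * h1_inner (g k) (g l)))"
    proof (rule sum.cong[OF refl])
      fix k assume "k \<in> {..<m}"
      then have "h1_inner (g k) (\<lambda>x. \<Sum>l<m. f' (p l) * g l x) = (\<Sum>l<m. f' (p l) * h1_inner (g k) (g l))"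
        by (intro ip_lincomb_right) (use g in auto)
      then show "f (p k) * h1_inner (g k) f' = f (p k) * (\<Sum>l<m. f' (p l) * h1_inner (g k) (g l))"
        using rep[OF f'] by simp
    qed
    finally show ?thesis by (simp add: sum_distrib_left mult.assoc)
  qed
  have "((\<lambda>s. \<Sum>k<m. \<Sum>l<m. w s (p k) * w s (p l) * h1_inner (g k) (g l)) has_real_derivative
      (\<Sum>k<m. \<Sum>l<m. (w' t (p k) * w t (p l) + w' t (p l) * w t (p k)) * h1_inner (g k) (g l))) (at t within {0..T})"
    by (intro DERIV_sum DERIV_cmult_right DERIV_mult w' t)
  moreover have "(\<Sum>k<m. \<Sum>l<m. (w' t (p k) * w t (p l) + w' t (p l) * w t (p k)) * h1_inner (g k) (g l))
      = h1_inner (w' t) (w t) + h1_inner (w t) (w' t)"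
    unfolding ip[OF w'V w[OF t]] ip[OF w[OF t] w'V] by (simp add: sum.distrib algebra_simps)
  ultimately have "((\<lambda>s. \<Sum>k<m. \<Sum>l<m. w s (p k) * w s (p l) * h1_inner (g k) (g l)) has_real_derivative
      2 * h1_inner (w' t) (w t)) (at t within {0..T})"
    by (simp add: h1_inner_commute[of "w t"])
  then show "((\<lambda>s. h1_inner (w s) (w s)) has_real_derivative 2 * h1_inner (w' t) (w t)) (at t within {0..T})"
    by (rule has_field_derivative_transform_within[where d = 1]) (use t ip[OF w w] in auto)
qed

lemma semidiscrete_solutionD:
  assumes "semidiscrete_solution r N T v uh" "t \<in> {0..T}"
  shows "uh t \<in> splines r N"
    and "((\<lambda>s. uh s x) has_real_derivative time_deriv T uh t x) (at t within {0..T})"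
    and "f \<in> splines r N \<Longrightarrow> h1_inner (time_deriv T uh t) f + ch_form (uh t) (uh t) f = 0"
proof -
  show "uh t \<in> splines r N" using assms by (simp add: semidiscrete_solution_def)
  show "((\<lambda>s. uh s x) has_real_derivative time_deriv T uh t x) (at t within {0..T})"
    by (rule differentiable_time_deriv) (use assms in \<open>simp add: semidiscrete_solution_def\<close>)
  assume f: "f \<in> splines r N"
  have "l2_inner (time_deriv T uh t) f + l2_inner (deriv (time_deriv T uh t)) (deriv f)
        + 3 * l2_inner (\<lambda>x. uh t x * deriv (uh t) x) f
        + 1 / 2 * l2_inner (\<lambda>x. (deriv (uh t) x)\<^sup>2) (deriv f)
        + l2_inner (\<lambda>x. uh t x * (deriv ^^ 2) (uh t) x) (deriv f) = 0"
    using assms f unfolding semidiscrete_solution_def by blast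
  then show "h1_inner (time_deriv T uh t) f + ch_form (uh t) (uh t) f = 0"
    by (simp add: h1_inner_def ch_form_def power2_eq_square)
qed

text \<open>\<open>w\<close> is a spline curve that satisfies the scheme up to the defect
  \<open>\<delta>\<close>. Testing the difference of the two relations with \<open>w\<close> minus
  \<open>uh\<close> gives a differential inequality for its H^1 square norm in which only
  \<open>w\<close> has to be bounded. A second solution with \<open>\<delta> = 0\<close> gives
  uniqueness, the quasiinterpolant gives the error estimate.\<close>

lemma semidiscrete_energy_estimate:
  assumes r: "r \<ge> 3" and N: "N \<ge> 1" and basis: "is_spline_basis r N b" and T: "T > 0"
    and w: "\<And>t. t \<in> {0..T} \<Longrightarrow> w t \<in> splines r N"
    and w': "\<And>t x. t \<in> {0..T} \<Longrightarrow> ((\<lambda>s. w s x) has_real_derivative w' t x) (at t within {0..T})"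
    and cons: "\<And>t f. t \<in> {0..T} \<Longrightarrow> f \<in> splines r N \<Longrightarrow>
      \<bar>h1_inner (w' t) f + ch_form (w t) (w t) f\<bar> \<le> \<delta> * sqrt (h1_inner f f)"
    and M: "0 \<le> M" "\<And>t k x. t \<in> {0..T} \<Longrightarrow> k \<le> 2 \<Longrightarrow> x \<in> {0..1} - mesh N \<Longrightarrow> \<bar>(deriv ^^ k) (w t) x\<bar> \<le> M"
    and sol: "semidiscrete_solution r N T (w 0) uh" and t: "t \<in> {0..T}"
  shows "h1_inner (\<lambda>x. w t x - uh t x) (\<lambda>x. w t x - uh t x) \<le> \<delta>\<^sup>2 * T * exp ((10 * M + 1) * T)"
proof -
  interpret function_inner_space "splines r N" h1_inner by (rule splines_h1_inner_space[OF r N])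
  note W = splines_W2[OF r N]
  define e where "e t x = w t x + (-1) * uh t x" for t x
  define e' where "e' t x = w' t x + (-1) * time_deriv T uh t x" for t x
  note sD = semidiscrete_solutionD[OF sol]
  have eV: "e t \<in> splines r N" if "t \<in> {0..T}" for t
    unfolding e_def[abs_def] by (rule add_cmult[OF w[OF that] sD(1)[OF that]])
  have e': "((\<lambda>s. e s x) has_real_derivative e' t x) (at t within {0..T})" if "t \<in> {0..T}" for t x
    unfolding e_def e'_def by (intro DERIV_add DERIV_cmult w' sD(2) that)
  have "h1_inner (e t) (e t) \<le> \<delta>\<^sup>2 * T * exp ((10 * M + 1) * T)"
  proof (rule gronwall_affine[OF _ _ _ _ _ t])
    show "((\<lambda>s. h1_inner (e s) (e s)) has_real_derivative 2 * h1_inner (e' t) (e t)) (at t within {0..T})"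
      if "t \<in> {0..T}" for t
      by (rule spline_curve_derivative(2)[OF r N basis T eV e' that])
    have "e 0 = (\<lambda>_. 0)" using sol by (simp add: e_def[abs_def] semidiscrete_solution_def)
    then show "h1_inner (e 0) (e 0) = 0" using ip_zero[OF zero] by simp
    fix t assume t: "t \<in> {0..T}"
    note wV = w[OF t] and uV = sD(1)[OF t] and eV' = eV[OF t]
    have w'V: "w' t \<in> splines r N" by (rule spline_curve_derivative(1)[OF r N basis T w w' t])
    have u'V: "time_deriv T uh t \<in> splines r N" by (rule spline_curve_derivative(1)[OF r N basis T sD(1) sD(2) t])
    have u: "uh t = (\<lambda>x. w t x - e t x)" by (simp add: e_def)
    have "h1_inner (e' t) (e t) = h1_inner (w' t) (e t) + (-1) * h1_inner (time_deriv T uh t) (e t)"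
      unfolding e'_def[abs_def] by (rule lin[OF w'V u'V eV'])
    also have "\<dots> = (h1_inner (w' t) (e t) + ch_form (w t) (w t) (e t)) - (ch_form (w t) (w t) (e t) - ch_form (uh t) (uh t) (e t))"
      using sD(3)[OF t eV'] by simp
    finally have eq: "h1_inner (e' t) (e t)
      = (h1_inner (w' t) (e t) + ch_form (w t) (w t) (e t)) - (ch_form (w t) (w t) (e t) - ch_form (uh t) (uh t) (e t))" .
    have b1: "\<bar>ch_form (w t) (w t) (e t) - ch_form (uh t) (uh t) (e t)\<bar> \<le> 5 * M * h1_inner (e t) (e t)"
      unfolding u
    proof (rule ch_form_diff_energy_bound[OF W[OF wV] W[OF eV']])
      fix x assume x: "x \<in> {0..1} - mesh N"
      show "\<bar>w t x\<bar> \<le> M \<and> \<bar>deriv (w t) x\<bar> \<le> M \<and> \<bar>(deriv ^^ 2) (w t) x\<bar> \<le> M"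
        using M(2)[OF t _ x, of 0] M(2)[OF t _ x, of 1] M(2)[OF t _ x, of 2] by simp
    qed
    define n where "n = sqrt (h1_inner (e t) (e t))"
    have n: "n\<^sup>2 = h1_inner (e t) (e t)" unfolding n_def using nonneg[OF eV'] by simp
    \<comment> \<open>Young's inequality contributes the 1 in \<open>10 * M + 1\<close>; the 10 is
      twice the 5 of \<open>ch_form_diff_energy_bound\<close>.\<close>
    have "2 * (\<delta> * n) \<le> \<delta>\<^sup>2 + n\<^sup>2" using zero_le_power2[of "\<delta> - n"] by (simp add: power2_diff)
    then show "2 * h1_inner (e' t) (e t) \<le> \<delta>\<^sup>2 + (10 * M + 1) * h1_inner (e t) (e t)"
      using cons[OF t eV'] b1 unfolding eq n_def[symmetric] n by (simp add: algebra_simps abs_le_iff)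
  qed (use M in auto)
  then show ?thesis by (simp add: e_def[abs_def])
qed

text \<open>One solution plays the part of \<open>w\<close> with zero defect. Its derivatives in
  \<open>x\<close> are bounded over [0,T] because its finitely many coordinates are continuous in
  time. The bound may depend on the mesh, which is harmless as the estimate is multiplied by
  zero.\<close>

lemma semidiscrete_solution_unique:
  assumes r: "r \<ge> 3" and N: "N \<ge> 1" and basis: "is_spline_basis r N b" and T: "T > 0"
    and u: "semidiscrete_solution r N T v uh" and v: "semidiscrete_solution r N T v vh" and t: "t \<in> {0..T}"
  shows "vh t = uh t"
proof -
  interpret function_inner_space "splines r N" h1_inner by (rule splines_h1_inner_space[OF r N])
  note uD = semidiscrete_solutionD[OF u]
  obtain m :: nat and p g where g: "\<And>k. k < m \<Longrightarrow> g k \<in> splines r N"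
    and rep: "\<And>f. f \<in> splines r N \<Longrightarrow> f = (\<lambda>x. \<Sum>k<m. f (p k) * g k x)"
    by (rule spline_lagrange_basis[OF basis]) blast
  have "\<exists>B. \<forall>t\<in>{0..T}. \<bar>uh t x\<bar> \<le> B" for x
  proof -
    have "continuous_on {0..T} (\<lambda>t. uh t x)" using uD(2) by (intro DERIV_continuous_on)
    then have "bounded ((\<lambda>t. uh t x) ` {0..T})" by (intro compact_imp_bounded compact_continuous_image) auto
    then show ?thesis unfolding bounded_iff real_norm_def by blast
  qed
  then obtain B where B: "\<And>t x. t \<in> {0..T} \<Longrightarrow> \<bar>uh t x\<bar> \<le> B x" by metis
  have "\<exists>B'. \<forall>x\<in>{0..1}. \<bar>(deriv ^^ j) (g k) x\<bar> \<le> B'" if "k < m" for k j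
    using spline_pw_deriv[OF g[OF that] N, of j] unfolding pw_def by blast
  then obtain B' where B': "\<And>k j x. k < m \<Longrightarrow> x \<in> {0..1} \<Longrightarrow> \<bar>(deriv ^^ j) (g k) x\<bar> \<le> B' k j" by metis
  have B0: "0 \<le> B x" for x using B[of 0 x] T by force
  have B'0: "0 \<le> B' k j" if "k < m" for k j using B'[OF that, of 0 j] by force
  define M where "M = (\<Sum>j\<in>{0, 1, 2::nat}. \<Sum>k<m. B (p k) * B' k j)"
  have M: "\<bar>(deriv ^^ j) (uh t) x\<bar> \<le> M" if t: "t \<in> {0..T}" and j: "j \<le> 2" and x: "x \<in> {0..1} - mesh N" for t j x
  proof -
    have "(deriv ^^ j) (uh t) x = (deriv ^^ j) (\<lambda>x. \<Sum>k<m. uh t (p k) * g k x) x" using rep[OF uD(1)[OF t]] by simp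
    also have "\<dots> = (\<Sum>k<m. uh t (p k) * (deriv ^^ j) (g k) x)"
      by (rule higher_deriv_spline_lincomb[OF r N j x]) (use g in auto)
    finally have "\<bar>(deriv ^^ j) (uh t) x\<bar> \<le> (\<Sum>k<m. \<bar>uh t (p k) * (deriv ^^ j) (g k) x\<bar>)" by (simp add: sum_abs)
    also have "\<dots> \<le> (\<Sum>k<m. B (p k) * B' k j)"
      unfolding abs_mult using B[OF t] B' x B0 by (intro sum_mono mult_mono) auto
    also have "\<dots> \<le> M" unfolding M_def using B0 B'0 j
      by (intro member_le_sum[of j "{0, 1, 2}" "\<lambda>j. \<Sum>k<m. B (p k) * B' k j"] sum_nonneg mult_nonneg_nonneg) auto
    finally show ?thesis .
  qed
  have M0: "0 \<le> M" unfolding M_def using B0 B'0 by (intro sum_nonneg mult_nonneg_nonneg) auto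
  have u0: "uh 0 = v" using u by (simp add: semidiscrete_solution_def)
  have "h1_inner (\<lambda>x. uh t x - vh t x) (\<lambda>x. uh t x - vh t x) \<le> 0\<^sup>2 * T * exp ((10 * M + 1) * T)"
    by (rule semidiscrete_energy_estimate[OF r N basis T uD(1,2) _ M0 M _ t]) (use uD(3) v u0 in auto)
  moreover have d: "(\<lambda>x. uh t x - vh t x) \<in> splines r N"
    using add_cmult[OF uD(1)[OF t] semidiscrete_solutionD(1)[OF v t], of "-1"] by simp
  ultimately have "(\<lambda>x. uh t x - vh t x) = (\<lambda>_. 0)" using definite[OF d] nonneg[OF d] by simp
  then show ?thesis by (simp add: fun_eq_iff)
qed

text \<open>In an H^1-orthonormal basis the mass matrix is the identity, so the scheme is an
  explicit quadratic system, and its energy is the sum of squares of the coefficients.\<close>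

lemma semidiscrete_solution_exists:
  assumes r: "r \<ge> 3" and N: "N \<ge> 1" and basis: "is_spline_basis r N b" and T: "T > 0" and v: "v \<in> splines r N"
  obtains uh where "semidiscrete_solution r N T v uh"
proof -
  interpret function_inner_space "splines r N" h1_inner by (rule splines_h1_inner_space[OF r N])
  interpret W: function_space "W2 N" by (rule W2_function_space)
  obtain n :: nat and e where e: "\<And>i. i < n \<Longrightarrow> e i \<in> splines r N"
    and rep: "\<And>f. f \<in> splines r N \<Longrightarrow> f = (\<lambda>x. \<Sum>i<n. h1_inner f (e i) * e i x)"
    by (rule orthonormal_basis[OF finite_atLeastAtMost spline_basisD[OF basis]]) blast+
  have eW: "e i \<in> W2 N" if "i \<in> {..<n}" for i using splines_W2[OF r N e] that by simp
  define \<beta> where "\<beta> i k l = ch_form (e k) (e l) (e i)" for i k l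
  have SW: "(\<lambda>x. \<Sum>i<n. y i * e i x) \<in> W2 N" for y by (rule W.lincomb) (use eW in auto)
  \<comment> \<open>With \<open>z = y\<close> this yields the energy identity of the system, and
    with the coefficients of a test function for \<open>z\<close> it yields the scheme.\<close>
  have form: "ch_form (\<lambda>x. \<Sum>k<n. y k * e k x) (\<lambda>x. \<Sum>l<n. y l * e l x) (\<lambda>x. \<Sum>i<n. z i * e i x)
     = (\<Sum>i<n. z i * (\<Sum>k<n. \<Sum>l<n. y k * y l * \<beta> i k l))" for y z
  proof -
    let ?Y = "\<lambda>x. \<Sum>k<n. y k * e k x"
    have "ch_form ?Y ?Y (\<lambda>x. \<Sum>i<n. z i * e i x) = (\<Sum>i<n. z i * ch_form ?Y ?Y (e i))"
      by (rule W.linear_lincomb[OF _ finite_lessThan eW]) (rule ch_form_add_cmult_3; (rule SW | assumption))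
    also have "\<dots> = (\<Sum>i<n. z i * (\<Sum>k<n. y k * ch_form (e k) ?Y (e i)))"
    proof (rule sum.cong[OF refl])
      fix i assume i: "i \<in> {..<n}"
      have "ch_form ?Y ?Y (e i) = (\<Sum>k<n. y k * ch_form (e k) ?Y (e i))"
        by (rule W.linear_lincomb[OF _ finite_lessThan eW, where F = "\<lambda>f. ch_form f ?Y (e i)"])
          (rule ch_form_add_cmult_1; (rule SW eW[OF i] | assumption))
      then show "z i * ch_form ?Y ?Y (e i) = z i * (\<Sum>k<n. y k * ch_form (e k) ?Y (e i))" by simp
    qed
    also have "\<dots> = (\<Sum>i<n. z i * (\<Sum>k<n. y k * (\<Sum>l<n. y l * \<beta> i k l)))"
    proof (intro sum.cong[OF refl] arg_cong2[of _ _ _ _ "(*)"] refl)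
      fix i k assume i: "i \<in> {..<n}" and k: "k \<in> {..<n}"
      show "ch_form (e k) ?Y (e i) = (\<Sum>l<n. y l * \<beta> i k l)"
        unfolding \<beta>_def
        by (rule W.linear_lincomb[OF _ finite_lessThan eW, where F = "\<lambda>f. ch_form (e k) f (e i)"])
          (rule ch_form_add_cmult_2; (rule eW[OF i] eW[OF k] | assumption))
    qed
    finally show ?thesis by (simp add: sum_distrib_left mult_ac)
  qed
  have energy: "(\<Sum>i<n. y i * (\<Sum>k<n. \<Sum>l<n. y k * y l * \<beta> i k l)) = 0" for y
    using form[of y y] ch_form_self_eq_0[OF SW[of y]] by simp
  have energy': "(\<Sum>i<n. \<Sum>k<n. \<Sum>l<n. y i * (y k * y l * \<beta> i k l)) = 0" for y
    using energy[of y] by (simp only: sum_distrib_left)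
  obtain a :: "real \<Rightarrow> nat \<Rightarrow> real" where a0: "\<And>i. i < n \<Longrightarrow> a 0 i = h1_inner v (e i)"
    and a: "\<And>t i. t \<in> {0..T} \<Longrightarrow> i < n \<Longrightarrow>
      ((\<lambda>s. a s i) has_real_derivative - (\<Sum>k<n. \<Sum>l<n. a t k * a t l * \<beta> i k l)) (at t within {0..T})"
    by (rule energy_preserving_quadratic_ode[OF energy' less_imp_le[OF T], where ?a0.0 = "\<lambda>i. h1_inner v (e i)"]) blast
  define uh where "uh t x = (\<Sum>i<n. a t i * e i x)" for t x
  define q where "q t i = - (\<Sum>k<n. \<Sum>l<n. a t k * a t l * \<beta> i k l)" for t i
  have der: "((\<lambda>s. uh s x) has_real_derivative (\<Sum>i<n. q t i * e i x)) (at t within {0..T})" if t: "t \<in> {0..T}" for t x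
    unfolding uh_def q_def by (intro DERIV_sum DERIV_cmult_right a t) simp
  have td: "time_deriv T uh t = (\<lambda>x. \<Sum>i<n. q t i * e i x)" if t: "t \<in> {0..T}" for t
    by (rule ext, rule time_derivI[OF T t der[OF t]])
  have sol: "h1_inner (time_deriv T uh t) f + ch_form (uh t) (uh t) f = 0" if t: "t \<in> {0..T}" and f: "f \<in> splines r N" for t f
  proof -
    have "h1_inner (time_deriv T uh t) f = (\<Sum>i<n. q t i * h1_inner (e i) f)"
      unfolding td[OF t] by (rule ip_lincomb) (use e f in auto)
    moreover have "ch_form (uh t) (uh t) f = (\<Sum>i<n. h1_inner f (e i) * (\<Sum>k<n. \<Sum>l<n. a t k * a t l * \<beta> i k l))"
      by (subst rep[OF f]) (simp only: uh_def[abs_def] form)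
    ultimately show ?thesis by (simp add: q_def h1_inner_commute[of f] sum_negf mult.commute)
  qed
  have "semidiscrete_solution r N T v uh"
    unfolding semidiscrete_solution_def
  proof (intro conjI ballI allI)
    show "uh t \<in> splines r N" for t unfolding uh_def[abs_def] by (rule lincomb) (use e in auto)
    show "(\<lambda>s. uh s x) differentiable (at t within {0..T})" if "t \<in> {0..T}" for t x
      using der[OF that, of x] by (auto simp: differentiable_def has_field_derivative_def)
    show "uh 0 = v"
      by (subst rep[OF v]) (simp add: uh_def[abs_def] a0)
    show "l2_inner (time_deriv T uh t) f + l2_inner (deriv (time_deriv T uh t)) (deriv f)
        + 3 * l2_inner (\<lambda>x. uh t x * deriv (uh t) x) f
        + 1 / 2 * l2_inner (\<lambda>x. (deriv (uh t) x)\<^sup>2) (deriv f)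
        + l2_inner (\<lambda>x. uh t x * (deriv ^^ 2) (uh t) x) (deriv f) = 0"
      if "f \<in> splines r N" "t \<in> {0..T}" for f t
      using sol[OF that(2,1)] by (simp add: h1_inner_def ch_form_def power2_eq_square)
  qed
  then show ?thesis by (rule that)
qed

text \<open>The derivatives in \<open>x\<close> up to order \<open>m\<close> of \<open>u\<close> and
  of its time derivative are continuous on the compact set [0,T] x [0,1], hence bounded there, and
  periodicity extends the bound. One derivative in time and \<open>m\<close> in space make the order
  \<open>Suc m\<close>.\<close>

lemma C_per_space_time_slices:
  assumes u: "C_per_space_time (Suc m) T u" and T: "T > 0"
  obtains M ut where "\<And>t. t \<in> {0..T} \<Longrightarrow> u t \<in> CB m M" "\<And>t. t \<in> {0..T} \<Longrightarrow> ut t \<in> CB m M"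
    "\<And>t x. t \<in> {0..T} \<Longrightarrow> ((\<lambda>s. u s x) has_real_derivative ut t x) (at t within {0..T})"
proof -
  obtain D :: "nat \<Rightarrow> nat \<Rightarrow> real \<Rightarrow> real \<Rightarrow> real" where
    per: "\<And>t. t \<in> {0..T} \<Longrightarrow> periodic1 (u t)"
    and D0: "\<And>t x. t \<in> {0..T} \<Longrightarrow> D 0 0 t x = u t x"
    and cont: "\<And>i j. i + j \<le> Suc m \<Longrightarrow> continuous_on ({0..T} \<times> UNIV) (\<lambda>(t, x). D i j t x)"
    and dx: "\<And>i j t x. i + j < Suc m \<Longrightarrow> t \<in> {0..T} \<Longrightarrow> (D i j t has_real_derivative D i (Suc j) t x) (at x)"
    and dt: "\<And>i j t x. i + j < Suc m \<Longrightarrow> t \<in> {0..T} \<Longrightarrow> ((\<lambda>s. D i j s x) has_real_derivative D (Suc i) j t x) (at t within {0..T})"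
    using u unfolding C_per_space_time_def by blast
  have D0': "D 0 0 t = u t" if "t \<in> {0..T}" for t using D0[OF that] by auto
  have ut: "((\<lambda>s. u s x) has_real_derivative D 1 0 t x) (at t within {0..T})" if "t \<in> {0..T}" for t x
  proof -
    have "((\<lambda>s. D 0 0 s x) has_real_derivative D 1 0 t x) (at t within {0..T})"
      using dt[of 0 0 t x] that by simp
    then show ?thesis
      by (rule has_field_derivative_transform_within[where d = 1]) (use that D0 in auto)
  qed
  \<comment> \<open>Periodicity is given for \<open>u\<close> only; the time derivatives at
    \<open>x\<close> and \<open>x + 1\<close> are those of the same function of time.\<close>
  have per1: "periodic1 (D 1 0 t)" if t: "t \<in> {0..T}" for t
    unfolding periodic1_def
  proof
    fix x
    show "D 1 0 t (x + 1) = D 1 0 t x"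
    proof (rule real_derivative_unique_within_Icc[OF T t _ ut[OF t]])
      show "((\<lambda>s. u s x) has_real_derivative D 1 0 t (x + 1)) (at t within {0..T})"
        by (rule has_field_derivative_transform_within[OF ut[OF t, of "x + 1"], where d = 1])
          (use t per in \<open>auto simp: periodic1_def\<close>)
    qed
  qed
  have slice: "D i 0 t \<in> C_per m" "\<And>j. j \<le> m \<Longrightarrow> (deriv ^^ j) (D i 0 t) = D i j t"
    if i: "i \<le> 1" and t: "t \<in> {0..T}" for i t
  proof -
    have p: "periodic1 (D i 0 t)"
    proof -
      have "i = 0 \<or> i = 1" using i by auto
      then show ?thesis using per1[OF t] per[OF t] D0'[OF t] by auto
    qed
    have d: "(D i j t has_real_derivative D i (Suc j) t x) (at x)" if "j < m" for j x
      by (rule dx) (use i that t in auto)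
    have "continuous_on UNIV ((\<lambda>(t, x). D i m t x) \<circ> (\<lambda>x. (t, x)))"
      by (intro continuous_on_compose continuous_intros continuous_on_subset[OF cont]) (use i t in auto)
    then have c: "continuous_on UNIV (D i m t)" by (simp add: o_def)
    show "D i 0 t \<in> C_per m" by (rule C_perI(1)[where D = "\<lambda>j. D i j t", OF p refl d c])
    show "(deriv ^^ j) (D i 0 t) = D i j t" if "j \<le> m" for j
      by (rule C_perI(2)[where D = "\<lambda>j. D i j t", OF p refl d c that])
  qed
  have "\<exists>B. \<forall>t\<in>{0..T}. \<forall>x. \<bar>D i j t x\<bar> \<le> B" if i: "i \<le> 1" and j: "j \<le> m" for i j
  proof -
    have "bounded ((\<lambda>(t, x). D i j t x) ` ({0..T} \<times> {0..1}))"
      by (intro compact_imp_bounded compact_continuous_image compact_Times continuous_on_subset[OF cont])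
        (use i j in auto)
    then obtain B where B: "\<And>t x. t \<in> {0..T} \<Longrightarrow> x \<in> {0..1} \<Longrightarrow> \<bar>D i j t x\<bar> \<le> B"
      unfolding bounded_iff by fastforce
    have "\<bar>D i j t x\<bar> \<le> B" if t: "t \<in> {0..T}" for t x
    proof -
      have "periodic1 (D i j t)" using C_per_periodic_deriv[OF slice(1)[OF i t] j] slice(2)[OF i t j] by simp
      then show ?thesis by (rule periodic1_reduce[of _ x]) (use B[OF t] in auto)
    qed
    then show ?thesis by blast
  qed
  then obtain B where B: "\<And>i j t x. i \<le> 1 \<Longrightarrow> j \<le> m \<Longrightarrow> t \<in> {0..T} \<Longrightarrow> \<bar>D i j t x\<bar> \<le> B i j" by metis
  define M where "M = (\<Sum>(i, j)\<in>{..1} \<times> {..m}. \<bar>B i j\<bar>)"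
  have M: "\<bar>D i j t x\<bar> \<le> M" if "i \<le> 1" "j \<le> m" "t \<in> {0..T}" for i j t x
  proof -
    have "\<bar>B i j\<bar> \<le> M"
      unfolding M_def using that member_le_sum[of "(i, j)" "{..1} \<times> {..m}" "\<lambda>(i, j). \<bar>B i j\<bar>"] by auto
    then show ?thesis using B[OF that, of x] by linarith
  qed
  show ?thesis
  proof (rule that[of M "D 1 0"])
    show "u t \<in> CB m M" if "t \<in> {0..T}" for t
      using slice[of 0 t] M[of 0 _ t] that unfolding CB_def D0'[OF that, symmetric] by simp
    show "D 1 0 t \<in> CB m M" if "t \<in> {0..T}" for t
      using slice[of 1 t] M[of 1 _ t] that unfolding CB_def by simp
  qed (rule ut)
qed

theorem proposition3p2:
  fixes r :: nat and \<phi> :: "nat \<Rightarrow> nat \<Rightarrow> real \<Rightarrow> real"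
  assumes "r \<ge> 3"
    and "quasi_interp_basis r \<phi>"
  shows "\<exists>k. \<forall>T>0. \<forall>u u0.
    C_per_space_time k T u \<and> camassa_holm_solution T u0 u \<longrightarrow>
    (\<exists>C. \<exists>h0>0. \<forall>N\<ge>1. 1 / real N \<le> h0 \<longrightarrow>
      (\<exists>uh. semidiscrete_solution r N T (quasi_interp \<phi> N u0) uh \<and>
        (\<forall>vh. semidiscrete_solution r N T (quasi_interp \<phi> N u0) vh \<longrightarrow>
          (\<forall>t\<in>{0..T}. vh t = uh t)) \<and>
        (\<forall>t\<in>{0..T}. l2_norm (\<lambda>x. u t x - uh t x) \<le> C * (1 / real N) ^ r)))"
proof -
  note r = assms(1) and \<phi> = assms(2)
  obtain m where m: "m \<ge> 5"
    and cons: "\<And>M. \<exists>C\<ge>0. \<forall>v\<in>CB m M. \<forall>vt\<in>CB m M. \<forall>N f. ch_equation v vt \<longrightarrow> N \<ge> 1 \<longrightarrow> f \<in> splines r N \<longrightarrow>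
      \<bar>h1_inner (quasi_interp \<phi> N vt) f + ch_form (quasi_interp \<phi> N v) (quasi_interp \<phi> N v) f\<bar>
        \<le> C * (1 / real N) ^ r * sqrt (h1_inner f f)"
    and bnd: "\<And>M. \<exists>B\<ge>0. \<forall>v\<in>CB m M. \<forall>N\<ge>1. \<forall>k\<le>2. \<forall>x\<in>{0..1} - mesh N. \<bar>(deriv ^^ k) (quasi_interp \<phi> N v) x\<bar> \<le> B"
    and err: "\<And>M. \<exists>C\<ge>0. \<forall>v\<in>CB m M. \<forall>N\<ge>1. l2_norm (\<lambda>x. quasi_interp \<phi> N v x - v x) \<le> C * (1 / real N) ^ r"
    by (rule ch_consistency[OF r \<phi>]) blast
  have "\<exists>C. \<exists>h0>0. \<forall>N\<ge>1. 1 / real N \<le> h0 \<longrightarrow>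
      (\<exists>uh. semidiscrete_solution r N T (quasi_interp \<phi> N u0) uh \<and>
        (\<forall>vh. semidiscrete_solution r N T (quasi_interp \<phi> N u0) vh \<longrightarrow>
          (\<forall>t\<in>{0..T}. vh t = uh t)) \<and>
        (\<forall>t\<in>{0..T}. l2_norm (\<lambda>x. u t x - uh t x) \<le> C * (1 / real N) ^ r))"
    if T: "T > 0" and u: "C_per_space_time (Suc m) T u" and ch: "camassa_holm_solution T u0 u" for T u u0
  proof -
    obtain M ut where uM: "\<And>t. t \<in> {0..T} \<Longrightarrow> u t \<in> CB m M" and utM: "\<And>t. t \<in> {0..T} \<Longrightarrow> ut t \<in> CB m M"
      and ut: "\<And>t x. t \<in> {0..T} \<Longrightarrow> ((\<lambda>s. u s x) has_real_derivative ut t x) (at t within {0..T})"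
      by (rule C_per_space_time_slices[OF u T]) blast
    obtain C1 where C1: "C1 \<ge> 0" "\<And>v vt N f. v \<in> CB m M \<Longrightarrow> vt \<in> CB m M \<Longrightarrow>
      ch_equation v vt \<Longrightarrow> N \<ge> 1 \<Longrightarrow> f \<in> splines r N \<Longrightarrow>
      \<bar>h1_inner (quasi_interp \<phi> N vt) f + ch_form (quasi_interp \<phi> N v) (quasi_interp \<phi> N v) f\<bar>
        \<le> C1 * (1 / real N) ^ r * sqrt (h1_inner f f)"
      using cons[of M] by blast
    obtain B where B: "B \<ge> 0" "\<And>v N k x. v \<in> CB m M \<Longrightarrow> N \<ge> 1 \<Longrightarrow> k \<le> 2 \<Longrightarrow> x \<in> {0..1} - mesh N \<Longrightarrow>
        \<bar>(deriv ^^ k) (quasi_interp \<phi> N v) x\<bar> \<le> B"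
      using bnd[of M] by blast
    obtain C2 where C2: "C2 \<ge> 0" "\<And>v N. v \<in> CB m M \<Longrightarrow> N \<ge> 1 \<Longrightarrow>
        l2_norm (\<lambda>x. quasi_interp \<phi> N v x - v x) \<le> C2 * (1 / real N) ^ r"
      using err[of M] by blast
    have td: "time_deriv T u t = ut t" if "t \<in> {0..T}" for t
      by (rule ext, rule time_derivI[OF T that ut[OF that]])
    have pde: "ch_equation (u t) (ut t)" if "t \<in> {0..T}" for t
      using ch td[OF that] that unfolding camassa_holm_solution_def ch_equation_def by metis
    define G where "G = T * exp ((10 * B + 1) * T)"
    have G: "0 \<le> G" using T by (simp add: G_def)
    \<comment> \<open>Interpolation error and energy estimate, added as squares.\<close>
    define C where "C = sqrt (2 * C2\<^sup>2 + 2 * (C1\<^sup>2 * G))"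
    have C: "0 \<le> C" "C\<^sup>2 = 2 * C2\<^sup>2 + 2 * (C1\<^sup>2 * G)" using G by (simp_all add: C_def)
    have main: "\<exists>uh. semidiscrete_solution r N T (quasi_interp \<phi> N u0) uh \<and>
        (\<forall>vh. semidiscrete_solution r N T (quasi_interp \<phi> N u0) vh \<longrightarrow> (\<forall>t\<in>{0..T}. vh t = uh t)) \<and>
        (\<forall>t\<in>{0..T}. l2_norm (\<lambda>x. u t x - uh t x) \<le> C * (1 / real N) ^ r)" if N: "N \<ge> 1" for N
    proof -
      have basis: "is_spline_basis r N (\<phi> N)" using \<phi> N by (simp add: quasi_interp_basis_def)
      have QV: "quasi_interp \<phi> N v \<in> splines r N" for v by (rule quasi_interp_in_splines[of r N \<phi>, OF basis])
      \<comment> \<open>\<open>u0\<close> and \<open>u 0\<close> are only known to agree on [0,1];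
        the quasiinterpolant reads nothing but the nodes there.\<close>
      have Q0: "quasi_interp \<phi> N u0 = quasi_interp \<phi> N (u 0)"
        unfolding quasi_interp_def
        using ch N by (intro ext sum.cong refl) (auto simp: camassa_holm_solution_def)
      define \<epsilon> where "\<epsilon> = (1 / real N) ^ r"
      have \<epsilon>: "0 \<le> \<epsilon>" by (simp add: \<epsilon>_def)
      obtain uh where uh: "semidiscrete_solution r N T (quasi_interp \<phi> N u0) uh"
        by (rule semidiscrete_solution_exists[OF r N basis T QV])
      have "l2_norm (\<lambda>x. u t x - uh t x) \<le> C * \<epsilon>" if t: "t \<in> {0..T}" for t
      proof -
        let ?w = "\<lambda>t. quasi_interp \<phi> N (u t)"
        let ?e = "\<lambda>x. ?w t x - uh t x"
        have h1: "h1_inner ?e ?e \<le> (C1 * \<epsilon>)\<^sup>2 * T * exp ((10 * B + 1) * T)"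
        proof (rule semidiscrete_energy_estimate[OF r N basis T, where w = ?w and w' = "\<lambda>t. quasi_interp \<phi> N (ut t)"])
          show "((\<lambda>s. ?w s x) has_real_derivative quasi_interp \<phi> N (ut t) x) (at t within {0..T})"
            if "t \<in> {0..T}" for t x
            unfolding quasi_interp_def by (intro DERIV_sum DERIV_cmult_right ut that)
          show "\<bar>h1_inner (quasi_interp \<phi> N (ut t)) f + ch_form (?w t) (?w t) f\<bar> \<le> C1 * \<epsilon> * sqrt (h1_inner f f)"
            if "t \<in> {0..T}" "f \<in> splines r N" for t f
            unfolding \<epsilon>_def by (rule C1(2)[OF uM[OF that(1)] utM[OF that(1)] pde[OF that(1)] N that(2)])
          show "\<bar>(deriv ^^ k) (?w t) x\<bar> \<le> B" if "t \<in> {0..T}" "k \<le> 2" "x \<in> {0..1} - mesh N" for t k x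
            by (rule B(2)[OF uM[OF that(1)] N that(2,3)])
        qed (use QV B(1) uh t Q0 in auto)
        have eV: "?e \<in> splines r N"
          using function_space.add_cmult[OF splines_function_space QV semidiscrete_solutionD(1)[OF uh t], where c = "-1"] by simp
        note W = splines_W2[OF r N]
        have pwu: "pw (u t)" by (rule W2D(6)[OF CB_W2[OF uM[OF t]]]) (use m in simp)
        have pww: "pw (?w t)" and pwuh: "pw (uh t)"
          by (rule W2D(6)[OF W[OF QV]], rule W2D(6)[OF W[OF semidiscrete_solutionD(1)[OF uh t]]])
        have "(l2_norm (\<lambda>x. u t x - uh t x))\<^sup>2 \<le> 2 * (l2_norm (\<lambda>x. u t x - ?w t x))\<^sup>2 + 2 * (l2_norm ?e)\<^sup>2"
          by (rule l2_norm_diff_power2_le[OF pwu pww pwuh])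
        also have "\<dots> \<le> 2 * (C2 * \<epsilon>)\<^sup>2 + 2 * ((C1 * \<epsilon>)\<^sup>2 * G)"
        proof (intro add_mono mult_left_mono)
          have "l2_norm (\<lambda>x. u t x - ?w t x) = l2_norm (\<lambda>x. ?w t x - u t x)"
            unfolding l2_norm_def l2_inner_def by (intro arg_cong[where f = sqrt] integral_cong) (simp add: algebra_simps)
          also have "\<dots> \<le> C2 * \<epsilon>" unfolding \<epsilon>_def by (rule C2(2)[OF uM[OF t] N])
          finally show "(l2_norm (\<lambda>x. u t x - ?w t x))\<^sup>2 \<le> (C2 * \<epsilon>)\<^sup>2"
            by (rule power_mono) (rule l2_norm_nonneg[OF pw_diff[OF pwu pww]])
          have "(l2_norm ?e)\<^sup>2 \<le> h1_inner ?e ?e"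
            using l2_norm_power2[OF W2D(6)[OF W[OF eV]]] l2_inner_nonneg[OF W2D(7)[OF W[OF eV]]]
            by (simp add: h1_inner_def)
          then show "(l2_norm ?e)\<^sup>2 \<le> (C1 * \<epsilon>)\<^sup>2 * G" using h1 by (simp add: G_def mult.assoc)
        qed auto
        also have "\<dots> = (C * \<epsilon>)\<^sup>2" by (simp add: power_mult_distrib C(2) algebra_simps)
        finally show ?thesis by (rule power2_le_imp_le) (use C(1) \<epsilon> in simp)
      qed
      then show ?thesis
        using uh semidiscrete_solution_unique[OF r N basis T uh] unfolding \<epsilon>_def by blast
    qed
    \<comment> \<open>The estimate holds on every mesh, so \<open>h0 = 1\<close> serves.\<close>
    show ?thesis by (intro exI[of _ C] exI[of _ 1]) (use main in auto)
  qed
  then show ?thesis by (intro exI[of _ "Suc m"]) blast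
qed

end
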